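(* Let $d$ be a positive integer. There exists $\epsilon=\epsilon(d)>0$ such that for any $\delta>0$ there exists a positive integer $k=k(d,\delta)$ with the following property. For all positive integers $n_1,\dots,n_d$, for any $\mathcal B'\subset\mathcal B$ with $|\mathcal B'|\ge\delta|\mathcal B|$ and any $\mathcal A\subset\mathcal G$ which is $(\mathcal B',1-\epsilon)$-closed, there exists a $k$-simple set $\mathcal D\subset\mathcal G$ which has $|\mathcal D\cap\mathcal A|\ge\frac12|\mathcal D|$.
   Context: $\mathcal G=\mathbb F_2^{n_1}\otimes\dots\otimes\mathbb F_2^{n_d}$. $\mathcal B$ is the multiset $\{u_1\otimes\dots\otimes u_d: u_i\in\mathbb F_2^{n_i}\text{ for all }i\}$, with one element for each tuple $(u_1,\dots,u_d)$ (zero vectors allowed, so $|\mathcal B|=2^{n_1+\dots+n_d}$). $\mathcal B'\subset\mathcal B$ denotes a sub-multiset; sizes of multisets are counted with multiplicity. For a finite non-empty subset $A$ of an Abelian group and a finite non-empty (multi)set $B$ of elements of the group, $A$ is $(B,\eta)$-closed if $|\{(a,b)\in A\times B: a+b\in A\}|\ge\eta|A||B|$ (elements of $B$ counted with multiplicity). For a non-empty $I\subset[d]=\{1,\dots,d\}$ write $\mathbb F_2^I=\bigotimes_{i\in I}\mathbb F_2^{n_i}$ and $I^c=[d]\setminus I$, so that $\mathcal G=\mathbb F_2^I\otimes\mathbb F_2^{I^c}$ naturally. A set $\mathcal C\subset\mathcal G$ is $k$-simple if there exist subspaces $H_I\subset\mathbb F_2^I$ of codimension at most $k$, one for each non-empty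 $I\subset[d]$, such that $\mathcal C$ is a translate of $\bigcap_{I\subset[d],I\ne\emptyset}(H_I\otimes\mathbb F_2^{I^c})$, where $H_{[d]}\otimes\mathbb F_2^{\emptyset}$ means $H_{[d]}$. *)

theory Defs
  imports Complex_Main "HOL-Library.Z2" "HOL-Library.Function_Algebras"
    "HOL-Library.FuncSet" "HOL-Library.Multiset"
begin

(* Tensors over F_2 are coordinate arrays: an element of the tensor product of the F_2^(n i)
   for i in I is a function on the multi-indices j with j i < n i for i in I.  Multi-indices
   are extensional functions and arrays vanish off the multi-indices, so that all the spaces
   F_2^I live in the single type tensor.  For I = {} there is exactly one multi-index,
   so F_2^{} is the field itself. *)

type_synonym multi_index = "nat \<Rightarrow> nat"
type_synonym tensor = "multi_index \<Rightarrow> bit"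

definition multi_indices :: "(nat \<Rightarrow> nat) \<Rightarrow> nat set \<Rightarrow> multi_index set" where
  "multi_indices n I = (\<Pi>\<^sub>E i\<in>I. {..<n i})"

definition tensor_space :: "(nat \<Rightarrow> nat) \<Rightarrow> nat set \<Rightarrow> tensor set" where
  "tensor_space n I = {x. \<forall>j. j \<notin> multi_indices n I \<longrightarrow> x j = 0}"

definition tensor_scale :: "bit \<Rightarrow> tensor \<Rightarrow> tensor" where
  "tensor_scale c x = (\<lambda>j. c * x j)"

interpretation F2: vector_space tensor_scale
  by unfold_locales (auto simp: tensor_scale_def algebra_simps fun_eq_iff)

abbreviation full_space :: "nat \<Rightarrow> (nat \<Rightarrow> nat) \<Rightarrow> tensor set" where
  "full_space d n \<equiv> tensor_space n {1..d}"

definition vec_space :: "nat \<Rightarrow> (nat \<Rightarrow> bit) set" where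
  "vec_space m = {v. \<forall>j\<ge>m. v j = 0}"

definition pure_tensor :: "nat \<Rightarrow> (nat \<Rightarrow> nat) \<Rightarrow> (nat \<Rightarrow> nat \<Rightarrow> bit) \<Rightarrow> tensor" where
  "pure_tensor d n u =
     (\<lambda>j. if j \<in> multi_indices n {1..d} then \<Prod>i=1..d. u i (j i) else 0)"

definition pure_tensors :: "nat \<Rightarrow> (nat \<Rightarrow> nat) \<Rightarrow> tensor multiset" where
  "pure_tensors d n =
     image_mset (pure_tensor d n) (mset_set (\<Pi>\<^sub>E i\<in>{1..d}. vec_space (n i)))"

lemma bij_vec_space: "bij_betw (\<lambda>S j. if j \<in> S then 1 else 0) (Pow {..<m}) (vec_space m)"
proof (rule bij_betw_byWitness[where f' = "\<lambda>v. {j. v j = 1}"])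
  show "(\<lambda>S j. if j \<in> S then 1 else 0) ` Pow {..<m} \<subseteq> vec_space m"
    by (auto simp: vec_space_def)
  show "(\<lambda>v. {j. v j = 1}) ` vec_space m \<subseteq> Pow {..<m}"
    by (auto simp: vec_space_def) (metis not_le zero_neq_one)
qed (auto simp: fun_eq_iff)

lemma finite_vec_space: "finite (vec_space m)"
  using bij_betw_finite[OF bij_vec_space] by simp

lemma card_vec_space: "card (vec_space m) = 2 ^ m"
  using bij_betw_same_card[OF bij_vec_space] by (simp add: card_Pow)

lemma size_pure_tensors: "size (pure_tensors d n) = 2 ^ (\<Sum>i=1..d. n i)"
  by (simp add: pure_tensors_def card_PiE card_vec_space power_sum)

definition closed_wrt :: "'a::ab_group_add multiset \<Rightarrow> real \<Rightarrow> 'a set \<Rightarrow> bool" where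
  "closed_wrt B \<eta> A \<longleftrightarrow>
     finite A \<and> A \<noteq> {} \<and> B \<noteq> {#} \<and>
     real (\<Sum>a\<in>A. size {#b \<in># B. a + b \<in> A#}) \<ge> \<eta> * real (card A) * real (size B)"

(* The natural bilinear map from F_2^I x F_2^J to F_2^(I Un J), for disjoint I and J. *)
definition tensor_mult ::
  "(nat \<Rightarrow> nat) \<Rightarrow> nat set \<Rightarrow> nat set \<Rightarrow> tensor \<Rightarrow> tensor \<Rightarrow> tensor" where
  "tensor_mult n I J x y =
     (\<lambda>j. if j \<in> multi_indices n (I \<union> J) then x (restrict j I) * y (restrict j J) else 0)"

definition subspace_tensor ::
  "(nat \<Rightarrow> nat) \<Rightarrow> nat set \<Rightarrow> nat set \<Rightarrow> tensor set \<Rightarrow> tensor set \<Rightarrow> tensor set" where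
  "subspace_tensor n I J U V = F2.span {tensor_mult n I J x y | x y. x \<in> U \<and> y \<in> V}"

(* For I = {1..d} the factor below is H {1..d} tensored with F_2^{}; this equals H {1..d}
   by subspace_tensor_empty. *)
definition simple :: "nat \<Rightarrow> nat \<Rightarrow> (nat \<Rightarrow> nat) \<Rightarrow> tensor set \<Rightarrow> bool" where
  "simple k d n C \<longleftrightarrow>
     (\<exists>H :: nat set \<Rightarrow> tensor set.
        (\<forall>I. I \<subseteq> {1..d} \<and> I \<noteq> {} \<longrightarrow>
           F2.subspace (H I) \<and> H I \<subseteq> tensor_space n I \<and>
           F2.dim (tensor_space n I) - F2.dim (H I) \<le> k) \<and>
        (\<exists>t\<in>full_space d n.
           C = (+) t ` (\<Inter>I\<in>{I. I \<subseteq> {1..d} \<and> I \<noteq> {}}.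
             subspace_tensor n I ({1..d} - I) (H I) (tensor_space n ({1..d} - I)))))"

lemma subspace_tensor_empty:
  assumes H: "F2.subspace H" "H \<subseteq> tensor_space n I"
  shows "subspace_tensor n I {} H (tensor_space n {}) = H"
proof -
  have eq: "tensor_mult n I {} x y = tensor_scale (y (\<lambda>_. undefined)) x"
    if "x \<in> H" for x y
  proof
    fix j
    show "tensor_mult n I {} x y j = tensor_scale (y (\<lambda>_. undefined)) x j"
    proof (cases "j \<in> multi_indices n I")
      case True
      then have "restrict j I = j"
        unfolding multi_indices_def by (rule PiE_restrict)
      with True show ?thesis
        by (simp add: tensor_mult_def tensor_scale_def restrict_def mult.commute)
    next
      case False
      then have "x j = 0" using that H(2) by (auto simp: tensor_space_def)
      with False show ?thesis by (simp add: tensor_mult_def tensor_scale_def)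
    qed
  qed
  have "{tensor_mult n I {} x y | x y. x \<in> H \<and> y \<in> tensor_space n {}} = H" (is "?S = H")
  proof
    show "?S \<subseteq> H" using H(1) by (auto simp: eq intro: F2.subspace_scale)
    show "H \<subseteq> ?S"
    proof
      fix x assume x: "x \<in> H"
      define e :: tensor where "e = (\<lambda>j. if j = (\<lambda>_. undefined) then 1 else 0)"
      have "e \<in> tensor_space n {}"
        by (auto simp: e_def tensor_space_def multi_indices_def)
      moreover have "x = tensor_mult n I {} x e"
        using x by (simp add: eq e_def)
      ultimately show "x \<in> ?S" using x by blast
    qed
  qed
  then show ?thesis
    using H(1) by (simp add: subspace_tensor_def)
qed

end

theory Submission
  imports Defs
begin

text \<open>
  Identify tensors with multilinear forms through their values at pure tensors.  Expanding in Fourier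
  series, the hypothesis says that at least half of the spectral mass of \<open>A\<close> sits on tensors \<open>r\<close>
  whose form vanishes at all but a proportion \<open>\<epsilon>\<close> of \<open>B'\<close>.  If all these \<open>r\<close> lie in a sum of spaces
  \<open>V\<^sub>I \<otimes> F\<^sup>I\<^sup>c\<close> with \<open>dim V\<^sub>I \<le> k\<close>, then the simple subspace annihilated by this sum has a translate in
  which \<open>A\<close> has density at least a half.

  Such spaces \<open>V\<^sub>I\<close> are found by induction on the number of coordinates.  A second moment argument
  shows that up to forms of positive bias there are only boundedly many \<open>r\<close>, and the induction
  hypothesis, applied to the set where all slices \<open>t(u, \<sqdot>)\<close> of such a form \<open>t\<close> vanish, turns
  positive bias into bounded partition rank.  The remaining sums of boundedly many products are treated
  one type of block \<open>I\<close> at a time, larger blocks first: slicing along the complement of \<open>I\<close>, the induction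
  hypothesis confines the factors on \<open>I\<close> to a bounded space modulo products of smaller blocks, and a
  potential argument makes this space independent of \<open>r\<close>.  After each step the set of test points is
  replaced by a set of differences on which the forms found so far vanish, so that the part of \<open>r\<close>
  already dealt with can be subtracted.
\<close>

section \<open>Multilinear forms over the two-element field\<close>

text \<open>The obstacle is the order of quantifiers: the admissible error may depend on the set of
  coordinates only, whereas the density shrinks from step to step and the number of forms grows as
  it does. Restricting the test points to the common zeros of k forms can raise the relative error
  by a factor that grows with k. Differences of points with equal values cost a factor 4 per
  coordinate, however many forms there are: an additive function nonzero at u + u' is nonzero at u
  or at u', and both are distributed like the old points, up to a discarded part. Such differences
  are not uniform on a set, hence weights instead of sets.

  Larger blocks come first because slicing along the complement of \<open>I\<close> turns a product
  of blocks not containing \<open>I\<close> into a product of proper subsets of \<open>I\<close>,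
  which counts as low rank inside the slice. There the factors on \<open>I\<close> become visible,
  but only where their cofactors are nonzero. A cofactor that is mostly zero is itself confined by
  the induction hypothesis on the complement; any other one exposes, on many slices, a factor
  missing from the current space, which is what makes the potential grow.\<close>

type_synonym tuple = "nat \<Rightarrow> nat \<Rightarrow> bit"
type_synonym form = "tuple \<Rightarrow> bit"

text \<open>With these simp rules active, sums and products of bits turn into bitwise operations,
  out of reach of the ring laws and sum lemmas used below.\<close>

declare bit_not_zero_iff [simp del] bit_not_one_iff [simp del]
  add_bit_eq_xor [simp del] mult_bit_eq_and [simp del]

lemma bit_add_self [simp]: "(b::bit) + b = 0"
  by (cases b) auto

lemma bit_add_eq_iff: "(a::bit) + b = c \<longleftrightarrow> a = b + c"
  by (cases a; cases b; cases c) auto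

lemma bit_neq_0_iff: "(b::bit) \<noteq> 0 \<longleftrightarrow> b = 1"
  by (cases b) auto

text \<open>Zero padding instead of extensional functions: tuples over disjoint coordinate sets are
  glued by plain addition, and all tuples live in one group of exponent 2.\<close>

definition tuples :: "(nat \<Rightarrow> nat) \<Rightarrow> nat set \<Rightarrow> tuple set" where
  "tuples n I = {u. \<forall>i j. u i j \<noteq> 0 \<longrightarrow> i \<in> I \<and> j < n i}"

definition proj :: "(nat \<Rightarrow> nat) \<Rightarrow> nat set \<Rightarrow> tuple \<Rightarrow> tuple" where
  "proj n I u = (\<lambda>i j. if i \<in> I \<and> j < n i then u i j else 0)"

lemma tuplesD: "u \<in> tuples n I \<Longrightarrow> i \<notin> I \<or> \<not> j < n i \<Longrightarrow> u i j = 0"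
  by (auto simp: tuples_def)

lemma proj_tuples [simp]: "proj n I u \<in> tuples n I"
  by (auto simp: proj_def tuples_def)

lemma proj_id [simp]: "u \<in> tuples n I \<Longrightarrow> proj n I u = u"
  by (auto simp: proj_def tuples_def fun_eq_iff)

lemma tuples_add: "u \<in> tuples n I \<Longrightarrow> v \<in> tuples n I \<Longrightarrow> u + v \<in> tuples n I"
  by (auto simp: tuples_def) (metis add.right_neutral)+

lemma tuple_add_self [simp]: "(u::tuple) + u = 0"
  by (auto simp: fun_eq_iff)

lemma tuple_add_self_left [simp]: "(u::tuple) + (u + v) = v"
  by (auto simp: fun_eq_iff)

lemma zero_tuples [simp]: "0 \<in> tuples n I"
  by (auto simp: tuples_def)

lemma finite_tuples [simp]:
  assumes "finite I" shows "finite (tuples n I)"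
proof -
  have "tuples n I \<subseteq> (\<lambda>S i j. if (i, j) \<in> S then 1 else 0) ` Pow (Sigma I (\<lambda>i. {..<n i}))"
  proof
    fix u assume u: "u \<in> tuples n I"
    have "u = (\<lambda>i j. if (i, j) \<in> {(i, j). u i j \<noteq> 0} then 1 else 0)"
      by (intro ext, rename_tac i j, case_tac "u i j") simp_all
    moreover have "{(i, j). u i j \<noteq> 0} \<in> Pow (Sigma I (\<lambda>i. {..<n i}))"
      using u by (auto simp: tuples_def)
    ultimately show "u \<in> (\<lambda>S i j. if (i, j) \<in> S then 1 else 0) ` Pow (Sigma I (\<lambda>i. {..<n i}))"
      by (rule image_eqI)
  qed
  moreover have "finite (Pow (Sigma I (\<lambda>i. {..<n i})))" using assms by auto
  ultimately show ?thesis by (meson finite_imageI finite_subset)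
qed

lemma card_tuples_pos [simp]: "finite I \<Longrightarrow> card (tuples n I) > 0"
  using zero_tuples[of n I] by (metis card_gt_0_iff empty_iff finite_tuples)

lemma bij_tuples_split:
  assumes "I \<subseteq> D"
  shows "bij_betw (\<lambda>(x, y). x + y) (tuples n (D - I) \<times> tuples n I) (tuples n D)"
proof (rule bij_betw_byWitness[where f' = "\<lambda>u. (proj n (D - I) u, proj n I u)"])
  show "\<forall>a\<in>tuples n (D - I) \<times> tuples n I.
       (\<lambda>u. (proj n (D - I) u, proj n I u)) (case a of (x, y) \<Rightarrow> x + y) = a"
    by (auto simp: proj_def tuples_def fun_eq_iff)
  show "\<forall>a'\<in>tuples n D. (case (proj n (D - I) a', proj n I a') of (x, y) \<Rightarrow> x + y) = a'"
    using assms by (auto simp: proj_def tuples_def fun_eq_iff)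
  show "(\<lambda>(x, y). x + y) ` (tuples n (D - I) \<times> tuples n I) \<subseteq> tuples n D"
    using assms by (auto simp: tuples_def) (metis DiffD1 add_0 subsetD)+
qed auto

lemma sum_tuples_split:
  assumes "I \<subseteq> D" "finite D"
  shows "(\<Sum>s\<in>tuples n D. F s) = (\<Sum>x\<in>tuples n (D - I). \<Sum>y\<in>tuples n I. F (x + y))"
  using assms sum.reindex_bij_betw[OF bij_tuples_split[OF assms(1)], of F n, symmetric]
  by (simp add: sum.cartesian_product case_prod_unfold)

lemma card_tuples_split:
  assumes "I \<subseteq> D"
  shows "card (tuples n D) = card (tuples n (D - I)) * card (tuples n I)"
  using bij_betw_same_card[OF bij_tuples_split[OF assms, of n]] by (simp add: card_cartesian_product)

text \<open>A form is a function on all tuples, and the first clause makes it depend on the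
  coordinates in \<open>I\<close> only. Forms on different coordinate sets thus share one type and
  multiply pointwise, and forms on the empty set are the constants. Over two elements, additivity in
  each coordinate is full linearity.\<close>

definition multilinear :: "(nat \<Rightarrow> nat) \<Rightarrow> nat set \<Rightarrow> form \<Rightarrow> bool" where
  "multilinear n I f \<longleftrightarrow> (\<forall>u. f (proj n I u) = f u) \<and>
     (\<forall>i\<in>I. \<forall>u a b. f (u(i := a + b)) = f (u(i := a)) + f (u(i := b)))"

lemma multilinear_cong:
  assumes "multilinear n I f" "\<And>i j. i \<in> I \<Longrightarrow> j < n i \<Longrightarrow> u i j = v i j"
  shows "f u = f v"
proof -
  have "proj n I u = proj n I v" using assms(2) by (auto simp: proj_def fun_eq_iff)
  then show ?thesis using assms(1) unfolding multilinear_def by metis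
qed

lemma multilinear_add_coord:
  "multilinear n I f \<Longrightarrow> i \<in> I \<Longrightarrow> f (u(i := a + b)) = f (u(i := a)) + f (u(i := b))"
  by (auto simp: multilinear_def)

lemma multilinearI:
  assumes "\<And>u v. (\<And>i j. i \<in> I \<Longrightarrow> j < n i \<Longrightarrow> u i j = v i j) \<Longrightarrow> f u = f v"
    "\<And>i u a b. i \<in> I \<Longrightarrow> f (u(i := a + b)) = f (u(i := a)) + f (u(i := b))"
  shows "multilinear n I f"
  unfolding multilinear_def
  by (intro conjI allI ballI assms) (auto simp: proj_def)

lemma multilinear_0 [simp]: "multilinear n I (\<lambda>u. 0)"
  by (simp add: multilinear_def)

lemma multilinear_add:
  "multilinear n I f \<Longrightarrow> multilinear n I g \<Longrightarrow> multilinear n I (\<lambda>u. f u + g u)"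
  by (auto simp: multilinear_def algebra_simps)

lemma multilinear_sum:
  "(\<And>x. x \<in> A \<Longrightarrow> multilinear n I (f x)) \<Longrightarrow> multilinear n I (\<lambda>u. \<Sum>x\<in>A. f x u)"
  by (induction A rule: infinite_finite_induct) (auto intro: multilinear_add)

lemma multilinear_cmult: "multilinear n I f \<Longrightarrow> multilinear n I (\<lambda>u. c * f u)"
  by (auto simp: multilinear_def algebra_simps)

lemma multilinear_const [simp]: "multilinear n {} (\<lambda>u. c)"
  by (simp add: multilinear_def)

lemma multilinear_emptyD: "multilinear n {} f \<Longrightarrow> f u = f v"
  by (rule multilinear_cong) auto

lemma multilinear_upd:
  assumes "multilinear n I f" "i \<notin> I" shows "f (u(i := a)) = f u"
  by (rule multilinear_cong[OF assms(1)]) (use assms(2) in auto)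

lemma multilinear_mult:
  assumes f: "multilinear n I f" and g: "multilinear n J g" and "I \<inter> J = {}"
  shows "multilinear n (I \<union> J) (\<lambda>u. f u * g u)"
proof (rule multilinearI)
  fix u v :: tuple assume "\<And>i j. i \<in> I \<union> J \<Longrightarrow> j < n i \<Longrightarrow> u i j = v i j"
  then have "f u = f v" "g u = g v"
    by (auto intro!: multilinear_cong[OF f] multilinear_cong[OF g])
  then show "f u * g u = f v * g v" by simp
next
  fix i u a b assume "i \<in> I \<union> J"
  then consider "i \<in> I" "i \<notin> J" | "i \<in> J" "i \<notin> I" using assms(3) by auto
  then show "f (u(i := a + b)) * g (u(i := a + b)) =
      f (u(i := a)) * g (u(i := a)) + f (u(i := b)) * g (u(i := b))"
    by cases (simp_all add: multilinear_upd[OF f] multilinear_upd[OF g]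
        multilinear_add_coord[OF f] multilinear_add_coord[OF g] algebra_simps)
qed

text \<open>The projection makes the result depend on the coordinates in \<open>I\<close> only, as a
  form on \<open>I\<close> must.\<close>

definition slice :: "(nat \<Rightarrow> nat) \<Rightarrow> nat set \<Rightarrow> tuple \<Rightarrow> form \<Rightarrow> form" where
  "slice n I x f = (\<lambda>y. f (x + proj n I y))"

lemma multilinear_slice:
  assumes f: "multilinear n J f" and x: "x \<in> tuples n K" and "K \<inter> I = {}"
  shows "multilinear n (J \<inter> I) (slice n I x f)"
proof (rule multilinearI)
  fix u v :: tuple assume "\<And>i j. i \<in> J \<inter> I \<Longrightarrow> j < n i \<Longrightarrow> u i j = v i j"
  then show "slice n I x f u = slice n I x f v"
    unfolding slice_def by (intro multilinear_cong[OF f]) (auto simp: proj_def)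
next
  fix i u a b assume i: "i \<in> J \<inter> I"
  \<comment> \<open>The projection cuts off the entries of \<open>a\<close> beyond
    \<open>n i\<close>, so an update of the argument appears as an update by the truncated
    vector.\<close>
  define t where "t = (\<lambda>a::nat \<Rightarrow> bit. \<lambda>j. if j < n i then a j else 0)"
  have eq: "x + proj n I (u(i := a)) = (x + proj n I u)(i := t a)" for a
    using i assms(3) tuplesD[OF x, of i] by (auto simp: proj_def t_def fun_eq_iff)
  have t: "t (a + b) = t a + t b" by (auto simp: t_def fun_eq_iff)
  show "slice n I x f (u(i := a + b)) = slice n I x f (u(i := a)) + slice n I x f (u(i := b))"
    unfolding slice_def eq t using multilinear_add_coord[OF f] i by auto
qed

lemma slice_id:
  assumes f: "multilinear n J f" and "J \<subseteq> I" "x \<in> tuples n K" "K \<inter> I = {}"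
  shows "slice n I x f = f"
proof
  fix u show "slice n I x f u = f u"
    unfolding slice_def using assms(2-) tuplesD[OF assms(3)]
    by (intro multilinear_cong[OF f]) (auto simp: proj_def)
qed

lemma slice_const:
  assumes f: "multilinear n J f" and "J \<inter> I = {}"
  shows "slice n I x f = (\<lambda>_. f x)"
proof
  fix u show "slice n I x f u = f x"
    unfolding slice_def using assms(2)
    by (intro multilinear_cong[OF f]) (auto simp: proj_def)
qed

lemma slice_eq: "y \<in> tuples n I \<Longrightarrow> slice n I x f y = f (x + y)"
  by (simp add: slice_def)

text \<open>A pair \<open>(J, g)\<close> is a form \<open>g\<close> on the coordinates in \<open>J\<close>.  If the forms paired with \<open>J\<close>
  span \<open>V\<^sub>J\<close>, then \<open>ideal n D G\<close> is the sum of the spaces \<open>V\<^sub>J \<otimes> F\<^sup>D\<^sup>-\<^sup>J\<close>, the annihilator of a simple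
  subspace.\<close>

definition generators :: "(nat \<Rightarrow> nat) \<Rightarrow> nat set \<Rightarrow> (nat set \<times> form) set \<Rightarrow> bool" where
  "generators n D G \<longleftrightarrow> finite G \<and> (\<forall>(J, g)\<in>G. J \<subseteq> D \<and> J \<noteq> {} \<and> multilinear n J g)"

definition ideal :: "(nat \<Rightarrow> nat) \<Rightarrow> nat set \<Rightarrow> (nat set \<times> form) set \<Rightarrow> form set" where
  "ideal n D G = {r. \<exists>h. (\<forall>p\<in>G. multilinear n (D - fst p) (h p)) \<and>
     r = (\<lambda>u. \<Sum>p\<in>G. snd p u * h p u)}"

lemma ideal_0: "(\<lambda>u. 0) \<in> ideal n D G"
  unfolding ideal_def by (auto intro!: exI[of _ "\<lambda>p u. 0"])

lemma ideal_add:
  assumes "r \<in> ideal n D G" "r' \<in> ideal n D G" shows "(\<lambda>u. r u + r' u) \<in> ideal n D G"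
proof -
  obtain h where h: "\<forall>p\<in>G. multilinear n (D - fst p) (h p)" "r = (\<lambda>u. \<Sum>p\<in>G. snd p u * h p u)"
    using assms(1) by (auto simp: ideal_def)
  obtain h' where h': "\<forall>p\<in>G. multilinear n (D - fst p) (h' p)" "r' = (\<lambda>u. \<Sum>p\<in>G. snd p u * h' p u)"
    using assms(2) by (auto simp: ideal_def)
  show ?thesis unfolding ideal_def using h h'
    by (auto intro!: exI[of _ "\<lambda>p u. h p u + h' p u"] multilinear_add
        simp: sum.distrib algebra_simps)
qed

lemma ideal_sum:
  "(\<And>x. x \<in> A \<Longrightarrow> f x \<in> ideal n D G) \<Longrightarrow> (\<lambda>u. \<Sum>x\<in>A. f x u) \<in> ideal n D G"
  by (induction A rule: infinite_finite_induct) (auto intro: ideal_add ideal_0)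

lemma ideal_gen:
  assumes "finite G" "(J, g) \<in> G" "multilinear n (D - J) h"
  shows "(\<lambda>u. g u * h u) \<in> ideal n D G"
proof -
  have "(\<Sum>p\<in>G. snd p u * (if p = (J, g) then h u else 0)) = g u * h u" for u
    using assms(1,2) by (simp add: if_distrib sum.delta' cong: if_cong)
  moreover have "\<forall>p\<in>G. multilinear n (D - fst p) (\<lambda>u. if p = (J, g) then h u else 0)"
  proof
    fix p show "multilinear n (D - fst p) (\<lambda>u. if p = (J, g) then h u else 0)"
      using assms(3) by (cases "p = (J, g)") simp_all
  qed
  ultimately show ?thesis unfolding ideal_def
    by (intro CollectI exI[of _ "\<lambda>p u. if p = (J, g) then h u else 0"]) simp
qed

lemma ideal_mono:
  assumes "r \<in> ideal n D G" "G \<subseteq> G'" "finite G'" shows "r \<in> ideal n D G'"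
proof -
  obtain h where h: "\<forall>p\<in>G. multilinear n (D - fst p) (h p)" "r = (\<lambda>u. \<Sum>p\<in>G. snd p u * h p u)"
    using assms(1) by (auto simp: ideal_def)
  have "(\<lambda>u. \<Sum>p\<in>G. snd p u * h p u) \<in> ideal n D G'"
    using h(1) assms(2,3) by (intro ideal_sum ideal_gen[where J = "fst p" for p]) auto
  then show ?thesis using h(2) by simp
qed

lemma ideal_vanish:
  assumes "r \<in> ideal n D G" "\<And>J g. (J, g) \<in> G \<Longrightarrow> g s = 0" shows "r s = 0"
proof -
  obtain h where h: "r = (\<lambda>u. \<Sum>p\<in>G. snd p u * h p u)"
    using assms(1) by (auto simp: ideal_def)
  have "snd p s = 0" if "p \<in> G" for p
    using assms(2)[of "fst p" "snd p"] that by simp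
  then show ?thesis by (simp add: h)
qed

lemma generators_Un: "generators n D G \<Longrightarrow> generators n D G' \<Longrightarrow> generators n D (G \<union> G')"
  by (auto simp: generators_def)

section \<open>Products over disjoint blocks and partition rank\<close>

inductive products :: "(nat \<Rightarrow> nat) \<Rightarrow> nat set set \<Rightarrow> nat set \<Rightarrow> form \<Rightarrow> bool"
  for n F where
  one: "products n F {} (\<lambda>u. 1)"
| mult: "P \<in> F \<Longrightarrow> P \<inter> J = {} \<Longrightarrow> multilinear n P a \<Longrightarrow> products n F J b \<Longrightarrow>
    products n F (P \<union> J) (\<lambda>u. a u * b u)"

text \<open>For non-empty \<open>J\<close> and \<open>F = proper_subsets J\<close> this is partition
  rank at most \<open>K\<close>. The family \<open>F\<close> is a parameter because the main
  induction removes its blocks one by one.\<close>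

definition rank_le :: "(nat \<Rightarrow> nat) \<Rightarrow> nat set set \<Rightarrow> nat set \<Rightarrow> nat \<Rightarrow> form \<Rightarrow> bool" where
  "rank_le n F J K f \<longleftrightarrow> (\<exists>gs. length gs \<le> K \<and> (\<forall>g\<in>set gs. products n F J g) \<and>
     f = (\<lambda>u. \<Sum>g\<leftarrow>gs. g u))"

lemma rank_le_0 [simp]: "rank_le n F J K (\<lambda>u. 0)"
  unfolding rank_le_def by (rule exI[of _ "[]"]) simp

lemma rank_le_mono: "rank_le n F J K f \<Longrightarrow> K \<le> K' \<Longrightarrow> rank_le n F J K' f"
  unfolding rank_le_def by force

lemma rank_le_add:
  assumes "rank_le n F J K f" "rank_le n F J L g" "K + L \<le> M"
  shows "rank_le n F J M (\<lambda>u. f u + g u)"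
proof -
  obtain fs where "length fs \<le> K" "\<forall>g\<in>set fs. products n F J g" "f = (\<lambda>u. \<Sum>g\<leftarrow>fs. g u)"
    using assms(1) by (auto simp: rank_le_def)
  moreover obtain gs where "length gs \<le> L" "\<forall>g\<in>set gs. products n F J g" "g = (\<lambda>u. \<Sum>g\<leftarrow>gs. g u)"
    using assms(2) by (auto simp: rank_le_def)
  ultimately show ?thesis unfolding rank_le_def
    using assms(3) by (intro exI[of _ "fs @ gs"]) auto
qed

lemma rank_le_product: "products n F J g \<Longrightarrow> rank_le n F J 1 g"
  unfolding rank_le_def by (rule exI[of _ "[g]"]) simp

lemma rank_le_sum:
  assumes "finite A" "\<And>x. x \<in> A \<Longrightarrow> rank_le n F J 1 (f x)"
  shows "rank_le n F J (card A) (\<lambda>u. \<Sum>x\<in>A. f x u)"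
  using assms
  by (induction A rule: finite_induct) (auto intro: rank_le_add[where K = 1])

lemma rank_le_sum_list:
  assumes "\<And>x. x \<in> set xs \<Longrightarrow> rank_le n F J L (f x)"
  shows "rank_le n F J (length xs * L) (\<lambda>u. \<Sum>x\<leftarrow>xs. f x u)"
  using assms
  by (induction xs) (auto intro: rank_le_add[where K = L and L = "length xs * L" for xs])

lemma products_mono: "products n F J g \<Longrightarrow> F \<subseteq> F' \<Longrightarrow> products n F' J g"
  by (induction rule: products.induct) (auto intro: products.intros)

lemma products_blocks:
  assumes "products n F J g" shows "products n {P\<in>F. P \<subseteq> J} J g"
  using assms
proof (induction rule: products.induct)
  case one then show ?case by (rule products.one)
next
  case (mult P J a b)
  from mult.IH have "products n {Q\<in>F. Q \<subseteq> P \<union> J} J b" by (rule products_mono) auto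
  with mult show ?case by (intro products.mult) auto
qed

lemma multilinear_products: "products n F J g \<Longrightarrow> multilinear n J g"
  by (induction rule: products.induct) (auto intro: multilinear_mult)

lemma multilinear_sum_list:
  "(\<And>x. x \<in> set xs \<Longrightarrow> multilinear n I (f x)) \<Longrightarrow> multilinear n I (\<lambda>u. \<Sum>x\<leftarrow>xs. f x u)"
  by (induction xs) (auto intro: multilinear_add)

lemma multilinear_rank_le: "rank_le n F J K f \<Longrightarrow> multilinear n J f"
  unfolding rank_le_def by (metis multilinear_products multilinear_sum_list)

lemma products_times:
  assumes "products n F J a" "products n F J' b" "J \<inter> J' = {}"
  shows "products n F (J \<union> J') (\<lambda>u. a u * b u)"
  using assms
proof (induction rule: products.induct)
  case one then show ?case by simp
next
  case (mult P J a' b')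
  have "products n F (P \<union> (J \<union> J')) (\<lambda>u. a' u * (b' u * b u))"
    using mult.hyps mult.prems by (intro products.mult[OF _ _ _ mult.IH]) auto
  then show ?case by (simp add: Un_assoc mult.assoc)
qed

lemma rank_le_times:
  assumes "rank_le n F J K a" "rank_le n F J' L b" "J \<inter> J' = {}"
  shows "rank_le n F (J \<union> J') (K * L) (\<lambda>u. a u * b u)"
proof -
  obtain as where as: "length as \<le> K" "\<forall>g\<in>set as. products n F J g" "a = (\<lambda>u. \<Sum>g\<leftarrow>as. g u)"
    using assms(1) by (auto simp: rank_le_def)
  obtain bs where bs: "length bs \<le> L" "\<forall>g\<in>set bs. products n F J' g" "b = (\<lambda>u. \<Sum>g\<leftarrow>bs. g u)"
    using assms(2) by (auto simp: rank_le_def)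
  have "rank_le n F (J \<union> J') (length as * (length bs * 1)) (\<lambda>u. \<Sum>f\<leftarrow>as. \<Sum>g\<leftarrow>bs. f u * g u)"
    using as(2) bs(2) assms(3) by (intro rank_le_sum_list rank_le_product products_times) auto
  moreover have "(\<lambda>u. \<Sum>f\<leftarrow>as. \<Sum>g\<leftarrow>bs. f u * g u) = (\<lambda>u. a u * b u)"
    by (simp add: as(3) bs(3) sum_list_const_mult sum_list_mult_const)
  ultimately show ?thesis
    using as(1) bs(1) by (auto intro: rank_le_mono mult_le_mono)
qed

lemma rank_le_family_mono: "rank_le n F J K f \<Longrightarrow> F \<subseteq> F' \<Longrightarrow> rank_le n F' J K f"
  unfolding rank_le_def by (metis products_mono)

text \<open>The blocks of a product are disjoint, so a non-empty block occurs at most once.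
  Factoring it out produces the terms that \<open>decomposed\<close> collects.\<close>

lemma products_extract:
  assumes "products n F J g"
  shows "products n (F - {I}) J g \<or>
    (I \<subseteq> J \<and> (\<exists>a b. multilinear n I a \<and> products n F (J - I) b \<and> g = (\<lambda>u. a u * b u)))"
  using assms
proof (induction rule: products.induct)
  case one then show ?case by (simp add: products.one)
next
  case (mult P J a b)
  show ?case
  proof (cases "P = I")
    case True
    then have "P \<union> J - I = J" using mult by auto
    with True mult show ?thesis by auto
  next
    case False
    from mult.IH show ?thesis
    proof
      assume "products n (F - {I}) J b"
      then show ?thesis using mult False by (auto intro: products.mult)
    next
      assume "I \<subseteq> J \<and> (\<exists>a b'. multilinear n I a \<and> products n F (J - I) b' \<and> b = (\<lambda>u. a u * b' u))"
      then obtain a' b' where ab: "I \<subseteq> J" "multilinear n I a'" "products n F (J - I) b'"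
        "b = (\<lambda>u. a' u * b' u)" by auto
      have "products n F (P \<union> (J - I)) (\<lambda>u. a u * b' u)"
        using mult ab by (intro products.mult) auto
      moreover have "P \<union> (J - I) = P \<union> J - I" using mult ab by auto
      ultimately show ?thesis using ab(1,2,4)
        by (intro disjI2 conjI exI[of _ a'] exI[of _ "\<lambda>u. a u * b' u"]) (auto simp: algebra_simps)
    qed
  qed
qed

section \<open>Slices of products\<close>

abbreviation proper_subsets :: "nat set \<Rightarrow> nat set set" where
  "proper_subsets I \<equiv> {P. P \<noteq> {} \<and> P \<subset> I}"

text \<open>A factor on \<open>P\<close> becomes a form on \<open>P \<inter> I\<close>, a proper
  subset of \<open>I\<close> by the assumption on \<open>F\<close>, or a scalar if \<open>P\<close>
  and \<open>I\<close> are disjoint. A zero scalar gives the first alternative.\<close>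

lemma products_slice:
  assumes "products n F J g" "\<And>P. P \<in> F \<Longrightarrow> \<not> I \<subseteq> P" "x \<in> tuples n K" "K \<inter> I = {}"
  shows "slice n I x g = (\<lambda>u. 0) \<or> products n (proper_subsets I) (J \<inter> I) (slice n I x g)"
  using assms
proof (induction rule: products.induct)
  case one
  then show ?case by (auto simp: slice_def intro: products.one)
next
  case (mult P J a b)
  have s: "slice n I x (\<lambda>u. a u * b u) = (\<lambda>u. slice n I x a u * slice n I x b u)"
    by (simp add: slice_def)
  from mult have IH: "slice n I x b = (\<lambda>u. 0) \<or> products n (proper_subsets I) (J \<inter> I) (slice n I x b)"
    by auto
  show ?case
  proof (cases "slice n I x b = (\<lambda>u. 0)")
    case True then show ?thesis by (simp add: s)
  next
    case False
    with IH have b: "products n (proper_subsets I) (J \<inter> I) (slice n I x b)" by auto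
    show ?thesis
    proof (cases "P \<inter> I = {}")
      case True
      then have "slice n I x a = (\<lambda>_. a x)" using mult by (intro slice_const)
      with b True show ?thesis by (cases "a x") (auto simp: s Int_Un_distrib2)
    next
      case False
      have "P \<inter> I \<noteq> I" using mult by auto
      then have "products n (proper_subsets I) ((P \<inter> I) \<union> (J \<inter> I))
        (\<lambda>u. slice n I x a u * slice n I x b u)"
        using b mult False by (intro products.mult multilinear_slice) auto
      then show ?thesis by (simp add: s Int_Un_distrib2)
    qed
  qed
qed

lemma rank_le_slice:
  assumes "rank_le n F J K g" "\<And>P. P \<in> F \<Longrightarrow> \<not> I \<subseteq> P" "x \<in> tuples n L" "L \<inter> I = {}"
  shows "rank_le n (proper_subsets I) (J \<inter> I) K (slice n I x g)"
proof -
  obtain gs where gs: "length gs \<le> K" "\<forall>g\<in>set gs. products n F J g" "g = (\<lambda>u. \<Sum>g\<leftarrow>gs. g u)"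
    using assms(1) by (auto simp: rank_le_def)
  have "rank_le n (proper_subsets I) (J \<inter> I) (length gs * 1) (\<lambda>u. \<Sum>g\<leftarrow>gs. slice n I x g u)"
  proof (rule rank_le_sum_list)
    fix g assume "g \<in> set gs"
    then have "slice n I x g = (\<lambda>u. 0) \<or> products n (proper_subsets I) (J \<inter> I) (slice n I x g)"
      using gs(2) assms(2-) by (intro products_slice) auto
    then show "rank_le n (proper_subsets I) (J \<inter> I) 1 (slice n I x g)"
      by (auto intro: rank_le_product[unfolded One_nat_def])
  qed
  then show ?thesis using gs(1,3) by (auto simp: slice_def intro: rank_le_mono)
qed

section \<open>Restricting a weight to the zeros of given forms\<close>

definition weight :: "(tuple \<Rightarrow> real) \<Rightarrow> bool" where
  "weight \<phi> \<longleftrightarrow> (\<forall>s. 0 \<le> \<phi> s \<and> \<phi> s \<le> 1)"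

definition mass :: "(nat \<Rightarrow> nat) \<Rightarrow> nat set \<Rightarrow> (tuple \<Rightarrow> real) \<Rightarrow> real" where
  "mass n D \<phi> = (\<Sum>s\<in>tuples n D. \<phi> s)"

definition defect :: "(nat \<Rightarrow> nat) \<Rightarrow> nat set \<Rightarrow> (tuple \<Rightarrow> real) \<Rightarrow> form \<Rightarrow> real" where
  "defect n D \<phi> r = (\<Sum>s\<in>tuples n D. \<phi> s * of_bool (r s = 1))"

lemma weightD: "weight \<phi> \<Longrightarrow> 0 \<le> \<phi> s" "weight \<phi> \<Longrightarrow> \<phi> s \<le> 1"
  by (auto simp: weight_def)

lemma defect_nonneg: "weight \<phi> \<Longrightarrow> 0 \<le> defect n D \<phi> r"
  by (auto simp: defect_def weight_def intro!: sum_nonneg)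

lemma mass_nonneg: "weight \<phi> \<Longrightarrow> 0 \<le> mass n D \<phi>"
  by (auto simp: mass_def weight_def intro!: sum_nonneg)

lemma mass_le_card: "weight \<phi> \<Longrightarrow> mass n D \<phi> \<le> card (tuples n D)"
  unfolding mass_def using sum_bounded_above[of "tuples n D" \<phi> 1] by (auto simp: weight_def)

text \<open>Draw \<open>u\<close> from the weight \<open>\<phi>\<close> and \<open>u'\<close> from \<open>\<phi>\<close> conditioned on having the colour of \<open>u\<close>;
  both have the same marginal (up to rare colours, which are discarded), and the result is the
  distribution of \<open>u + u'\<close>, scaled by \<open>\<eta>\<close>.\<close>

definition colour_mass :: "tuple set \<Rightarrow> (tuple \<Rightarrow> 'c) \<Rightarrow> (tuple \<Rightarrow> real) \<Rightarrow> tuple \<Rightarrow> real" where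
  "colour_mass X \<gamma> \<phi> u = (\<Sum>u'\<in>X. \<phi> u' * of_bool (\<gamma> u' = \<gamma> u))"

definition coupling ::
  "tuple set \<Rightarrow> (tuple \<Rightarrow> 'c) \<Rightarrow> real \<Rightarrow> (tuple \<Rightarrow> real) \<Rightarrow> tuple \<Rightarrow> tuple \<Rightarrow> real" where
  "coupling X \<gamma> \<eta> \<phi> u u' = of_bool (\<gamma> u' = \<gamma> u \<and> colour_mass X \<gamma> \<phi> u \<ge> \<eta> * card X)
     * \<phi> u * \<phi> u' / colour_mass X \<gamma> \<phi> u"

definition difference_weight ::
  "tuple set \<Rightarrow> (tuple \<Rightarrow> 'c) \<Rightarrow> real \<Rightarrow> (tuple \<Rightarrow> real) \<Rightarrow> tuple \<Rightarrow> real" where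
  "difference_weight X \<gamma> \<eta> \<phi> y = \<eta> * (\<Sum>u\<in>X. coupling X \<gamma> \<eta> \<phi> u (u + y))"

lemma sum_translate:
  fixes F :: "'a::ab_group_add \<Rightarrow> real"
  assumes "\<And>x y. x \<in> X \<Longrightarrow> y \<in> X \<Longrightarrow> x + y \<in> X" "u \<in> X" "u + u = 0"
  shows "(\<Sum>y\<in>X. F (u + y)) = (\<Sum>y\<in>X. F y)"
proof -
  have "u + (u + y) = y" for y using assms(3) by (simp flip: add.assoc)
  then show ?thesis
    by (intro sum.reindex_bij_witness[of _ "\<lambda>y. u + y" "\<lambda>y. u + y"]) (auto intro: assms)
qed

lemma sum_difference_weight:
  fixes F :: "tuple \<Rightarrow> tuple \<Rightarrow> real"
  assumes "\<And>x y. x \<in> X \<Longrightarrow> y \<in> X \<Longrightarrow> x + y \<in> X"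
  shows "(\<Sum>y\<in>X. \<Sum>u\<in>X. F u (u + y)) = (\<Sum>u\<in>X. \<Sum>u'\<in>X. F u u')"
proof -
  have "(\<Sum>y\<in>X. \<Sum>u\<in>X. F u (u + y)) = (\<Sum>u\<in>X. \<Sum>y\<in>X. F u (u + y))"
    by (rule sum.swap)
  also have "\<dots> = (\<Sum>u\<in>X. \<Sum>u'\<in>X. F u u')"
    using assms by (intro sum.cong refl sum_translate) auto
  finally show ?thesis .
qed

context
  fixes X :: "tuple set" and \<gamma> :: "tuple \<Rightarrow> 'c" and \<eta> :: real and \<phi> :: "tuple \<Rightarrow> real"
  assumes X: "finite X" "X \<noteq> {}" "\<And>x y. x \<in> X \<Longrightarrow> y \<in> X \<Longrightarrow> x + y \<in> X"
    and \<eta>: "\<eta> > 0" and \<phi>: "weight \<phi>"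
begin

lemma coupling_nonneg: "coupling X \<gamma> \<eta> \<phi> u u' \<ge> 0"
  using weightD[OF \<phi>] by (auto simp: coupling_def colour_mass_def sum_nonneg)

lemma coupling_sym: "coupling X \<gamma> \<eta> \<phi> u u' = coupling X \<gamma> \<eta> \<phi> u' u"
proof (cases "\<gamma> u' = \<gamma> u")
  case True
  then have "colour_mass X \<gamma> \<phi> u = colour_mass X \<gamma> \<phi> u'" by (simp add: colour_mass_def)
  then show ?thesis by (simp add: coupling_def True)
qed (auto simp: coupling_def)

text \<open>This is what the cutoff on the colour mass buys: dividing by at least
  \<open>\<eta> * card X\<close> and scaling by \<open>\<eta>\<close> leaves at most
  \<open>1 / card X\<close>, so that \<open>card X\<close> such terms add up to at most 1.\<close>

lemma coupling_le: "\<eta> * coupling X \<gamma> \<eta> \<phi> u u' \<le> 1 / card X"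
proof (cases "\<gamma> u' = \<gamma> u \<and> colour_mass X \<gamma> \<phi> u \<ge> \<eta> * card X")
  case True
  have c: "0 < \<eta> * card X" using \<eta> X by (simp add: card_gt_0_iff)
  have p: "\<phi> u * \<phi> u' \<le> 1" "0 \<le> \<phi> u * \<phi> u'" using weightD[OF \<phi>] by (auto intro: mult_le_one)
  have "\<phi> u * \<phi> u' / colour_mass X \<gamma> \<phi> u \<le> 1 / (\<eta> * card X)"
    using True c p by (intro frac_le) auto
  then have "\<eta> * (\<phi> u * \<phi> u' / colour_mass X \<gamma> \<phi> u) \<le> \<eta> * (1 / (\<eta> * card X))"
    using \<eta> by (intro mult_left_mono) auto
  then show ?thesis using True \<eta> by (simp add: coupling_def)
qed (auto simp: coupling_def)

lemma difference_weight_nonneg: "difference_weight X \<gamma> \<eta> \<phi> y \<ge> 0"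
  using \<eta> by (auto simp: difference_weight_def intro!: mult_nonneg_nonneg sum_nonneg coupling_nonneg)

lemma difference_weight_le_1: "difference_weight X \<gamma> \<eta> \<phi> y \<le> 1"
proof -
  have "difference_weight X \<gamma> \<eta> \<phi> y = (\<Sum>u\<in>X. \<eta> * coupling X \<gamma> \<eta> \<phi> u (u + y))"
    by (simp add: difference_weight_def sum_distrib_left)
  also have "\<dots> \<le> card X * (1 / card X)"
    by (intro sum_bounded_above coupling_le)
  finally show ?thesis using X by simp
qed

text \<open>Dividing by the colour mass normalises the second draw; summing it out leaves the weight
  of the first, except on discarded colours.\<close>

lemma coupling_marginal:
  "(\<Sum>u'\<in>X. coupling X \<gamma> \<eta> \<phi> u u') = \<phi> u * of_bool (colour_mass X \<gamma> \<phi> u \<ge> \<eta> * card X)"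
proof -
  have c: "0 < \<eta> * card X" using \<eta> X by (simp add: card_gt_0_iff)
  have "(\<Sum>u'\<in>X. coupling X \<gamma> \<eta> \<phi> u u') =
     (\<Sum>u'\<in>X. of_bool (colour_mass X \<gamma> \<phi> u \<ge> \<eta> * card X) * \<phi> u / colour_mass X \<gamma> \<phi> u *
        (\<phi> u' * of_bool (\<gamma> u' = \<gamma> u)))"
    by (intro sum.cong refl) (auto simp: coupling_def)
  also have "\<dots> = of_bool (colour_mass X \<gamma> \<phi> u \<ge> \<eta> * card X) * \<phi> u / colour_mass X \<gamma> \<phi> u
      * colour_mass X \<gamma> \<phi> u"
    by (simp add: colour_mass_def[of X \<gamma> \<phi> u] sum_distrib_left)
  finally show ?thesis using c by auto
qed

lemma difference_weight_support:
  assumes "difference_weight X \<gamma> \<eta> \<phi> y \<noteq> 0"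
  shows "\<exists>u\<in>X. \<phi> u \<noteq> 0 \<and> \<phi> (u + y) \<noteq> 0 \<and> \<gamma> (u + y) = \<gamma> u"
proof -
  have "\<exists>u\<in>X. coupling X \<gamma> \<eta> \<phi> u (u + y) \<noteq> 0"
    using assms by (auto simp: difference_weight_def) (meson sum.neutral)
  then show ?thesis by (force simp: coupling_def)
qed

text \<open>A discarded colour class has mass below \<open>\<eta> * card X\<close>, and there are at
  most \<open>N\<close> classes.\<close>

lemma sum_difference_weight_ge:
  assumes "finite C" "card C \<le> N" "\<And>u. u \<in> X \<Longrightarrow> \<gamma> u \<in> C"
  shows "(\<Sum>y\<in>X. difference_weight X \<gamma> \<eta> \<phi> y) \<ge> \<eta> * ((\<Sum>u\<in>X. \<phi> u) - N * (\<eta> * card X))"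
proof -
  let ?L = "\<lambda>u. colour_mass X \<gamma> \<phi> u \<ge> \<eta> * card X"
  have "(\<Sum>u\<in>X. \<phi> u * of_bool (\<not> ?L u)) = (\<Sum>c\<in>C. \<Sum>u\<in>{u\<in>X. \<gamma> u = c}. \<phi> u * of_bool (\<not> ?L u))"
    using X assms by (intro sum.group[symmetric]) auto
  also have "\<dots> \<le> (\<Sum>c\<in>C. \<eta> * card X)"
  proof (rule sum_mono)
    fix c assume "c \<in> C"
    show "(\<Sum>u\<in>{u\<in>X. \<gamma> u = c}. \<phi> u * of_bool (\<not> ?L u)) \<le> \<eta> * card X"
    proof (cases "\<exists>w\<in>X. \<gamma> w = c \<and> \<not> ?L w")
      case True
      then obtain w where w: "w \<in> X" "\<gamma> w = c" "\<not> ?L w" by auto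
      have "(\<Sum>u\<in>{u\<in>X. \<gamma> u = c}. \<phi> u * of_bool (\<not> ?L u)) \<le> (\<Sum>u\<in>{u\<in>X. \<gamma> u = c}. \<phi> u)"
        using weightD[OF \<phi>] by (intro sum_mono) auto
      also have "\<dots> = colour_mass X \<gamma> \<phi> w"
        unfolding colour_mass_def using w(2) X(1) by (auto intro: sum.mono_neutral_cong_left)
      finally show ?thesis using w(3) by simp
    next
      case False
      then have "(\<Sum>u\<in>{u\<in>X. \<gamma> u = c}. \<phi> u * of_bool (\<not> ?L u)) = 0"
        by (intro sum.neutral) auto
      then show ?thesis using \<eta> by simp
    qed
  qed
  also have "\<dots> \<le> N * (\<eta> * card X)" using assms \<eta> by (auto intro!: mult_right_mono)
  finally have 1: "(\<Sum>u\<in>X. \<phi> u * of_bool (\<not> ?L u)) \<le> N * (\<eta> * card X)" .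
  have "(\<Sum>y\<in>X. difference_weight X \<gamma> \<eta> \<phi> y) = \<eta> * (\<Sum>u\<in>X. \<Sum>u'\<in>X. coupling X \<gamma> \<eta> \<phi> u u')"
    unfolding difference_weight_def sum_distrib_left[symmetric]
    by (subst sum_difference_weight) (use X in auto)
  also have "\<dots> = \<eta> * (\<Sum>u\<in>X. \<phi> u * of_bool (?L u))" by (simp add: coupling_marginal)
  also have "(\<Sum>u\<in>X. \<phi> u * of_bool (?L u)) = (\<Sum>u\<in>X. \<phi> u) - (\<Sum>u\<in>X. \<phi> u * of_bool (\<not> ?L u))"
    by (auto simp: sum_subtractf[symmetric] intro!: sum.cong)
  also have "\<eta> * \<dots> \<ge> \<eta> * ((\<Sum>u\<in>X. \<phi> u) - N * (\<eta> * card X))"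
    using 1 \<eta> by (intro mult_left_mono) auto
  finally show ?thesis .
qed

text \<open>If \<open>q (u + u') = 1\<close> then \<open>q u = 1\<close> or \<open>q u' = 1\<close>.
  The coupling is symmetric, so both cases have the same mass, which its marginal bounds; hence the
  factor 2.\<close>

lemma sum_difference_weight_le:
  fixes q :: "tuple \<Rightarrow> bit"
  assumes "\<And>u y. u \<in> X \<Longrightarrow> y \<in> X \<Longrightarrow> q (u + y) = q u + q y"
  shows "(\<Sum>y\<in>X. difference_weight X \<gamma> \<eta> \<phi> y * of_bool (q y = 1))
    \<le> 2 * \<eta> * (\<Sum>u\<in>X. \<phi> u * of_bool (q u = 1))"
proof -
  let ?c = "coupling X \<gamma> \<eta> \<phi>" and ?q = "\<lambda>u. of_bool (q u = 1) :: real"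
  have "(\<Sum>y\<in>X. difference_weight X \<gamma> \<eta> \<phi> y * ?q y) = \<eta> * (\<Sum>y\<in>X. \<Sum>u\<in>X. ?c u (u + y) * ?q y)"
    by (simp add: difference_weight_def sum_distrib_left sum_distrib_right mult.assoc)
  also have "\<dots> = \<eta> * (\<Sum>y\<in>X. \<Sum>u\<in>X. (\<lambda>u u'. ?c u u' * ?q (u + u')) u (u + y))"
    by simp
  also have "\<dots> = \<eta> * (\<Sum>u\<in>X. \<Sum>u'\<in>X. ?c u u' * ?q (u + u'))"
    by (subst sum_difference_weight) (use X in auto)
  also have "\<dots> \<le> \<eta> * (\<Sum>u\<in>X. \<Sum>u'\<in>X. ?c u u' * ?q u + ?c u u' * ?q u')"
  proof (intro mult_left_mono sum_mono)
    fix u u' assume "u \<in> X" "u' \<in> X"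
    then show "?c u u' * ?q (u + u') \<le> ?c u u' * ?q u + ?c u u' * ?q u'"
      using coupling_nonneg[of u u'] assms by (cases "q u"; cases "q u'") auto
  qed (use \<eta> in auto)
  also have "\<dots> = \<eta> * ((\<Sum>u\<in>X. \<Sum>u'\<in>X. ?c u u' * ?q u) + (\<Sum>u\<in>X. \<Sum>u'\<in>X. ?c u u' * ?q u'))"
    by (simp add: sum.distrib)
  also have "(\<Sum>u\<in>X. \<Sum>u'\<in>X. ?c u u' * ?q u') = (\<Sum>u\<in>X. \<Sum>u'\<in>X. ?c u u' * ?q u)"
    by (subst sum.swap) (simp add: coupling_sym)
  also have "(\<Sum>u\<in>X. \<Sum>u'\<in>X. ?c u u' * ?q u) = (\<Sum>u\<in>X. (\<Sum>u'\<in>X. ?c u u') * ?q u)"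
    by (simp add: sum_distrib_right)
  also have "\<dots> \<le> (\<Sum>u\<in>X. \<phi> u * ?q u)"
    unfolding coupling_marginal using weightD[OF \<phi>] by (intro sum_mono) auto
  finally show ?thesis using \<eta> by (simp add: algebra_simps mult_left_mono)
qed

end

section \<open>Resampling coordinates by differences\<close>

lemma multilinear_add_tuples:
  assumes g: "multilinear n J g" and "i \<in> J" "v \<in> tuples n (D - {i})" "a \<in> tuples n {i}" "b \<in> tuples n {i}"
  shows "g (v + (a + b)) = g (v + a) + g (v + b)"
proof -
  have eq: "v + c = v(i := c i)" if "c \<in> tuples n {i}" for c
    using that assms(3) by (auto simp: tuples_def fun_eq_iff)
  show ?thesis
    using eq[OF assms(4)] eq[OF assms(5)] eq[OF tuples_add[OF assms(4,5)]]
      multilinear_add_coord[OF g \<open>i \<in> J\<close>, of v "a i" "b i"] by simp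
qed

lemma multilinear_irrelevant:
  assumes g: "multilinear n J g" and "i \<notin> J" "a \<in> tuples n {i}"
  shows "g (v + a) = g v"
proof (rule multilinear_cong[OF g])
  fix k j assume "k \<in> J" "j < n k"
  then have "k \<noteq> i" using assms(2) by auto
  then show "(v + a) k j = v k j" using tuplesD[OF assms(3), of k j] by simp
qed

text \<open>The new weight is fixed before \<open>r\<close>: one weight serves all forms at once,
  and the factor \<open>c\<close> is the same for all of them.\<close>

definition refines :: "(nat \<Rightarrow> nat) \<Rightarrow> nat set \<Rightarrow> real \<Rightarrow> (tuple \<Rightarrow> real) \<Rightarrow> (tuple \<Rightarrow> real) \<Rightarrow> bool" where
  "refines n D c \<phi> \<phi>' \<longleftrightarrow> weight \<phi>' \<and> (\<forall>r \<epsilon>. multilinear n D r \<longrightarrow> \<epsilon> \<ge> 0 \<longrightarrow>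
     defect n D \<phi> r \<le> \<epsilon> * mass n D \<phi> \<longrightarrow> defect n D \<phi>' r \<le> c * \<epsilon> * mass n D \<phi>')"

lemma refines_trans:
  assumes "refines n D c \<phi> \<phi>'" "refines n D c' \<phi>' \<phi>''" "c \<ge> 0"
  shows "refines n D (c' * c) \<phi> \<phi>''"
  using assms unfolding refines_def by (metis mult.assoc mult_nonneg_nonneg)

text \<open>Apply the coupling on each fibre in direction \<open>i\<close> and take the difference
  as the new coordinate. The mass stays at least \<open>\<eta> / 2\<close> times the old one while
  the defect is at most \<open>2 * \<eta>\<close> times the old one; the quotient is the 4.\<close>

lemma resample_coordinate:
  fixes \<gamma> :: "tuple \<Rightarrow> 'c" and \<delta> :: real and N :: nat
  assumes D: "finite D" "i \<in> D" and \<phi>: "weight \<phi>" and \<delta>: "\<delta> > 0" "mass n D \<phi> \<ge> \<delta> * card (tuples n D)"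
    and C: "finite C" "card C \<le> N" "N > 0" "\<And>u. \<gamma> u \<in> C"
  shows "\<exists>\<phi>'. refines n D 4 \<phi> \<phi>' \<and> mass n D \<phi>' \<ge> \<delta>\<^sup>2 / (4 * N) * card (tuples n D) \<and>
    (\<forall>s\<in>tuples n D. \<phi>' s \<noteq> 0 \<longrightarrow> (\<exists>v\<in>tuples n (D - {i}). \<exists>u\<in>tuples n {i}. \<exists>y\<in>tuples n {i}.
       s = v + y \<and> \<phi> (v + u) \<noteq> 0 \<and> \<phi> (v + (u + y)) \<noteq> 0 \<and> \<gamma> (v + (u + y)) = \<gamma> (v + u)))"
proof -
  define X where "X = tuples n {i}"
  define V where "V = tuples n (D - {i})"
  \<comment> \<open>With \<open>N\<close> colours this threshold discards density at most
    \<open>\<delta> / 2\<close>, that is, at most half of the mass.\<close>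
  define \<eta> where "\<eta> = \<delta> / (2 * N)"
  have \<eta>: "\<eta> > 0" using \<delta> C by (simp add: \<eta>_def)
  have X: "finite X" "X \<noteq> {}" "\<And>x y. x \<in> X \<Longrightarrow> y \<in> X \<Longrightarrow> x + y \<in> X"
    unfolding X_def using zero_tuples[of n "{i}"] by (blast intro: tuples_add finite_tuples)+
  define f where "f v = difference_weight X (\<lambda>u. \<gamma> (v + u)) \<eta> (\<lambda>u. \<phi> (v + u))" for v
  define \<phi>' where "\<phi>' s = f (proj n (D - {i}) s) (proj n {i} s)" for s
  have \<phi>v: "weight (\<lambda>u. \<phi> (v + u))" for v using \<phi> by (auto simp: weight_def)
  have D': "{i} \<subseteq> D" using D by auto
  have split: "(\<Sum>s\<in>tuples n D. F s) = (\<Sum>v\<in>V. \<Sum>u\<in>X. F (v + u))" for F :: "tuple \<Rightarrow> real"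
    unfolding V_def X_def by (rule sum_tuples_split[OF D' D(1)])
  have eq: "\<phi>' (v + u) = f v u" if "v \<in> V" "u \<in> X" for v u
  proof -
    have "proj n (D - {i}) (v + u) = v" "proj n {i} (v + u) = u"
      using that by (auto simp: V_def X_def proj_def tuples_def fun_eq_iff)
    then show ?thesis by (simp add: \<phi>'_def)
  qed
  have w: "weight \<phi>'"
    unfolding weight_def \<phi>'_def f_def
    using difference_weight_nonneg[OF X \<eta> \<phi>v] difference_weight_le_1[OF X \<eta> \<phi>v] by blast
  have cardD: "real (card (tuples n D)) = (\<Sum>v\<in>V. real (card X))"
    using card_tuples_split[OF D', of n] by (simp add: V_def X_def)
  have "mass n D \<phi>' = (\<Sum>v\<in>V. \<Sum>u\<in>X. f v u)"
    unfolding mass_def split by (intro sum.cong refl eq)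
  also have "\<dots> \<ge> (\<Sum>v\<in>V. \<eta> * ((\<Sum>u\<in>X. \<phi> (v + u)) - N * (\<eta> * card X)))"
    unfolding f_def by (intro sum_mono sum_difference_weight_ge[OF X \<eta> \<phi>v C(1,2)]) (use C in auto)
  also have "(\<Sum>v\<in>V. \<eta> * ((\<Sum>u\<in>X. \<phi> (v + u)) - N * (\<eta> * card X))) =
      \<eta> * (mass n D \<phi> - N * \<eta> * card (tuples n D))"
    unfolding mass_def split cardD
    by (simp add: sum_distrib_left sum_subtractf algebra_simps)
  also have "\<dots> = \<eta> * (mass n D \<phi> - \<delta> / 2 * card (tuples n D))"
    using C(3) by (simp add: \<eta>_def)
  finally have "mass n D \<phi>' \<ge> \<eta> * (mass n D \<phi> - \<delta> / 2 * card (tuples n D))" by simp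
  moreover have "\<eta> * (mass n D \<phi> - \<delta> / 2 * card (tuples n D)) \<ge> \<eta> * (mass n D \<phi> / 2)"
    using \<delta>(2) \<eta> by (intro mult_left_mono) auto
  ultimately have m: "mass n D \<phi>' \<ge> \<eta> * (mass n D \<phi> / 2)" by linarith
  moreover have "\<eta> * (mass n D \<phi> / 2) \<ge> \<eta> * (\<delta> * card (tuples n D) / 2)"
    using \<delta>(2) \<eta> by (intro mult_left_mono) auto
  ultimately have m2: "mass n D \<phi>' \<ge> \<delta>\<^sup>2 / (4 * N) * card (tuples n D)"
    by (simp add: \<eta>_def power2_eq_square)
  have d: "defect n D \<phi>' r \<le> 4 * \<epsilon> * mass n D \<phi>'"
    if r: "multilinear n D r" and \<epsilon>: "\<epsilon> \<ge> 0" "defect n D \<phi> r \<le> \<epsilon> * mass n D \<phi>" for r \<epsilon>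
  proof -
    have "defect n D \<phi>' r = (\<Sum>v\<in>V. \<Sum>u\<in>X. f v u * of_bool (r (v + u) = 1))"
      unfolding defect_def split by (intro sum.cong refl) (simp add: eq)
    also have "\<dots> \<le> (\<Sum>v\<in>V. 2 * \<eta> * (\<Sum>u\<in>X. \<phi> (v + u) * of_bool (r (v + u) = 1)))"
      unfolding f_def
    proof (intro sum_mono sum_difference_weight_le[OF X \<eta> \<phi>v])
      fix v u y assume "v \<in> V" "u \<in> X" "y \<in> X"
      then show "r (v + (u + y)) = r (v + u) + r (v + y)"
        unfolding V_def X_def using multilinear_add_tuples[OF r D(2)] by blast
    qed
    also have "\<dots> = 2 * \<eta> * defect n D \<phi> r"
      unfolding defect_def split by (simp add: sum_distrib_left)
    also have "\<dots> \<le> 2 * \<eta> * (\<epsilon> * mass n D \<phi>)" using \<epsilon> \<eta> by (intro mult_left_mono) auto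
    also have "\<dots> = 4 * \<epsilon> * (\<eta> * (mass n D \<phi> / 2))" by simp
    also have "\<dots> \<le> 4 * \<epsilon> * mass n D \<phi>'" using m \<epsilon> by (intro mult_left_mono) auto
    finally show ?thesis .
  qed
  have s: "\<exists>v\<in>tuples n (D - {i}). \<exists>u\<in>tuples n {i}. \<exists>y\<in>tuples n {i}. s = v + y \<and>
      \<phi> (v + u) \<noteq> 0 \<and> \<phi> (v + (u + y)) \<noteq> 0 \<and> \<gamma> (v + (u + y)) = \<gamma> (v + u)"
    if s: "s \<in> tuples n D" "\<phi>' s \<noteq> 0" for s
  proof -
    define v where "v = proj n (D - {i}) s"
    define y where "y = proj n {i} s"
    have "f v y \<noteq> 0" using s by (simp add: \<phi>'_def v_def y_def)
    from difference_weight_support[OF X \<eta> \<phi>v this[unfolded f_def]] obtain u where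
      "u \<in> X" "\<phi> (v + u) \<noteq> 0" "\<phi> (v + (u + y)) \<noteq> 0" "\<gamma> (v + (u + y)) = \<gamma> (v + u)" by blast
    moreover have "s = v + y" using s(1) D
      by (auto simp: v_def y_def proj_def tuples_def fun_eq_iff)
    moreover have "v \<in> tuples n (D - {i})" "y \<in> tuples n {i}" by (auto simp: v_def y_def)
    ultimately show ?thesis unfolding X_def by blast
  qed
  have "refines n D 4 \<phi> \<phi>'" using w d unfolding refines_def by blast
  with m2 s show ?thesis by blast
qed

text \<open>The loss in relative error depends only on the number of resampled coordinates. The
  number \<open>M\<close> of forms affects the density \<open>\<delta>'\<close> alone.\<close>

definition zero_refinable :: "real \<Rightarrow> nat \<Rightarrow> nat set \<Rightarrow> real \<Rightarrow> bool" where
  "zero_refinable \<delta> M E \<delta>' \<longleftrightarrow> (\<forall>n D \<phi> G. finite D \<longrightarrow> E \<subseteq> D \<longrightarrow> weight \<phi> \<longrightarrow>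
     mass n D \<phi> \<ge> \<delta> * card (tuples n D) \<longrightarrow> generators n D G \<longrightarrow> card G \<le> M \<longrightarrow>
     (\<exists>\<phi>'. refines n D (4 ^ card E) \<phi> \<phi>' \<and> mass n D \<phi>' \<ge> \<delta>' * card (tuples n D) \<and>
       (\<forall>J g s. (J, g) \<in> G \<longrightarrow> J \<inter> E \<noteq> {} \<longrightarrow> s \<in> tuples n D \<longrightarrow> \<phi>' s \<noteq> 0 \<longrightarrow> g s = 0)))"

text \<open>Resample one coordinate at a time, coloured by the values of all generators. A form
  involving coordinate \<open>i\<close> has equal values at two points that differ only there, so by
  additivity it vanishes at the difference; a form not involving \<open>i\<close> keeps the zeros it
  had.\<close>

lemma ex_zero_refinable:
  assumes "finite E" "\<delta> > 0"
  shows "\<exists>\<delta>'>0. zero_refinable \<delta> M E \<delta>'"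
  using assms(1)
proof (induction E rule: finite_induct)
  case empty
  have "zero_refinable \<delta> M {} \<delta>"
    unfolding zero_refinable_def
  proof (intro allI impI)
    fix n D \<phi> and G :: "(nat set \<times> form) set"
    assume "weight \<phi>" "mass n D \<phi> \<ge> \<delta> * card (tuples n D)"
    then show "\<exists>\<phi>'. refines n D (4 ^ card ({} :: nat set)) \<phi> \<phi>' \<and> mass n D \<phi>' \<ge> \<delta> * card (tuples n D) \<and>
       (\<forall>J g s. (J, g) \<in> G \<longrightarrow> J \<inter> {} \<noteq> {} \<longrightarrow> s \<in> tuples n D \<longrightarrow> \<phi>' s \<noteq> 0 \<longrightarrow> g s = 0)"
      by (intro exI[of _ \<phi>]) (simp add: refines_def)
  qed
  then show ?case using assms(2) by blast
next
  case (insert i E)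
  from insert.IH obtain \<delta>' where \<delta>': "\<delta>' > 0" and IH: "zero_refinable \<delta> M E \<delta>'" by blast
  define \<delta>'' where "\<delta>'' = \<delta>'\<^sup>2 / (4 * (2 ^ M :: nat))"
  have \<delta>'': "\<delta>'' > 0" using \<delta>' by (simp add: \<delta>''_def)
  have "zero_refinable \<delta> M (insert i E) \<delta>''"
    unfolding zero_refinable_def
  proof (intro allI impI)
    fix n D \<phi> G
    assume D: "finite D" "insert i E \<subseteq> D" and \<phi>: "weight \<phi>" "mass n D \<phi> \<ge> \<delta> * card (tuples n D)"
      and G: "generators n D G" "card G \<le> M"
    from D(2) have i: "i \<in> D" and E: "E \<subseteq> D" by auto
    from IH[unfolded zero_refinable_def, rule_format, OF D(1) E \<phi> G] obtain \<phi>1 where r1: "refines n D (4 ^ card E) \<phi> \<phi>1"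
      and m1: "mass n D \<phi>1 \<ge> \<delta>' * card (tuples n D)"
      and z1: "\<And>J g s. (J, g) \<in> G \<Longrightarrow> J \<inter> E \<noteq> {} \<Longrightarrow> s \<in> tuples n D \<Longrightarrow> \<phi>1 s \<noteq> 0 \<Longrightarrow> g s = 0"
      by blast
    have w1: "weight \<phi>1" using r1 by (simp add: refines_def)
    define \<gamma> where "\<gamma> s = {p\<in>G. snd p s = 1}" for s :: tuple
    have "finite G" using G by (simp add: generators_def)
    then have C: "finite (Pow G)" "card (Pow G) \<le> 2 ^ M" "\<And>u. \<gamma> u \<in> Pow G"
      using G(2) by (auto simp: \<gamma>_def card_Pow)
    have "(2::nat) ^ M > 0" by simp
    from resample_coordinate[where \<gamma> = \<gamma>, OF D(1) i w1 \<delta>' m1 C(1,2) this C(3), folded \<delta>''_def]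
    obtain \<phi>' where r': "refines n D 4 \<phi>1 \<phi>'" and m': "mass n D \<phi>' \<ge> \<delta>'' * card (tuples n D)"
      and s': "\<And>s. s \<in> tuples n D \<Longrightarrow> \<phi>' s \<noteq> 0 \<Longrightarrow> (\<exists>v\<in>tuples n (D - {i}). \<exists>u\<in>tuples n {i}.
         \<exists>y\<in>tuples n {i}. s = v + y \<and> \<phi>1 (v + u) \<noteq> 0 \<and> \<phi>1 (v + (u + y)) \<noteq> 0 \<and>
           \<gamma> (v + (u + y)) = \<gamma> (v + u))"
      by blast
    have "refines n D (4 ^ card (insert i E)) \<phi> \<phi>'"
      using refines_trans[OF r1 r'] insert.hyps by simp
    moreover have "g s = 0" if g: "(J, g) \<in> G" "J \<inter> insert i E \<noteq> {}" "s \<in> tuples n D" "\<phi>' s \<noteq> 0" for J g s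
    proof -
      have ml: "multilinear n J g" using G(1) g(1) by (auto simp: generators_def)
      from s'[OF g(3,4)] obtain v u y where v: "v \<in> tuples n (D - {i})" and u: "u \<in> tuples n {i}"
        and y: "y \<in> tuples n {i}" and s: "s = v + y" "\<phi>1 (v + u) \<noteq> 0"
        and \<gamma>: "\<gamma> (v + (u + y)) = \<gamma> (v + u)" by blast
      have vu: "v + u \<in> tuples n D"
        using v u i by (auto simp: tuples_def) (metis DiffD1 add_0)+
      show ?thesis
      proof (cases "i \<in> J")
        case True
        have "g (v + (u + y)) = 1 \<longleftrightarrow> g (v + u) = 1" using \<gamma> g(1) unfolding \<gamma>_def set_eq_iff by (metis (mono_tags, lifting) mem_Collect_eq snd_conv)
        moreover have "g (v + (u + y)) = g (v + u) + g (v + y)"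
          using multilinear_add_tuples[OF ml True v u y] .
        ultimately show ?thesis unfolding s(1) by (cases "g (v + u)"; cases "g (v + y)") auto
      next
        case False
        then have "g s = g (v + u)"
          using multilinear_irrelevant[OF ml False u] multilinear_irrelevant[OF ml False y] s by simp
        then show ?thesis using z1[OF g(1) _ vu s(2)] g(2) False by auto
      qed
    qed
    ultimately show "\<exists>\<phi>'. refines n D (4 ^ card (insert i E)) \<phi> \<phi>' \<and>
       mass n D \<phi>' \<ge> \<delta>'' * card (tuples n D) \<and>
       (\<forall>J g s. (J, g) \<in> G \<longrightarrow> J \<inter> insert i E \<noteq> {} \<longrightarrow> s \<in> tuples n D \<longrightarrow> \<phi>' s \<noteq> 0 \<longrightarrow> g s = 0)"
      using m' by (intro exI[of _ \<phi>']) simp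
  qed
  with \<delta>'' show ?case by blast
qed

section \<open>Bias and partition rank\<close>

text \<open>The set \<open>R\<close> permits restricting the claim to forms of a given rank, which
  the induction over blocks needs.\<close>

definition forced ::
  "(nat \<Rightarrow> nat) \<Rightarrow> nat set \<Rightarrow> form set \<Rightarrow> real \<Rightarrow> nat \<Rightarrow> (tuple \<Rightarrow> real) \<Rightarrow> bool" where
  "forced n D R \<epsilon> k \<phi> \<longleftrightarrow> (\<exists>G. generators n D G \<and> card G \<le> k \<and>
     (\<forall>r\<in>R. multilinear n D r \<longrightarrow> defect n D \<phi> r \<le> \<epsilon> * mass n D \<phi> \<longrightarrow> r \<in> ideal n D G))"

definition dense_weight :: "(nat \<Rightarrow> nat) \<Rightarrow> nat set \<Rightarrow> real \<Rightarrow> (tuple \<Rightarrow> real) \<Rightarrow> bool" where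
  "dense_weight n D \<delta> \<phi> \<longleftrightarrow> weight \<phi> \<and> mass n D \<phi> \<ge> \<delta> * card (tuples n D)"

text \<open>Choosing \<open>\<epsilon>\<close> before \<open>\<delta>\<close> is what allows a later
  passage to a weight of smaller density; choosing \<open>k\<close> before \<open>n\<close> is the
  uniformity in the dimensions.\<close>

definition forcing :: "nat set \<Rightarrow> bool" where
  "forcing D \<longleftrightarrow> (\<exists>\<epsilon>>0. \<forall>\<delta>>0. \<exists>k. \<forall>n \<phi>. dense_weight n D \<delta> \<phi> \<longrightarrow>
     forced n D UNIV \<epsilon> k \<phi>)"

section \<open>Characters and biased forms\<close>

definition chi :: "bit \<Rightarrow> real" where
  "chi b = (if b = 1 then -1 else 1)"

lemma chi_add: "chi (a + b) = chi a * chi b"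
  by (cases a; cases b) (auto simp: chi_def)

lemma chi_0 [simp]: "chi 0 = 1" and chi_1 [simp]: "chi 1 = -1"
  by (simp_all add: chi_def)

lemma chi_eq: "chi b = 1 - 2 * of_bool (b = 1)"
  by (simp add: chi_def)

lemma sum_chi_additive:
  fixes f :: "'a::ab_group_add \<Rightarrow> bit"
  assumes X: "\<And>x y. x \<in> X \<Longrightarrow> y \<in> X \<Longrightarrow> x + y \<in> X" "\<And>x. x \<in> X \<Longrightarrow> x + x = 0"
    and f: "\<And>x y. x \<in> X \<Longrightarrow> y \<in> X \<Longrightarrow> f (x + y) = f x + f y"
  shows "(\<Sum>x\<in>X. chi (f x)) = of_bool (\<forall>x\<in>X. f x = 0) * real (card X)"
proof (cases "\<forall>x\<in>X. f x = 0")
  case True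
  then have "(\<Sum>x\<in>X. chi (f x)) = (\<Sum>x\<in>X. 1)" by (intro sum.cong) auto
  with True show ?thesis by simp
next
  case False
  then obtain u where u: "u \<in> X" "f u = 1" by (auto simp: bit_neq_0_iff)
  have "(\<Sum>x\<in>X. chi (f x)) = (\<Sum>x\<in>X. chi (f (u + x)))"
    by (rule sum_translate[OF X(1) u(1) X(2)[OF u(1)], symmetric])
  also have "\<dots> = (\<Sum>x\<in>X. - chi (f x))"
    using u f by (intro sum.cong refl) (simp add: chi_add)
  finally show ?thesis using False by (simp add: sum_negf)
qed

lemma products_single: "P \<in> F \<Longrightarrow> multilinear n P a \<Longrightarrow> products n F P a"
  using products.mult[OF _ _ _ products.one, of P F n a] by simp

lemma products_pair:
  assumes "P \<in> F" "D - P \<in> F" "P \<subseteq> D" "multilinear n P a" "multilinear n (D - P) b"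
  shows "products n F D (\<lambda>u. a u * b u)"
proof -
  have "products n F (P \<union> (D - P)) (\<lambda>u. a u * b u)"
    using assms by (intro products.mult products_single) auto
  then show ?thesis using assms(3) by (simp add: Un_absorb1)
qed

lemma multilinear_coord: "j < n i \<Longrightarrow> multilinear n {i} (\<lambda>u. u i j)"
  by (rule multilinearI) auto

lemma multilinear_expand:
  assumes t: "multilinear n D t" and i: "i \<in> D"
  shows "t u = (\<Sum>j<n i. u i j * t (u(i := (\<lambda>l. if l = j then 1 else 0))))"
proof -
  have zero: "t (u(i := (\<lambda>l. 0))) = 0" for u
  proof -
    define Z :: "nat \<Rightarrow> bit" where "Z = (\<lambda>l. 0)"
    have "Z + Z = Z" by (simp add: Z_def fun_eq_iff)
    then have "t (u(i := Z)) = t (u(i := Z)) + t (u(i := Z))"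
      using multilinear_add_coord[OF t i, of u Z Z] by simp
    then show ?thesis unfolding Z_def by (metis bit_add_self)
  qed
  have *: "t (u(i := (\<lambda>l. if l < m then a l else 0))) =
      (\<Sum>j<m. a j * t (u(i := (\<lambda>l. if l = j then 1 else 0))))" for m a
  proof (induction m)
    case 0
    show ?case using zero[of u] by (simp add: fun_upd_def)
  next
    case (Suc m)
    have "(\<lambda>l. if l < Suc m then a l else 0) =
        (\<lambda>l. if l < m then a l else 0) + (\<lambda>l. if l = m then a m else 0)"
      by (auto simp: fun_eq_iff less_Suc_eq)
    then have "t (u(i := (\<lambda>l. if l < Suc m then a l else 0))) =
        t (u(i := (\<lambda>l. if l < m then a l else 0))) + t (u(i := (\<lambda>l. if l = m then a m else 0)))"
      using multilinear_add_coord[OF t i] by simp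
    moreover have "t (u(i := (\<lambda>l. if l = m then a m else 0))) =
        a m * t (u(i := (\<lambda>l. if l = m then 1 else 0)))"
      by (cases "a m") (simp_all add: zero cong: if_cong)
    ultimately show ?case using Suc by (simp add: fun_upd_def)
  qed
  have "t u = t (u(i := (\<lambda>l. if l < n i then u i l else 0)))"
    by (rule multilinear_cong[OF t]) auto
  then show ?thesis using * by simp
qed

text \<open>Summing the character over coordinate \<open>i\<close> first gives \<open>card X\<close>
  or 0, so the bias is the density of the points at which \<open>t\<close> vanishes identically in
  direction \<open>i\<close>. At these points every coefficient \<open>T j\<close> of
  \<open>t\<close> vanishes, so all of them lie in one ideal. Collecting the expansion of
  \<open>t\<close> by generators gives a number of products that does not depend on
  \<open>n i\<close>.\<close>

lemma rank_le_of_bias: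
  fixes c :: real
  assumes D: "finite D" "i \<in> D" and "forcing (D - {i})" and c: "c > 0"
  shows "\<exists>k. \<forall>n t. multilinear n D t \<longrightarrow> (\<Sum>s\<in>tuples n D. chi (t s)) \<ge> c * card (tuples n D) \<longrightarrow>
    rank_le n (proper_subsets D) D k t"
proof -
  let ?D = "D - {i}"
  from assms(3) obtain \<epsilon> where \<epsilon>: "\<epsilon> > 0" and *: "\<forall>\<delta>>0. \<exists>k. \<forall>n \<phi>. dense_weight n ?D \<delta> \<phi> \<longrightarrow> forced n ?D UNIV \<epsilon> k \<phi>"
    unfolding forcing_def by blast
  from * c obtain k where k: "\<And>n \<phi>. dense_weight n ?D c \<phi> \<Longrightarrow> forced n ?D UNIV \<epsilon> k \<phi>"
    by blast
  show ?thesis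
  proof (intro exI[of _ k] allI impI)
    fix n t
    assume t: "multilinear n D t" and bias: "(\<Sum>s\<in>tuples n D. chi (t s)) \<ge> c * card (tuples n D)"
    define X where "X = tuples n {i}"
    define w :: "tuple \<Rightarrow> real" where "w v = of_bool (\<forall>u\<in>X. t (v + u) = 0)" for v
    have D': "{i} \<subseteq> D" using D by auto
    have "(\<Sum>u\<in>X. chi (t (v + u))) = w v * real (card X)" if "v \<in> tuples n ?D" for v
      unfolding w_def X_def
      by (rule sum_chi_additive[where f = "\<lambda>u. t (v + u)"])
        (auto intro: tuples_add multilinear_add_tuples[OF t D(2) that])
    then have "(\<Sum>s\<in>tuples n D. chi (t s)) = mass n ?D w * card X"
      unfolding mass_def sum_distrib_right sum_tuples_split[OF D' D(1)] X_def
      by (intro sum.cong) auto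
    then have "c * card (tuples n ?D) * card X \<le> mass n ?D w * card X"
      using bias card_tuples_split[OF D', of n] by (simp add: X_def mult.assoc)
    moreover have "card X > 0" by (simp add: X_def)
    ultimately have m: "mass n ?D w \<ge> c * card (tuples n ?D)" by simp
    have w: "weight w" by (simp add: weight_def w_def)
    then have "dense_weight n ?D c w" using m by (simp add: dense_weight_def)
    from k[OF this] obtain G where G: "generators n ?D G" "card G \<le> k" and
      GI: "\<And>r. multilinear n ?D r \<Longrightarrow> defect n ?D w r \<le> \<epsilon> * mass n ?D w \<Longrightarrow> r \<in> ideal n ?D G"
      unfolding forced_def by blast
    define e where "e j = (\<lambda>k l. if k = i \<and> l = j then 1 else 0 :: bit)" for j :: nat
    define T where "T j = slice n ?D (e j) t" for j
    have e: "e j \<in> X" if "j < n i" for j using that by (auto simp: e_def X_def tuples_def)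
    have "\<exists>h. (\<forall>p\<in>G. multilinear n (?D - fst p) (h p)) \<and> T j = (\<lambda>u. \<Sum>p\<in>G. snd p u * h p u)"
      if j: "j < n i" for j
    proof -
      have "multilinear n (D \<inter> ?D) (T j)"
        unfolding T_def using e[OF j] by (intro multilinear_slice[OF t, of _ "{i}"]) (auto simp: X_def)
      moreover have "D \<inter> ?D = ?D" by auto
      ultimately have ml: "multilinear n ?D (T j)" by simp
      have "w s * of_bool (T j s = 1) = 0" if "s \<in> tuples n ?D" for s
      proof -
        have "T j s = t (s + e j)" using that by (simp add: T_def slice_eq add.commute[of "e j"])
        then show ?thesis using e[OF j] by (auto simp: w_def)
      qed
      then have "defect n ?D w (T j) = 0" unfolding defect_def by (intro sum.neutral) auto
      then have "T j \<in> ideal n ?D G" using \<epsilon> mass_nonneg[OF w] by (intro GI ml) simp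
      then show ?thesis by (simp add: ideal_def)
    qed
    then have "\<forall>j\<in>{..<n i}. \<exists>h. (\<forall>p\<in>G. multilinear n (?D - fst p) (h p)) \<and>
        T j = (\<lambda>u. \<Sum>p\<in>G. snd p u * h p u)" by simp
    from bchoice[OF this] obtain h where h: "\<And>j p. j < n i \<Longrightarrow> p \<in> G \<Longrightarrow> multilinear n (?D - fst p) (h j p)"
      "\<And>j. j < n i \<Longrightarrow> T j = (\<lambda>u. \<Sum>p\<in>G. snd p u * h j p u)" by auto
    \<comment> \<open>The total cofactor of generator \<open>p\<close>, after exchanging the sum
      over unit vectors with the sum over generators; it regains the coordinate
      \<open>i\<close>.\<close>
    define H where "H p u = (\<Sum>j<n i. u i j * h j p u)" for p u
    have tT: "t (u(i := (\<lambda>l. if l = j then 1 else 0))) = T j u" for u j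
      unfolding T_def slice_def
      by (rule multilinear_cong[OF t]) (auto simp: e_def proj_def)
    have "t u = (\<Sum>p\<in>G. snd p u * H p u)" for u
    proof -
      have "t u = (\<Sum>j<n i. u i j * (\<Sum>p\<in>G. snd p u * h j p u))"
        using multilinear_expand[OF t D(2), of u] by (simp add: tT h(2))
      also have "\<dots> = (\<Sum>p\<in>G. \<Sum>j<n i. u i j * (snd p u * h j p u))"
        unfolding sum_distrib_left by (rule sum.swap)
      also have "\<dots> = (\<Sum>p\<in>G. snd p u * H p u)"
        by (simp add: H_def sum_distrib_left algebra_simps)
      finally show ?thesis .
    qed
    then have "t = (\<lambda>u. \<Sum>p\<in>G. snd p u * H p u)" by auto
    moreover have "rank_le n (proper_subsets D) D (card G) (\<lambda>u. \<Sum>p\<in>G. snd p u * H p u)"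
    proof (intro rank_le_sum rank_le_product products_pair)
      show "finite G" using G by (simp add: generators_def)
      fix p assume p: "p \<in> G"
      have gp: "fst p \<subseteq> ?D" "fst p \<noteq> {}" "multilinear n (fst p) (snd p)"
        using G(1) p by (cases p; auto simp: generators_def)+
      show "fst p \<in> proper_subsets D" "D - fst p \<in> proper_subsets D" "fst p \<subseteq> D"
        using gp D by auto
      show "multilinear n (fst p) (snd p)" by fact
      have "multilinear n ({i} \<union> (?D - fst p)) (\<lambda>u. u i j * h j p u)" if "j < n i" for j
        using that h(1) p by (intro multilinear_mult multilinear_coord) auto
      moreover have "{i} \<union> (?D - fst p) = D - fst p" using gp D by auto
      ultimately show "multilinear n (D - fst p) (H p)"
        unfolding H_def by (intro multilinear_sum) auto
    qed
    ultimately have "rank_le n (proper_subsets D) D (card G) t" by (simp only:)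
    then show "rank_le n (proper_subsets D) D k t" using G(2) by (rule rank_le_mono)
  qed
qed

text \<open>Second moment of the sum \<open>X\<close> of the characters of \<open>Y\<close>: each
  form in \<open>Y\<close> contributes at least half of the mass to the weighted sum of
  \<open>X\<close>, while small pairwise correlations bound the sum of its square. Together they
  give \<open>M\<^sup>2 * \<delta> / 4 \<le> M + M\<^sup>2 * \<delta> / 8\<close>.\<close>

lemma card_small_correlation_le:
  fixes \<delta> :: real and \<phi> :: "tuple \<Rightarrow> real"
  assumes D: "finite D" and \<phi>: "weight \<phi>" and \<delta>: "\<delta> > 0" "mass n D \<phi> \<ge> \<delta> * card (tuples n D)"
    and Y: "finite Y" "\<And>r. r \<in> Y \<Longrightarrow> defect n D \<phi> r \<le> 1 / 4 * mass n D \<phi>"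
    "\<And>r r'. r \<in> Y \<Longrightarrow> r' \<in> Y \<Longrightarrow> r \<noteq> r' \<Longrightarrow>
      (\<Sum>s\<in>tuples n D. chi (r s + r' s)) \<le> \<delta> / 8 * card (tuples n D)"
  shows "card Y \<le> 8 / \<delta>"
proof -
  define M where "M = real (card Y)"
  define N where "N = real (card (tuples n D))"
  define m where "m = mass n D \<phi>"
  define X where "X s = (\<Sum>r\<in>Y. chi (r s))" for s
  have N: "N > 0" using D by (simp add: N_def)
  have 1: "(\<Sum>s\<in>tuples n D. \<phi> s * X s) \<ge> M * (m / 2)"
  proof -
    have "(\<Sum>s\<in>tuples n D. \<phi> s * X s) = (\<Sum>r\<in>Y. \<Sum>s\<in>tuples n D. \<phi> s * chi (r s))"
      unfolding X_def sum_distrib_left by (rule sum.swap)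
    also have "\<dots> = (\<Sum>r\<in>Y. m - 2 * defect n D \<phi> r)"
      unfolding m_def mass_def defect_def
      by (simp add: chi_eq sum_subtractf sum_distrib_left algebra_simps)
    also have "\<dots> \<ge> (\<Sum>r\<in>Y. m / 2)" using Y(2) by (intro sum_mono) (force simp: m_def)
    finally show ?thesis by (simp add: M_def)
  qed
  have 2: "(\<Sum>s\<in>tuples n D. \<phi> s * (X s)\<^sup>2) \<le> (M + M\<^sup>2 * (\<delta> / 8)) * N"
  proof -
    have "(\<Sum>s\<in>tuples n D. \<phi> s * (X s)\<^sup>2) \<le> (\<Sum>s\<in>tuples n D. (X s)\<^sup>2)"
      using weightD[OF \<phi>] by (intro sum_mono) (simp add: mult_left_le_one_le)
    also have "\<dots> = (\<Sum>s\<in>tuples n D. \<Sum>r\<in>Y. \<Sum>r'\<in>Y. chi (r s + r' s))"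
      by (simp add: X_def power2_eq_square sum_product chi_add)
    also have "\<dots> = (\<Sum>r\<in>Y. \<Sum>r'\<in>Y. \<Sum>s\<in>tuples n D. chi (r s + r' s))"
      by (subst sum.swap, rule sum.cong[OF refl], rule sum.swap)
    also have "\<dots> \<le> (\<Sum>r\<in>Y. \<Sum>r'\<in>Y. (if r' = r then N else 0) + \<delta> / 8 * N)"
    proof (intro sum_mono)
      fix r r' assume r: "r \<in> Y" "r' \<in> Y"
      show "(\<Sum>s\<in>tuples n D. chi (r s + r' s)) \<le> (if r' = r then N else 0) + \<delta> / 8 * N"
      proof (cases "r' = r")
        case True
        then show ?thesis using \<delta> N by (simp add: N_def)
      next
        case False
        then show ?thesis using Y(3)[OF r] by (simp add: N_def)
      qed
    qed
    also have "\<dots> = (M + M\<^sup>2 * (\<delta> / 8)) * N"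
      using Y(1) by (simp add: sum.distrib sum.delta M_def power2_eq_square algebra_simps)
    finally show ?thesis .
  qed
  \<comment> \<open>\<open>M / 2\<close> is the lower bound for the weighted mean of
    \<open>X\<close>; the square around it combines the two estimates into one for
    \<open>M\<close>.\<close>
  have "0 \<le> (\<Sum>s\<in>tuples n D. \<phi> s * (X s - M / 2)\<^sup>2)"
    using weightD[OF \<phi>] by (intro sum_nonneg) auto
  also have "\<dots> = (\<Sum>s\<in>tuples n D. \<phi> s * (X s)\<^sup>2) - M * (\<Sum>s\<in>tuples n D. \<phi> s * X s) + M\<^sup>2 / 4 * m"
    unfolding m_def mass_def
    by (simp add: power2_diff sum.distrib sum_subtractf sum_distrib_left sum_distrib_right
        algebra_simps power_divide)
  also have "\<dots> \<le> (M + M\<^sup>2 * (\<delta> / 8)) * N - M * (M * (m / 2)) + M\<^sup>2 / 4 * m"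
    using 2 mult_left_mono[OF 1, of M] by (simp add: M_def)
  finally have "M\<^sup>2 / 4 * m \<le> (M + M\<^sup>2 * (\<delta> / 8)) * N"
    by (simp add: power2_eq_square algebra_simps)
  moreover have "M\<^sup>2 / 4 * (\<delta> * N) \<le> M\<^sup>2 / 4 * m"
    using \<delta>(2) by (intro mult_left_mono) (auto simp: m_def N_def)
  ultimately have "(M * (\<delta> * M / 8)) * N \<le> M * N"
    by (simp add: power2_eq_square algebra_simps)
  then have "M * (\<delta> * M / 8) \<le> M" using N by (rule mult_right_le_imp_le)
  then have "M = 0 \<or> \<delta> * M / 8 \<le> 1"
    using mult_left_le_imp_le[of M "\<delta> * M / 8" 1] by (cases "M = 0") (auto simp: M_def)
  then show ?thesis using \<delta>(1) by (auto simp: M_def field_simps)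
qed

text \<open>Take for \<open>Y\<close> a largest set of forms with small defect and small pairwise
  correlations. Any further form with small defect correlates with a member of \<open>Y\<close>, so
  the sum of the two is biased and has bounded partition rank.\<close>

lemma reduce_to_low_rank:
  fixes \<delta> :: real
  assumes D: "finite D" "i \<in> D" and "forcing (D - {i})" and \<delta>: "\<delta> > 0"
  shows "\<exists>k. \<forall>n \<phi>. dense_weight n D \<delta> \<phi> \<longrightarrow>
    (\<exists>Y. finite Y \<and> card Y \<le> k \<and> (\<forall>r\<in>Y. multilinear n D r) \<and>
      (\<forall>r. multilinear n D r \<longrightarrow> defect n D \<phi> r \<le> 1 / 4 * mass n D \<phi> \<longrightarrow>
        (\<exists>y\<in>Y. rank_le n (proper_subsets D) D k (\<lambda>u. r u + y u))))"
proof -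
  from rank_le_of_bias[OF assms(1-3), of "\<delta> / 8"] \<delta> obtain k where
    k: "\<And>n t. multilinear n D t \<Longrightarrow> (\<Sum>s\<in>tuples n D. chi (t s)) \<ge> \<delta> / 8 * card (tuples n D) \<Longrightarrow>
    rank_le n (proper_subsets D) D k t" by auto
  define K where "K = max k (nat \<lceil>8 / \<delta>\<rceil>)"
  show ?thesis
  proof (intro exI[of _ K] allI impI)
    fix n \<phi> assume "dense_weight n D \<delta> \<phi>"
    then have \<phi>: "weight \<phi>" "mass n D \<phi> \<ge> \<delta> * card (tuples n D)"
      by (simp_all add: dense_weight_def)
    define R where "R = {r. multilinear n D r \<and> defect n D \<phi> r \<le> 1 / 4 * mass n D \<phi>}"
    define Q where "Q Y \<longleftrightarrow> finite Y \<and> Y \<subseteq> R \<and> (\<forall>r\<in>Y. \<forall>r'\<in>Y. r \<noteq> r' \<longrightarrow>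
      (\<Sum>s\<in>tuples n D. chi (r s + r' s)) \<le> \<delta> / 8 * card (tuples n D))" for Y
    have bound: "card Y \<le> K" if "Q Y" for Y
    proof -
      have "real (card Y) \<le> 8 / \<delta>"
        using that by (intro card_small_correlation_le[OF D(1) \<phi>(1) \<delta> \<phi>(2)]) (auto simp: Q_def R_def)
      then show ?thesis unfolding K_def by linarith
    qed
    have "Q {}" by (simp add: Q_def)
    moreover have "\<forall>Y. Q Y \<longrightarrow> card Y < Suc K" using bound by (simp add: less_Suc_eq_le)
    ultimately have "\<exists>Y. Q Y \<and> (\<forall>Y'. Q Y' \<longrightarrow> card Y' \<le> card Y)"
      by (rule Lattices_Big.ex_has_greatest_nat)
    then obtain Y where Y: "Q Y" "\<forall>Y'. Q Y' \<longrightarrow> card Y' \<le> card Y" by (elim exE conjE)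
    have "\<exists>y\<in>Y. rank_le n (proper_subsets D) D K (\<lambda>u. r u + y u)" if r: "r \<in> R" for r
    proof (cases "r \<in> Y")
      case True
      then show ?thesis by (intro bexI[of _ r]) auto
    next
      case False
      have "finite Y" using Y(1) by (simp add: Q_def)
      then have *: "\<not> Q (insert r Y)" using Y(2) False by (metis card_insert_disjoint not_less_eq_eq order_refl)
      have "\<exists>y\<in>Y. (\<Sum>s\<in>tuples n D. chi (r s + y s)) > \<delta> / 8 * card (tuples n D)"
      proof (rule ccontr)
        assume "\<not> ?thesis"
        then have le: "(\<Sum>s\<in>tuples n D. chi (r s + y s)) \<le> \<delta> / 8 * card (tuples n D)" if "y \<in> Y" for y
          using that by force
        have le': "(\<Sum>s\<in>tuples n D. chi (y s + r s)) \<le> \<delta> / 8 * card (tuples n D)" if "y \<in> Y" for y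
          using le[OF that] by (simp add: add.commute)
        have "Q (insert r Y)" using Y(1) r le le' unfolding Q_def by blast
        with * show False by simp
      qed
      then obtain y where y: "y \<in> Y" "(\<Sum>s\<in>tuples n D. chi (r s + y s)) > \<delta> / 8 * card (tuples n D)"
        by blast
      have "multilinear n D (\<lambda>u. r u + y u)"
        using r y Y(1) by (auto simp: R_def Q_def intro: multilinear_add)
      then have "rank_le n (proper_subsets D) D k (\<lambda>u. r u + y u)" using y(2) by (intro k) auto
      then show ?thesis using y(1) rank_le_mono[of n _ D k _ K] by (auto simp: K_def)
    qed
    then show "\<exists>Y. finite Y \<and> card Y \<le> K \<and> (\<forall>r\<in>Y. multilinear n D r) \<and>
      (\<forall>r. multilinear n D r \<longrightarrow> defect n D \<phi> r \<le> 1 / 4 * mass n D \<phi> \<longrightarrow>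
        (\<exists>y\<in>Y. rank_le n (proper_subsets D) D K (\<lambda>u. r u + y u)))"
      using Y(1) bound[OF Y(1)] by (intro exI[of _ Y]) (auto simp: Q_def R_def)
  qed
qed

section \<open>Eliminating a block\<close>

text \<open>Enlarge \<open>B\<close> as long as it is bad. Each enlargement raises the potential by
  \<open>c\<close>, so \<open>p\<close> of them would exceed its upper bound.\<close>

lemma greedy_saturation:
  fixes \<Phi> :: "'s set \<Rightarrow> real"
  assumes step: "\<And>B. finite B \<Longrightarrow> B\<^sub>0 \<subseteq> B \<Longrightarrow> ok B \<Longrightarrow> bad B \<Longrightarrow>
      \<exists>B'. B \<subseteq> B' \<and> finite B' \<and> ok B' \<and> card B' \<le> card B + q \<and> \<Phi> B' \<ge> \<Phi> B + c"
    and bound: "\<And>B. finite B \<Longrightarrow> 0 \<le> \<Phi> B \<and> \<Phi> B \<le> C"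
    and B\<^sub>0: "finite B\<^sub>0" "ok B\<^sub>0" and p: "real p * c > C"
  shows "\<exists>B. finite B \<and> B\<^sub>0 \<subseteq> B \<and> ok B \<and> card B \<le> card B\<^sub>0 + p * q \<and> \<not> bad B"
proof (rule ccontr)
  assume no: "\<not> ?thesis"
  have "\<exists>B. finite B \<and> B\<^sub>0 \<subseteq> B \<and> ok B \<and> card B \<le> card B\<^sub>0 + m * q \<and> \<Phi> B \<ge> real m * c"
    if "m \<le> p" for m
    using that
  proof (induction m)
    case 0
    then show ?case using B\<^sub>0 bound by (intro exI[of _ B\<^sub>0]) auto
  next
    case (Suc m)
    then obtain B where B: "finite B" "B\<^sub>0 \<subseteq> B" "ok B" "card B \<le> card B\<^sub>0 + m * q" "\<Phi> B \<ge> real m * c"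
      by auto
    have "card B \<le> card B\<^sub>0 + p * q" using B(4) Suc.prems
      by (meson Suc_leD add_left_mono le_trans mult_le_mono1)
    with no B have "bad B" by blast
    from step[OF B(1-3) this] obtain B' where "B \<subseteq> B'" "finite B'" "ok B'" "card B' \<le> card B + q"
      "\<Phi> B' \<ge> \<Phi> B + c" by blast
    with B show ?case by (intro exI[of _ B']) (auto simp: algebra_simps)
  qed
  from this[of p] obtain B where "finite B" "\<Phi> B \<ge> real p * c" by auto
  with bound[of B] p show False by auto
qed

lemma ideal_times:
  assumes v: "v \<in> ideal n I G" and G: "generators n I G" and b: "multilinear n (D - I) b" and "I \<subseteq> D"
  shows "(\<lambda>u. v u * b u) \<in> ideal n D G"
proof -
  obtain h where h: "\<forall>p\<in>G. multilinear n (I - fst p) (h p)" "v = (\<lambda>u. \<Sum>p\<in>G. snd p u * h p u)"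
    using v by (auto simp: ideal_def)
  have "multilinear n (D - fst p) (\<lambda>u. h p u * b u)" if "p \<in> G" for p
  proof -
    have "multilinear n ((I - fst p) \<union> (D - I)) (\<lambda>u. h p u * b u)"
      using h(1) that b by (intro multilinear_mult) auto
    moreover have "fst p \<subseteq> I" using G that by (cases p) (auto simp: generators_def)
    then have "(I - fst p) \<union> (D - I) = D - fst p" using assms(4) by auto
    ultimately show ?thesis by simp
  qed
  then show ?thesis unfolding ideal_def h(2)
    by (intro CollectI exI[of _ "\<lambda>p u. h p u * b u"]) (auto simp: sum_distrib_right mult.assoc)
qed

text \<open>Cofactors of generators on all of \<open>I\<close> are constants, so
  \<open>ideal n I ({I} \<times> B)\<close> is the span of \<open>B\<close>. Thus
  \<open>near\<close> means distance at most \<open>L\<close> from this span, measured in partition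
  rank.\<close>

definition near :: "(nat \<Rightarrow> nat) \<Rightarrow> nat set \<Rightarrow> form set \<Rightarrow> nat \<Rightarrow> form \<Rightarrow> bool" where
  "near n I B L c \<longleftrightarrow> (\<exists>v\<in>ideal n I ({I} \<times> B). rank_le n (proper_subsets I) I L (\<lambda>u. c u + v u))"

lemma near_mono: "near n I B L c \<Longrightarrow> B \<subseteq> B' \<Longrightarrow> finite B' \<Longrightarrow> near n I B' L c"
  unfolding near_def by (meson Sigma_mono finite.emptyI finite.insertI finite_SigmaI ideal_mono subset_refl)

text \<open>Slicing evaluates the cofactors at \<open>x\<close>, which leaves a combination of
  \<open>B\<close> with scalar coefficients.\<close>

lemma slice_ideal:
  assumes w: "w \<in> ideal n D ({I} \<times> B)" and B: "\<And>g. g \<in> B \<Longrightarrow> multilinear n I g"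
    and x: "x \<in> tuples n (D - I)"
  shows "slice n I x w \<in> ideal n I ({I} \<times> B)"
proof -
  obtain h where h: "\<forall>p\<in>{I} \<times> B. multilinear n (D - fst p) (h p)"
    "w = (\<lambda>u. \<Sum>p\<in>{I} \<times> B. snd p u * h p u)"
    using w by (auto simp: ideal_def)
  have "slice n I x w = (\<lambda>u. \<Sum>p\<in>{I} \<times> B. snd p u * h p x)"
  proof
    fix u
    have "snd p (x + proj n I u) * h p (x + proj n I u) = snd p u * h p x" if p: "p \<in> {I} \<times> B" for p
    proof -
      have "slice n I x (snd p) = snd p"
        using p B x by (intro slice_id[where J = I and K = "D - I"]) auto
      moreover have "slice n I x (h p) = (\<lambda>_. h p x)"
        using p h(1) by (intro slice_const[where J = "D - I"]) auto
      ultimately show ?thesis by (simp add: slice_def fun_eq_iff)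
    qed
    then show "slice n I x w u = (\<Sum>p\<in>{I} \<times> B. snd p u * h p x)"
      by (simp add: slice_def h(2))
  qed
  then show ?thesis unfolding ideal_def by (intro CollectI exI[of _ "\<lambda>p u. h p x"]) auto
qed

text \<open>This is what the induction hypothesis provides: \<open>V x\<close> comes from the block \<open>I\<close>, applied to the
  restriction of the weight to the slice at \<open>x\<close>, and \<open>G\<close> from the complement of \<open>I\<close>, applied to the
  marginal \<open>\<psi>\<close> of the weight.\<close>

definition slice_data where
  "slice_data n D I R \<psi> V G \<epsilon> N k \<longleftrightarrow>
     (\<forall>x. 0 \<le> \<psi> x) \<and> mass n (D - I) \<psi> > 0 \<and>
     (\<forall>x\<in>tuples n (D - I). finite (V x) \<and> card (V x) \<le> N) \<and>
     (\<forall>r\<in>R. (\<Sum>x\<in>tuples n (D - I). \<psi> x *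
        of_bool (\<nexists>v. v \<in> V x \<and> rank_le n (proper_subsets I) I k (\<lambda>u. slice n I x r u + v u)))
          \<le> \<epsilon> / 2 * mass n (D - I) \<psi>) \<and>
     generators n (D - I) G \<and>
     (\<forall>b. multilinear n (D - I) b \<longrightarrow> defect n (D - I) \<psi> b \<le> \<epsilon> * mass n (D - I) \<psi> \<longrightarrow>
        b \<in> ideal n (D - I) G)"

text \<open>Here \<open>z\<close> collects the products that use the blocks in \<open>F\<close>
  only, and \<open>w\<close> is what \<open>B\<close> accounts for already. The number of terms
  indexed by \<open>Q\<close>, those still to be eliminated, is the induction parameter of
  \<open>block_elimination\<close>.\<close>

definition decomposed where
  "decomposed n D I F Q a b L M B r \<longleftrightarrow> finite Q \<and>
     (\<forall>j\<in>Q. multilinear n I (a j) \<and> rank_le n F (D - I) M (b j)) \<and>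
     (\<exists>z w. rank_le n F D L z \<and> w \<in> ideal n D ({I} \<times> B) \<and>
       r = (\<lambda>u. (\<Sum>j\<in>Q. a j u * b j u) + z u + w u))"

text \<open>A form of this kind shows that \<open>B\<close> is too small: its factors on
  \<open>I\<close> are independent of \<open>B\<close> in a robust sense, and some cofactor, lying
  outside the ideal of \<open>G\<close>, is nonzero on many slices. Without such a form, each form
  in \<open>R\<close> with a decomposition into \<open>q\<close> terms has all cofactors in that
  ideal or a non-empty sum of factors near \<open>B\<close>.\<close>

definition saturation_failure where
  "saturation_failure n D I F R G B\<^sub>0 q L M L' B \<longleftrightarrow> (\<exists>r\<in>R. \<exists>(Q :: nat set) a b.
     card Q = q \<and> decomposed n D I F Q a b L M B\<^sub>0 r \<and>
     (\<forall>\<Lambda>\<subseteq>Q. \<Lambda> \<noteq> {} \<longrightarrow> \<not> near n I B L' (\<lambda>u. \<Sum>j\<in>\<Lambda>. a j u)) \<and>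
     (\<exists>j\<in>Q. b j \<notin> ideal n (D - I) G))"

text \<open>A weighted count of the slice representatives in \<open>V x\<close> that
  \<open>B\<close> explains. It increases with \<open>B\<close>, and under \<open>slice_data\<close>
  the bound on \<open>card (V x)\<close> keeps it bounded.\<close>

definition near_potential where
  "near_potential n D I \<psi> V L B =
     (\<Sum>x\<in>tuples n (D - I). \<psi> x * real (card {v\<in>V x. near n I B L v}))"

lemma bit_sum_eq:
  fixes f :: "nat \<Rightarrow> bit"
  assumes "finite Q" shows "(\<Sum>j\<in>Q. g j * f j) = (\<Sum>j\<in>{j\<in>Q. f j = 1}. g j)"
proof -
  have "(\<Sum>j\<in>Q. g j * f j) = (\<Sum>j\<in>{j\<in>Q. f j = 1}. g j * f j)"
    using assms by (intro sum.mono_neutral_right) (auto simp flip: bit_neq_0_iff)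
  also have "\<dots> = (\<Sum>j\<in>{j\<in>Q. f j = 1}. g j)" by (intro sum.cong) auto
  finally show ?thesis .
qed

text \<open>Add all factors \<open>a j\<close> of the failing form to \<open>B\<close>. Where
  \<open>b j0 x = 1\<close>, the slice of \<open>r\<close> at \<open>x\<close> is a non-empty sum
  \<open>s\<close> of the \<open>a j\<close>, plus low rank, plus a combination of \<open>B\<close>;
  so its representative in \<open>V x\<close>, if there is one, is near the new span. It was not
  near the old one, as \<open>s\<close> would then be within distance \<open>2 * (L + k)\<close> of
  it.\<close>

lemma potential_increase:
  assumes data: "slice_data n D I R \<psi> V G \<epsilon> N k"
    and I: "finite D" "I \<subseteq> D" and F: "\<And>P. P \<in> F \<Longrightarrow> \<not> I \<subseteq> P"
    and B: "finite B" "B\<^sub>0 \<subseteq> B" "\<And>g. g \<in> B \<Longrightarrow> multilinear n I g"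
    and fail: "saturation_failure n D I F R G B\<^sub>0 q L M (2 * (L + k)) B"
  shows "\<exists>B'. B \<subseteq> B' \<and> finite B' \<and> (\<forall>g\<in>B'. multilinear n I g) \<and> card B' \<le> card B + q \<and>
    near_potential n D I \<psi> V (L + k) B' \<ge> near_potential n D I \<psi> V (L + k) B
      + \<epsilon> / 2 * mass n (D - I) \<psi>"
proof -
  from fail obtain r a b and Q :: "nat set" where r: "r \<in> R" and *: "card Q = q \<and> decomposed n D I F Q a b L M B\<^sub>0 r \<and>
     (\<forall>\<Lambda>\<subseteq>Q. \<Lambda> \<noteq> {} \<longrightarrow> \<not> near n I B (2 * (L + k)) (\<lambda>u. \<Sum>j\<in>\<Lambda>. a j u)) \<and>
     (\<exists>j\<in>Q. b j \<notin> ideal n (D - I) G)"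
    unfolding saturation_failure_def by (elim bexE exE) (rule that)
  then have Q: "card Q = q" and dec: "decomposed n D I F Q a b L M B\<^sub>0 r"
    and far: "\<forall>\<Lambda>\<subseteq>Q. \<Lambda> \<noteq> {} \<longrightarrow> \<not> near n I B (2 * (L + k)) (\<lambda>u. \<Sum>j\<in>\<Lambda>. a j u)"
    by simp_all
  from * obtain j0 where j0: "j0 \<in> Q" "b j0 \<notin> ideal n (D - I) G" by blast
  from dec obtain z w where fQ: "finite Q" and a: "\<And>j. j \<in> Q \<Longrightarrow> multilinear n I (a j)"
    and b: "\<And>j. j \<in> Q \<Longrightarrow> rank_le n F (D - I) M (b j)"
    and z: "rank_le n F D L z" and w: "w \<in> ideal n D ({I} \<times> B\<^sub>0)"
    and req: "r = (\<lambda>u. (\<Sum>j\<in>Q. a j u * b j u) + z u + w u)"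
    unfolding decomposed_def by (elim exE conjE) (rule that, auto)
  define B' where "B' = B \<union> a ` Q"
  have B': "B \<subseteq> B'" "finite B'" "\<And>g. g \<in> B' \<Longrightarrow> multilinear n I g"
    using B fQ a by (auto simp: B'_def)
  have cB': "card B' \<le> card B + q"
    unfolding B'_def Q[symmetric] by (meson add_left_mono card_Un_le card_image_le fQ le_trans)
  have bml: "multilinear n (D - I) (b j)" if "j \<in> Q" for j
    using b[OF that] by (rule multilinear_rank_le)
  let ?near = "\<lambda>B x. {v\<in>V x. near n I B (L + k) v}"
  let ?good = "\<lambda>x. \<exists>v. v \<in> V x \<and> rank_le n (proper_subsets I) I k (\<lambda>u. slice n I x r u + v u)"
  from data have \<psi>: "\<And>x. 0 \<le> \<psi> x" and V: "\<And>x. x \<in> tuples n (D - I) \<Longrightarrow> finite (V x)"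
    and few: "(\<Sum>x\<in>tuples n (D - I). \<psi> x * of_bool (\<not> ?good x)) \<le> \<epsilon> / 2 * mass n (D - I) \<psi>"
    and wit: "\<And>b. multilinear n (D - I) b \<Longrightarrow> defect n (D - I) \<psi> b \<le> \<epsilon> * mass n (D - I) \<psi> \<Longrightarrow>
        b \<in> ideal n (D - I) G"
    unfolding slice_data_def using r by auto
  have sub: "?near B x \<subseteq> ?near B' x" for x using near_mono B' by blast
  have key: "card (?near B' x) \<ge> card (?near B x) + 1"
    if x: "x \<in> tuples n (D - I)" and good: "?good x" and bx: "b j0 x = 1" for x
  proof -
    obtain v where v: "v \<in> V x" "rank_le n (proper_subsets I) I k (\<lambda>u. slice n I x r u + v u)"
      using good by auto
    define \<Lambda> where "\<Lambda> = {j\<in>Q. b j x = 1}"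
    define s where "s u = (\<Sum>j\<in>\<Lambda>. a j u)" for u
    have \<Lambda>: "\<Lambda> \<subseteq> Q" "\<Lambda> \<noteq> {}" using j0 bx by (auto simp: \<Lambda>_def)
    have prod: "slice n I x (\<lambda>u. a j u * b j u) u = a j u * b j x" if "j \<in> Q" for j u
    proof -
      have "slice n I x (a j) = a j"
        using a[OF that] x by (intro slice_id[where J = I and K = "D - I"]) auto
      moreover have "slice n I x (b j) = (\<lambda>_. b j x)"
        using bml[OF that] by (intro slice_const[where J = "D - I"]) auto
      ultimately show ?thesis by (simp add: slice_def fun_eq_iff)
    qed
    have slr: "slice n I x r u = s u + slice n I x z u + slice n I x w u" for u
    proof -
      have "slice n I x r u = (\<Sum>j\<in>Q. slice n I x (\<lambda>u. a j u * b j u) u) + slice n I x z u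
          + slice n I x w u"
        by (simp add: slice_def req)
      also have "(\<Sum>j\<in>Q. slice n I x (\<lambda>u. a j u * b j u) u) = s u"
        unfolding s_def \<Lambda>_def using bit_sum_eq[OF fQ, of "\<lambda>j. a j u" "\<lambda>j. b j x"] by (simp add: prod)
      finally show ?thesis .
    qed
    have sw: "slice n I x w \<in> ideal n I ({I} \<times> B)"
      using slice_ideal[OF w _ x] B ideal_mono[of _ n I "{I} \<times> B\<^sub>0" "{I} \<times> B"] by blast
    have DI: "D \<inter> I = I" using I by auto
    have sz: "rank_le n (proper_subsets I) I L (slice n I x z)"
      using rank_le_slice[OF z F x] DI by auto
    have low: "rank_le n (proper_subsets I) I (L + k) (\<lambda>u. v u + (s u + slice n I x w u))"
    proof -
      have "rank_le n (proper_subsets I) I (L + k) (\<lambda>u. slice n I x z u + (slice n I x r u + v u))"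
        by (rule rank_le_add[OF sz v(2)]) simp
      moreover have "slice n I x z u + (slice n I x r u + v u) = v u + (s u + slice n I x w u)" for u
        unfolding slr by (simp add: algebra_simps)
      ultimately show ?thesis by simp
    qed
    have "(\<lambda>u. s u) \<in> ideal n I ({I} \<times> B')"
      unfolding s_def
    proof (rule ideal_sum)
      fix j assume j: "j \<in> \<Lambda>"
      have "(\<lambda>u. a j u * 1) \<in> ideal n I ({I} \<times> B')"
        using j \<Lambda> B'(2) by (intro ideal_gen[where J = I]) (auto simp: B'_def)
      then show "a j \<in> ideal n I ({I} \<times> B')" by simp
    qed
    moreover have "slice n I x w \<in> ideal n I ({I} \<times> B')"
      using ideal_mono[OF sw, of "{I} \<times> B'"] B' by auto
    ultimately have "(\<lambda>u. s u + slice n I x w u) \<in> ideal n I ({I} \<times> B')" by (rule ideal_add)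
    with low have "near n I B' (L + k) v" unfolding near_def by (rule bexI)
    moreover have "\<not> near n I B (L + k) v"
    proof
      assume "near n I B (L + k) v"
      then obtain v' where v': "v' \<in> ideal n I ({I} \<times> B)"
        "rank_le n (proper_subsets I) I (L + k) (\<lambda>u. v u + v' u)" by (auto simp: near_def)
      have "rank_le n (proper_subsets I) I (2 * (L + k))
          (\<lambda>u. (v u + (s u + slice n I x w u)) + (v u + v' u))"
        by (rule rank_le_add[OF low v'(2)]) simp
      moreover have "(v u + (s u + slice n I x w u)) + (v u + v' u) = s u + (slice n I x w u + v' u)" for u
        by (simp add: algebra_simps)
      ultimately have "rank_le n (proper_subsets I) I (2 * (L + k))
          (\<lambda>u. s u + (slice n I x w u + v' u))" by simp
      then have "near n I B (2 * (L + k)) s"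
        unfolding near_def using ideal_add[OF sw v'(1)] by (rule bexI)
      with far[rule_format, OF \<Lambda>] show False by (simp add: s_def[abs_def])
    qed
    ultimately have "v \<in> ?near B' x - ?near B x" using v(1) by auto
    then have "?near B x \<subset> ?near B' x" using sub by auto
    moreover have "finite (?near B' x)" using V[OF x] by simp
    ultimately have "card (?near B x) < card (?near B' x)" by (simp add: psubset_card_mono)
    then show ?thesis by simp
  qed
  \<comment> \<open>Since \<open>b j0\<close> is outside the ideal of \<open>G\<close>, it is 1 on
    more than an \<open>\<epsilon>\<close> share of the slices. Slices without a representative make
    up at most \<open>\<epsilon> / 2\<close>, so at least the other half counts towards the
    gain.\<close>
  have "defect n (D - I) \<psi> (b j0) > \<epsilon> * mass n (D - I) \<psi>"
    using wit[OF bml[OF j0(1)]] j0(2) not_le by blast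
  then have "\<epsilon> / 2 * mass n (D - I) \<psi> \<le> defect n (D - I) \<psi> (b j0) -
      (\<Sum>x\<in>tuples n (D - I). \<psi> x * of_bool (\<not> ?good x))"
    using few by simp
  also have "\<dots> \<le> (\<Sum>x\<in>tuples n (D - I). \<psi> x * (real (card (?near B' x)) - real (card (?near B x))))"
    unfolding defect_def sum_subtractf[symmetric]
  proof (rule sum_mono)
    fix x assume x: "x \<in> tuples n (D - I)"
    have le: "card (?near B x) \<le> card (?near B' x)" using sub V[OF x] by (intro card_mono) auto
    have "of_bool (b j0 x = 1) - of_bool (\<not> ?good x) \<le>
        real (card (?near B' x)) - real (card (?near B x))"
    proof (cases "?good x \<and> b j0 x = 1")
      case True
      then have "card (?near B' x) \<ge> card (?near B x) + 1" using key[OF x] by blast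
      then show ?thesis using True by simp
    next
      case False
      then have "of_bool (b j0 x = 1) - of_bool (\<not> ?good x) \<le> (0 :: real)" by auto
      then show ?thesis using le by linarith
    qed
    then have "\<psi> x * (of_bool (b j0 x = 1) - of_bool (\<not> ?good x)) \<le>
        \<psi> x * (real (card (?near B' x)) - real (card (?near B x)))"
      using \<psi> by (intro mult_left_mono) auto
    then show "\<psi> x * of_bool (b j0 x = 1) - \<psi> x * of_bool (\<not> ?good x) \<le>
        \<psi> x * (real (card (?near B' x)) - real (card (?near B x)))"
      by (simp only: right_diff_distrib)
  qed
  also have "\<dots> = near_potential n D I \<psi> V (L + k) B' - near_potential n D I \<psi> V (L + k) B"
    unfolding near_potential_def by (simp only: right_diff_distrib sum_subtractf)
  finally show ?thesis using B' cB' by (intro exI[of _ B']) auto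
qed

lemma near_potential_bounds:
  assumes "slice_data n D I R \<psi> V G \<epsilon> N k"
  shows "0 \<le> near_potential n D I \<psi> V L B \<and> near_potential n D I \<psi> V L B \<le> N * mass n (D - I) \<psi>"
proof -
  from assms have \<psi>: "\<And>x. 0 \<le> \<psi> x"
    and V: "\<And>x. x \<in> tuples n (D - I) \<Longrightarrow> finite (V x) \<and> card (V x) \<le> N"
    by (auto simp: slice_data_def)
  have "near_potential n D I \<psi> V L B \<le> (\<Sum>x\<in>tuples n (D - I). \<psi> x * N)"
    unfolding near_potential_def
  proof (intro sum_mono mult_left_mono \<psi>)
    fix x assume "x \<in> tuples n (D - I)"
    then show "real (card {v\<in>V x. near n I B L v}) \<le> N"
      using V card_mono[of "V x" "{v\<in>V x. near n I B L v}"] by force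
  qed
  then show ?thesis using \<psi>
    by (auto simp: near_potential_def mass_def sum_distrib_left mult.commute intro!: sum_nonneg)
qed

text \<open>The sum over \<open>\<Lambda>\<close> is a combination \<open>v\<close> of
  \<open>B\<close> up to rank \<open>L'\<close>. Solving for \<open>a j0\<close> and substituting
  adds \<open>b j0\<close> to the other cofactors in \<open>\<Lambda>\<close>, puts a remainder of
  rank \<open>L' * M\<close> into \<open>z\<close>, and puts \<open>v\<close> times
  \<open>b j0\<close> into \<open>w\<close>.\<close>

lemma eliminate_term:
  assumes dec: "decomposed n D I F Q a b L M B\<^sub>0 r" and I: "I \<subseteq> D" and F: "proper_subsets I \<subseteq> F"
    and B: "finite B" "B\<^sub>0 \<subseteq> B" "\<And>g. g \<in> B \<Longrightarrow> multilinear n I g" "I \<noteq> {}"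
    and \<Lambda>: "\<Lambda> \<subseteq> Q" "j0 \<in> \<Lambda>" "near n I B L' (\<lambda>u. \<Sum>j\<in>\<Lambda>. a j u)"
  shows "decomposed n D I F (Q - {j0}) a (\<lambda>j u. b j u + of_bool (j \<in> \<Lambda>) * b j0 u)
    (L + L' * M) (2 * M) B r"
proof -
  from dec obtain z w where fQ: "finite Q" and a: "\<And>j. j \<in> Q \<Longrightarrow> multilinear n I (a j)"
    and b: "\<And>j. j \<in> Q \<Longrightarrow> rank_le n F (D - I) M (b j)"
    and z: "rank_le n F D L z" and w: "w \<in> ideal n D ({I} \<times> B\<^sub>0)"
    and req: "r = (\<lambda>u. (\<Sum>j\<in>Q. a j u * b j u) + z u + w u)"
    unfolding decomposed_def by (elim exE conjE) (rule that, auto)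
  from \<Lambda>(3) obtain v where v: "v \<in> ideal n I ({I} \<times> B)"
    "rank_le n (proper_subsets I) I L' (\<lambda>u. (\<Sum>j\<in>\<Lambda>. a j u) + v u)" by (auto simp: near_def)
  have j0: "j0 \<in> Q" using \<Lambda> by auto
  have f\<Lambda>: "finite \<Lambda>" using \<Lambda> fQ finite_subset by auto
  define y where "y u = ((\<Sum>j\<in>\<Lambda>. a j u) + v u) * b j0 u" for u
  have ID: "I \<union> (D - I) = D" using I by auto
  have "rank_le n F (I \<union> (D - I)) (L' * M) (\<lambda>u. ((\<Sum>j\<in>\<Lambda>. a j u) + v u) * b j0 u)"
    by (rule rank_le_times[OF rank_le_family_mono[OF v(2) F] b[OF j0]]) auto
  then have y: "rank_le n F D (L' * M) y" unfolding y_def[abs_def] ID .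
  have gen: "generators n I ({I} \<times> B)" using B by (auto simp: generators_def)
  have vb: "(\<lambda>u. v u * b j0 u) \<in> ideal n D ({I} \<times> B)"
    by (rule ideal_times[OF v(1) gen multilinear_rank_le[OF b[OF j0]] I])
  have w': "w \<in> ideal n D ({I} \<times> B)" using ideal_mono[OF w, of "{I} \<times> B"] B by auto
  have req': "r u = (\<Sum>j\<in>Q - {j0}. a j u * (b j u + of_bool (j \<in> \<Lambda>) * b j0 u)) + (z u + y u)
      + (w u + v u * b j0 u)" for u
  proof -
    have 1: "(\<Sum>j\<in>Q. a j u * b j u) = (\<Sum>j\<in>Q - {j0}. a j u * b j u) + a j0 u * b j0 u"
      using sum.remove[OF fQ j0, of "\<lambda>j. a j u * b j u"] by (simp add: add.commute)
    have 2: "(\<Sum>j\<in>\<Lambda>. a j u) = a j0 u + (\<Sum>j\<in>\<Lambda> - {j0}. a j u)"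
      using sum.remove[OF f\<Lambda> \<Lambda>(2)] by simp
    have "(\<Sum>j\<in>Q - {j0}. a j u * (of_bool (j \<in> \<Lambda>) * b j0 u)) =
        (\<Sum>j\<in>Q - {j0}. if j \<in> \<Lambda> then a j u * b j0 u else 0)"
      by (intro sum.cong) auto
    also have "\<dots> = (\<Sum>j\<in>(Q - {j0}) \<inter> \<Lambda>. a j u * b j0 u)"
      using fQ by (simp add: sum.inter_restrict)
    also have "(Q - {j0}) \<inter> \<Lambda> = \<Lambda> - {j0}" using \<Lambda> by auto
    finally have 3: "(\<Sum>j\<in>Q - {j0}. a j u * (of_bool (j \<in> \<Lambda>) * b j0 u)) =
        (\<Sum>j\<in>\<Lambda> - {j0}. a j u) * b j0 u"
      by (simp add: sum_distrib_right)
    show ?thesis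
      unfolding req y_def 1 2 distrib_left sum.distrib 3 by (simp add: algebra_simps)
  qed
  have b': "rank_le n F (D - I) (2 * M) (\<lambda>u. b j u + of_bool (j \<in> \<Lambda>) * b j0 u)" if "j \<in> Q" for j
  proof (cases "j \<in> \<Lambda>")
    case True
    then show ?thesis using rank_le_add[OF b[OF that] b[OF j0], of "2 * M"] by simp
  next
    case False
    then show ?thesis using rank_le_mono[OF b[OF that], of "2 * M"] by simp
  qed
  have zy: "rank_le n F D (L + L' * M) (\<lambda>u. z u + y u)" by (rule rank_le_add[OF z y order_refl])
  show ?thesis unfolding decomposed_def
    using fQ a b' zy ideal_add[OF w' vb] req'
    by (intro conjI ballI exI[of _ "\<lambda>u. z u + y u"] exI[of _ "\<lambda>u. w u + v u * b j0 u"]) auto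
qed

definition eliminates where
  "eliminates n D I F R G q L M B\<^sub>0 K B \<longleftrightarrow> finite B \<and> B\<^sub>0 \<subseteq> B \<and> (\<forall>g\<in>B. multilinear n I g) \<and>
     (\<forall>r\<in>R. \<forall>(Q :: nat set) a b. card Q = q \<longrightarrow> decomposed n D I F Q a b L M B\<^sub>0 r \<longrightarrow>
        (\<exists>v\<in>ideal n D ({I} \<times> B \<union> G). rank_le n F D K (\<lambda>u. r u + v u)))"

text \<open>Induction on the number \<open>q\<close> of terms. The set \<open>B\<^sub>0\<close> is
  saturated before any single form is considered, so the result serves all of \<open>R\<close>.
  After that each form is covered by the ideal of \<open>G\<close> or loses one term by
  \<open>eliminate_term\<close>, and the induction hypothesis applies with the saturated set in
  place of \<open>B\<^sub>0\<close>.\<close>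

lemma block_elimination:
  fixes \<epsilon> :: real
  assumes D: "finite D" "I \<subseteq> D" "I \<noteq> {}" and F: "\<And>P. P \<in> F \<Longrightarrow> \<not> I \<subseteq> P" "proper_subsets I \<subseteq> F"
    and \<epsilon>: "\<epsilon> > 0"
  shows "\<exists>k' K'. \<forall>n R \<psi> V G B\<^sub>0. slice_data n D I R \<psi> V G \<epsilon> N k \<longrightarrow> finite B\<^sub>0 \<longrightarrow> card B\<^sub>0 \<le> m \<longrightarrow>
    (\<forall>g\<in>B\<^sub>0. multilinear n I g) \<longrightarrow> (\<exists>B. card B \<le> k' \<and> eliminates n D I F R G q L M B\<^sub>0 K' B)"
proof (induction q arbitrary: L M m)
  case 0
  show ?case
  proof (rule exI[of _ m], rule exI[of _ L], intro allI impI)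
    fix n R \<psi> V G B\<^sub>0
    assume data: "slice_data n D I R \<psi> V G \<epsilon> N k" and B: "finite B\<^sub>0" "card B\<^sub>0 \<le> m"
      "\<forall>g\<in>B\<^sub>0. multilinear n I g"
    have "finite G" using data by (simp add: slice_data_def generators_def)
    have "\<exists>v\<in>ideal n D ({I} \<times> B\<^sub>0 \<union> G). rank_le n F D L (\<lambda>u. r u + v u)"
      if "card Q = 0" and dec: "decomposed n D I F Q a b L M B\<^sub>0 r" for r and Q :: "nat set" and a b
    proof -
      have "Q = {}" using that by (auto simp: decomposed_def)
      with dec obtain z w where z: "rank_le n F D L z" and w: "w \<in> ideal n D ({I} \<times> B\<^sub>0)"
        and r: "r = (\<lambda>u. z u + w u)"
        unfolding decomposed_def by auto
      have "(\<lambda>u. r u + w u) = z" by (auto simp: r add.assoc)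
      moreover have "w \<in> ideal n D ({I} \<times> B\<^sub>0 \<union> G)"
        using ideal_mono[OF w] B(1) \<open>finite G\<close> by auto
      ultimately show ?thesis using z by (intro bexI[of _ w]) auto
    qed
    then have "eliminates n D I F R G 0 L M B\<^sub>0 L B\<^sub>0"
      unfolding eliminates_def using B by simp
    then show "\<exists>B. card B \<le> m \<and> eliminates n D I F R G 0 L M B\<^sub>0 L B"
      using B(2) by blast
  qed
next
  case (Suc q)
  define L' where "L' = 2 * (L + k)"
  \<comment> \<open>Each enlargement gains \<open>\<epsilon> / 2\<close> of the mass and the
    potential is at most \<open>N\<close> times the mass; the added 1 makes the comparison
    strict.\<close>
  define p where "p = nat \<lceil>2 * N / \<epsilon>\<rceil> + 1"
  define m' where "m' = m + p * Suc q"
  from Suc.IH[of m' "L + L' * M" "2 * M"] obtain k' K' where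
    IH: "\<forall>n R \<psi> V G B\<^sub>0. slice_data n D I R \<psi> V G \<epsilon> N k \<longrightarrow> finite B\<^sub>0 \<longrightarrow> card B\<^sub>0 \<le> m' \<longrightarrow>
    (\<forall>g\<in>B\<^sub>0. multilinear n I g) \<longrightarrow>
      (\<exists>B. card B \<le> k' \<and> eliminates n D I F R G q (L + L' * M) (2 * M) B\<^sub>0 K' B)"
    by (elim exE)
  show ?case
  proof (rule exI[of _ k'], rule exI[of _ "max L K'"], intro allI impI)
    fix n R \<psi> V G B\<^sub>0
    assume data: "slice_data n D I R \<psi> V G \<epsilon> N k" and B\<^sub>0: "finite B\<^sub>0" "card B\<^sub>0 \<le> m"
      "\<forall>g\<in>B\<^sub>0. multilinear n I g"
    have G: "finite G" "generators n (D - I) G" and \<Psi>: "mass n (D - I) \<psi> > 0"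
      using data by (auto simp: slice_data_def generators_def)
    have "2 * N / \<epsilon> < real p" unfolding p_def by linarith
    then have "real N < real p * (\<epsilon> / 2)" using \<epsilon> by (simp add: field_simps)
    then have pc: "real p * (\<epsilon> / 2 * mass n (D - I) \<psi>) > N * mass n (D - I) \<psi>"
      using \<Psi> by (simp flip: mult.assoc)
    have "\<exists>B. finite B \<and> B\<^sub>0 \<subseteq> B \<and> (\<forall>g\<in>B. multilinear n I g) \<and> card B \<le> card B\<^sub>0 + p * Suc q \<and>
        \<not> saturation_failure n D I F R G B\<^sub>0 (Suc q) L M L' B"
      by (rule greedy_saturation[where ok = "\<lambda>B. \<forall>g\<in>B. multilinear n I g"
          and \<Phi> = "near_potential n D I \<psi> V (L + k)"
          and bad = "saturation_failure n D I F R G B\<^sub>0 (Suc q) L M L'",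
          OF _ near_potential_bounds[OF data] B\<^sub>0(1,3) pc])
        (unfold L'_def, rule potential_increase[OF data D(1,2) F(1)], auto)
    then obtain B1 where B1: "finite B1" "B\<^sub>0 \<subseteq> B1" "\<forall>g\<in>B1. multilinear n I g" "card B1 \<le> m'"
      and sat: "\<not> saturation_failure n D I F R G B\<^sub>0 (Suc q) L M L' B1"
      using B\<^sub>0(2) unfolding m'_def by (meson add_le_mono1 le_trans)
    from IH[rule_format, OF data B1(1,4)] B1(3) obtain B where "card B \<le> k'"
      and el: "eliminates n D I F R G q (L + L' * M) (2 * M) B1 K' B" by blast
    then have B: "finite B" "B1 \<subseteq> B" "card B \<le> k'" "\<forall>g\<in>B. multilinear n I g"
      by (simp_all add: eliminates_def)
    have BI: "\<exists>v\<in>ideal n D ({I} \<times> B \<union> G). rank_le n F D K' (\<lambda>u. r u + v u)"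
      if "r \<in> R" "card (Q :: nat set) = q" "decomposed n D I F Q a b (L + L' * M) (2 * M) B1 r" for r Q a b
      using el that unfolding eliminates_def by blast
    have fin: "finite ({I} \<times> B \<union> G)" using B G by auto
    have "\<exists>v\<in>ideal n D ({I} \<times> B \<union> G). rank_le n F D (max L K') (\<lambda>u. r u + v u)"
      if r: "r \<in> R" and Q: "card Q = Suc q" and dec: "decomposed n D I F Q a b L M B\<^sub>0 r"
      for r and Q :: "nat set" and a b
    proof (cases "\<forall>j\<in>Q. b j \<in> ideal n (D - I) G")
      case True
      from dec obtain z w where a: "\<And>j. j \<in> Q \<Longrightarrow> multilinear n I (a j)"
        and z: "rank_le n F D L z" and w: "w \<in> ideal n D ({I} \<times> B\<^sub>0)"
        and req: "r = (\<lambda>u. (\<Sum>j\<in>Q. a j u * b j u) + z u + w u)"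
        unfolding decomposed_def by (elim exE conjE) (rule that, auto)
      have DI: "D - (D - I) = I" using D by auto
      have "(\<lambda>u. b j u * a j u) \<in> ideal n D G" if "j \<in> Q" for j
        by (rule ideal_times[where I = "D - I"]) (use True that G a DI in auto)
      then have "(\<lambda>u. \<Sum>j\<in>Q. b j u * a j u) \<in> ideal n D G" by (rule ideal_sum)
      then have "(\<lambda>u. \<Sum>j\<in>Q. b j u * a j u) \<in> ideal n D ({I} \<times> B \<union> G)"
        using ideal_mono fin by blast
      moreover have "w \<in> ideal n D ({I} \<times> B \<union> G)"
        using ideal_mono[OF w _ fin] B B1 by blast
      ultimately have "(\<lambda>u. (\<Sum>j\<in>Q. b j u * a j u) + w u) \<in> ideal n D ({I} \<times> B \<union> G)"
        by (rule ideal_add)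
      moreover have "(\<lambda>u. r u + ((\<Sum>j\<in>Q. b j u * a j u) + w u)) = z"
        by (auto simp: req algebra_simps)
      moreover have "rank_le n F D (max L K') z" using z by (rule rank_le_mono) simp
      ultimately show ?thesis by (intro bexI) auto
    next
      case False
      with sat r Q dec obtain \<Lambda> where \<Lambda>: "\<Lambda> \<subseteq> Q" "\<Lambda> \<noteq> {}" "near n I B1 L' (\<lambda>u. \<Sum>j\<in>\<Lambda>. a j u)"
        unfolding saturation_failure_def by metis
      then obtain j0 where j0: "j0 \<in> \<Lambda>" by auto
      have "decomposed n D I F (Q - {j0}) a (\<lambda>j u. b j u + of_bool (j \<in> \<Lambda>) * b j0 u)
          (L + L' * M) (2 * M) B1 r"
        using B1 D(3) by (intro eliminate_term[OF dec D(2) F(2) _ _ _ _ \<Lambda>(1) j0 \<Lambda>(3)]) auto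
      moreover have "card (Q - {j0}) = q" using Q j0 \<Lambda>(1) by auto
      ultimately obtain v where "v \<in> ideal n D ({I} \<times> B \<union> G)" "rank_le n F D K' (\<lambda>u. r u + v u)"
        using BI[OF r] by blast
      moreover have "rank_le n F D (max L K') (\<lambda>u. r u + v u)"
        by (rule rank_le_mono[OF calculation(2)]) simp
      ultimately show ?thesis by blast
    qed
    then have "eliminates n D I F R G (Suc q) L M B\<^sub>0 (max L K') B"
      unfolding eliminates_def using B B1 by blast
    then show "\<exists>B. card B \<le> k' \<and> eliminates n D I F R G (Suc q) L M B\<^sub>0 (max L K') B"
      using B(3) by blast
  qed
qed

section \<open>The structure of forms vanishing on most of a dense set\<close>

lemma dense_weightD:
  assumes "dense_weight n D \<delta> \<phi>"
  shows "weight \<phi>" "mass n D \<phi> \<ge> \<delta> * card (tuples n D)"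
  using assms by (simp_all add: dense_weight_def)

lemma mass_pos:
  assumes "dense_weight n D \<delta> \<phi>" "finite D" "\<delta> > 0" shows "mass n D \<phi> > 0"
proof -
  have "\<delta> * card (tuples n D) > 0" using assms by simp
  then show ?thesis using dense_weightD[OF assms(1)] by linarith
qed

text \<open>A generator on all of \<open>I\<close> has a constant cofactor, so it is either taken or
  left out; every other generator contributes a product of two proper blocks. Hence, up to bounded
  rank, an ideal has at most \<open>2 ^ card G\<close> elements, and these become the
  representatives \<open>V x\<close>.\<close>

lemma ideal_top_part:
  assumes r: "r \<in> ideal n I G" and G: "generators n I G"
  shows "\<exists>A\<subseteq>G. rank_le n (proper_subsets I) I (card G) (\<lambda>u. r u + (\<Sum>p\<in>A. snd p u))"
proof -
  obtain h where h: "\<forall>p\<in>G. multilinear n (I - fst p) (h p)" "r = (\<lambda>u. \<Sum>p\<in>G. snd p u * h p u)"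
    using r by (auto simp: ideal_def)
  have fG: "finite G" using G by (simp add: generators_def)
  have gp: "fst p \<subseteq> I" "fst p \<noteq> {}" "multilinear n (fst p) (snd p)" if "p \<in> G" for p
    using G that by (cases p; auto simp: generators_def)+
  \<comment> \<open>The cofactor is constant here, so its value at the zero tuple is its value
    everywhere.\<close>
  define A where "A = {p\<in>G. fst p = I \<and> h p 0 = 1}"
  define E where "E = {p\<in>G. fst p \<noteq> I}"
  have "(\<Sum>p\<in>G. snd p u * h p u) = (\<Sum>p\<in>E. snd p u * h p u) + (\<Sum>p\<in>A. snd p u)" for u
  proof -
    have "(\<Sum>p\<in>G. snd p u * h p u) = (\<Sum>p\<in>E. snd p u * h p u) + (\<Sum>p\<in>{p\<in>G. fst p = I}. snd p u * h p u)"
      using fG by (subst sum.union_disjoint[symmetric]) (auto simp: E_def intro!: sum.cong)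
    also have "(\<Sum>p\<in>{p\<in>G. fst p = I}. snd p u * h p u) = (\<Sum>p\<in>A. snd p u * h p u)"
    proof (rule sum.mono_neutral_right)
      show "\<forall>p\<in>{p\<in>G. fst p = I} - A. snd p u * h p u = 0"
      proof
        fix p assume p: "p \<in> {p\<in>G. fst p = I} - A"
        then have "multilinear n {} (h p)" using h(1) by force
        then have "h p u = h p 0" by (rule multilinear_emptyD)
        moreover have "h p 0 = 0" using p bit_neq_0_iff[of "h p 0"] by (auto simp: A_def)
        ultimately show "snd p u * h p u = 0" by simp
      qed
    qed (use fG in \<open>auto simp: A_def\<close>)
    also have "\<dots> = (\<Sum>p\<in>A. snd p u)"
    proof (rule sum.cong[OF refl])
      fix p assume p: "p \<in> A"
      then have "multilinear n {} (h p)" using h(1) by (force simp: A_def)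
      then have "h p u = h p 0" by (rule multilinear_emptyD)
      then show "snd p u * h p u = snd p u" using p by (simp add: A_def)
    qed
    finally show ?thesis .
  qed
  then have eq: "(\<lambda>u. r u + (\<Sum>p\<in>A. snd p u)) = (\<lambda>u. \<Sum>p\<in>E. snd p u * h p u)"
    unfolding h(2) by (auto simp: add.assoc)
  have "rank_le n (proper_subsets I) I (card E) (\<lambda>u. \<Sum>p\<in>E. snd p u * h p u)"
  proof (intro rank_le_sum rank_le_product products_pair)
    show "finite E" using fG by (simp add: E_def)
    fix p assume p: "p \<in> E"
    then have pG: "p \<in> G" "fst p \<noteq> I" by (auto simp: E_def)
    show "fst p \<in> proper_subsets I" "I - fst p \<in> proper_subsets I" "fst p \<subseteq> I"
      "multilinear n (fst p) (snd p)" "multilinear n (I - fst p) (h p)"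
      using gp[OF pG(1)] pG h(1) by auto
  qed
  moreover have "card E \<le> card G" using fG by (auto simp: E_def intro: card_mono)
  ultimately have "rank_le n (proper_subsets I) I (card G) (\<lambda>u. r u + (\<Sum>p\<in>A. snd p u))"
    unfolding eq by (rule rank_le_mono)
  moreover have "A \<subseteq> G" by (auto simp: A_def)
  ultimately show ?thesis by blast
qed

text \<open>Forcing on \<open>I\<close> is used on each fibre of density at least
  \<open>\<delta> / 2\<close>. A form of small total defect has small defect on most of these fibres
  by Markov's inequality, so there its slice is a subset sum of the generators up to bounded
  rank.\<close>

lemma ex_slice_data:
  assumes D: "finite D" "I \<subseteq> D" and "forcing I" "forcing (D - I)"
  shows "\<exists>\<epsilon>'>0. \<exists>\<epsilon>>0. \<forall>\<delta>>0. \<exists>N k kG. \<forall>n \<phi>. dense_weight n D \<delta> \<phi> \<longrightarrow>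
    (\<exists>\<psi> V G. card G \<le> kG \<and>
      slice_data n D I {r. multilinear n D r \<and> defect n D \<phi> r \<le> \<epsilon> * mass n D \<phi>} \<psi> V G \<epsilon>' N k)"
proof -
  from \<open>forcing I\<close> obtain \<epsilon>1 where \<epsilon>1: "\<epsilon>1 > 0" and f1:
    "\<forall>\<delta>>0. \<exists>k. \<forall>n \<phi>. dense_weight n I \<delta> \<phi> \<longrightarrow> forced n I UNIV \<epsilon>1 k \<phi>"
    unfolding forcing_def by blast
  from \<open>forcing (D - I)\<close> obtain \<epsilon>' where \<epsilon>': "\<epsilon>' > 0" and f2:
    "\<forall>\<delta>>0. \<exists>k. \<forall>n \<phi>. dense_weight n (D - I) \<delta> \<phi> \<longrightarrow> forced n (D - I) UNIV \<epsilon>' k \<phi>"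
    unfolding forcing_def by blast
  \<comment> \<open>Markov's inequality over the fibres divides by \<open>\<epsilon>1\<close>,
    dropping the sparse fibres costs a factor 2, and the share of bad slices aimed at is
    \<open>\<epsilon>' / 2\<close>; hence the 4.\<close>
  define \<epsilon> where "\<epsilon> = \<epsilon>1 * \<epsilon>' / 4"
  have \<epsilon>: "\<epsilon> > 0" using \<epsilon>1 \<epsilon>' by (simp add: \<epsilon>_def)
  have "\<exists>N k kG. \<forall>n \<phi>. dense_weight n D \<delta> \<phi> \<longrightarrow> (\<exists>\<psi> V G. card G \<le> kG \<and>
      slice_data n D I {r. multilinear n D r \<and> defect n D \<phi> r \<le> \<epsilon> * mass n D \<phi>} \<psi> V G \<epsilon>' N k)"
    if \<delta>: "\<delta> > 0" for \<delta> :: real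
  proof -
    from f1 \<delta> obtain k where k: "\<And>n \<phi>. dense_weight n I (\<delta> / 2) \<phi> \<Longrightarrow> forced n I UNIV \<epsilon>1 k \<phi>"
      by (meson half_gt_zero)
    from f2 \<delta> obtain kG where kG: "\<And>n \<phi>. dense_weight n (D - I) (\<delta> / 2) \<phi> \<Longrightarrow>
        forced n (D - I) UNIV \<epsilon>' kG \<phi>"
      by (meson half_gt_zero)
    have "\<exists>\<psi> V G. card G \<le> kG \<and>
      slice_data n D I {r. multilinear n D r \<and> defect n D \<phi> r \<le> \<epsilon> * mass n D \<phi>} \<psi> V G \<epsilon>' (2 ^ k) k"
      if \<phi>: "dense_weight n D \<delta> \<phi>" for n \<phi>
    proof -
      note w = dense_weightD[OF \<phi>]
      have fI: "finite I" using D finite_subset by auto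
      define c where "c = real (card (tuples n I))"
      have c: "c > 0" using fI by (simp add: c_def)
      define s where "s x = (\<lambda>y. \<phi> (x + y))" for x :: tuple
      have ws: "weight (s x)" for x using w(1) by (auto simp: weight_def s_def)
      define live where "live x \<longleftrightarrow> mass n I (s x) \<ge> \<delta> / 2 * c" for x
      \<comment> \<open>The density of the fibre, with sparse fibres dropped. These carry at most
        half of the total mass, so \<open>\<psi>\<close> still has density
        \<open>\<delta> / 2\<close>.\<close>
      define \<psi> where "\<psi> x = (if live x then mass n I (s x) / c else 0)" for x
      have "\<forall>x. \<exists>Gx. live x \<longrightarrow> generators n I Gx \<and> card Gx \<le> k \<and>
        (\<forall>r. multilinear n I r \<longrightarrow> defect n I (s x) r \<le> \<epsilon>1 * mass n I (s x) \<longrightarrow> r \<in> ideal n I Gx)"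
      proof
        fix x
        show "\<exists>Gx. live x \<longrightarrow> generators n I Gx \<and> card Gx \<le> k \<and>
          (\<forall>r. multilinear n I r \<longrightarrow> defect n I (s x) r \<le> \<epsilon>1 * mass n I (s x) \<longrightarrow> r \<in> ideal n I Gx)"
        proof (cases "live x")
          case True
          then have "dense_weight n I (\<delta> / 2) (s x)" using ws by (simp add: dense_weight_def live_def c_def)
          from k[OF this] show ?thesis unfolding forced_def by blast
        qed simp
      qed
      from choice[OF this] obtain G where G: "\<And>x. live x \<Longrightarrow> generators n I (G x)"
        "\<And>x. live x \<Longrightarrow> card (G x) \<le> k"
        "\<And>x r. live x \<Longrightarrow> multilinear n I r \<Longrightarrow> defect n I (s x) r \<le> \<epsilon>1 * mass n I (s x) \<Longrightarrow>
          r \<in> ideal n I (G x)" by blast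
      define V where "V x = (if live x then (\<lambda>A u. \<Sum>p\<in>A. snd p u) ` Pow (G x) else {})" for x
      have V: "finite (V x) \<and> card (V x) \<le> 2 ^ k" for x
      proof (cases "live x")
        case True
        then have "finite (G x)" using G(1) by (auto simp: generators_def)
        then have "card (V x) \<le> 2 ^ card (G x)"
          using True card_image_le[of "Pow (G x)" "\<lambda>A u. \<Sum>p\<in>A. snd p u"] by (simp add: V_def card_Pow)
        also have "\<dots> \<le> 2 ^ k" using G(2)[OF True] by (simp add: power_increasing)
        finally show ?thesis using True \<open>finite (G x)\<close> by (simp add: V_def)
      qed (simp add: V_def)
      have \<psi>w: "weight \<psi>"
        unfolding weight_def
      proof
        fix x
        show "0 \<le> \<psi> x \<and> \<psi> x \<le> 1"
          using mass_nonneg[OF ws, of n I x] mass_le_card[OF ws, of n I x] c by (simp add: \<psi>_def c_def)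
      qed
      have msplit: "mass n D \<phi> = (\<Sum>x\<in>tuples n (D - I). mass n I (s x))"
        unfolding mass_def s_def by (rule sum_tuples_split[OF D(2,1)])
      have cardD: "real (card (tuples n D)) = card (tuples n (D - I)) * c"
        using card_tuples_split[OF D(2), of n] by (simp add: c_def)
      have "mass n D \<phi> - \<delta> / 2 * card (tuples n D) \<le> mass n (D - I) \<psi> * c"
      proof -
        have "mass n D \<phi> - \<delta> / 2 * card (tuples n D) = (\<Sum>x\<in>tuples n (D - I). mass n I (s x) - \<delta> / 2 * c)"
          unfolding msplit cardD by (simp add: sum_subtractf)
        also have "\<dots> \<le> (\<Sum>x\<in>tuples n (D - I). \<psi> x * c)"
          using c \<delta> by (intro sum_mono) (auto simp: \<psi>_def live_def)
        finally show ?thesis by (simp add: mass_def sum_distrib_right)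
      qed
      then have half: "mass n D \<phi> / 2 \<le> mass n (D - I) \<psi> * c" using w(2) by linarith
      then have "\<delta> / 2 * card (tuples n (D - I)) * c \<le> mass n (D - I) \<psi> * c"
        using w(2) cardD by simp
      then have m\<psi>: "\<delta> / 2 * card (tuples n (D - I)) \<le> mass n (D - I) \<psi>" using c by simp
      then have d\<psi>: "dense_weight n (D - I) (\<delta> / 2) \<psi>" using \<psi>w by (simp add: dense_weight_def)
      have pos: "mass n (D - I) \<psi> > 0" by (rule mass_pos[OF d\<psi>]) (use D \<delta> in auto)
      from kG[OF d\<psi>] obtain H where H: "generators n (D - I) H" "card H \<le> kG"
        "\<And>b. multilinear n (D - I) b \<Longrightarrow> defect n (D - I) \<psi> b \<le> \<epsilon>' * mass n (D - I) \<psi> \<Longrightarrow>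
          b \<in> ideal n (D - I) H"
        unfolding forced_def by blast
      have few: "(\<Sum>x\<in>tuples n (D - I). \<psi> x *
          of_bool (\<nexists>v. v \<in> V x \<and> rank_le n (proper_subsets I) I k (\<lambda>u. slice n I x r u + v u)))
          \<le> \<epsilon>' / 2 * mass n (D - I) \<psi>" (is "(\<Sum>x\<in>_. \<psi> x * of_bool (?bad x)) \<le> _")
        if r: "multilinear n D r" "defect n D \<phi> r \<le> \<epsilon> * mass n D \<phi>" for r
      proof -
        have "\<psi> x * of_bool (?bad x) \<le> defect n I (s x) (slice n I x r) / (\<epsilon>1 * c)"
          if x: "x \<in> tuples n (D - I)" for x
        proof (cases "live x \<and> ?bad x")
          case True
          have "D \<inter> I = I" using D by auto
          then have ml: "multilinear n I (slice n I x r)"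
            using multilinear_slice[OF r(1) x, of I] by auto
          have "\<not> defect n I (s x) (slice n I x r) \<le> \<epsilon>1 * mass n I (s x)"
          proof
            assume "defect n I (s x) (slice n I x r) \<le> \<epsilon>1 * mass n I (s x)"
            then have "slice n I x r \<in> ideal n I (G x)" using G(3) True ml by blast
            from ideal_top_part[OF this G(1)] True obtain A where "A \<subseteq> G x"
              "rank_le n (proper_subsets I) I (card (G x)) (\<lambda>u. slice n I x r u + (\<Sum>p\<in>A. snd p u))"
              by blast
            then have "(\<lambda>u. \<Sum>p\<in>A. snd p u) \<in> V x \<and>
              rank_le n (proper_subsets I) I k (\<lambda>u. slice n I x r u + (\<Sum>p\<in>A. snd p u))"
              using True G(2)[of x] rank_le_mono[of n _ I "card (G x)" _ k] by (simp add: V_def)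
            then have "\<exists>v. v \<in> V x \<and> rank_le n (proper_subsets I) I k (\<lambda>u. slice n I x r u + v u)"
              by (rule exI[of _ "\<lambda>u. \<Sum>p\<in>A. snd p u"])
            with True show False by blast
          qed
          then have "mass n I (s x) \<le> defect n I (s x) (slice n I x r) / \<epsilon>1"
            using \<epsilon>1 by (simp add: field_simps)
          then have "mass n I (s x) / c \<le> defect n I (s x) (slice n I x r) / \<epsilon>1 / c"
            using c by (intro divide_right_mono) auto
          then show ?thesis using True by (simp add: \<psi>_def)
        next
          case False
          then have "\<psi> x * of_bool (?bad x) = 0" by (auto simp: \<psi>_def)
          moreover have "0 \<le> defect n I (s x) (slice n I x r) / (\<epsilon>1 * c)"
            using defect_nonneg[OF ws] \<epsilon>1 c by simp
          ultimately show ?thesis by linarith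
        qed
        then have "(\<Sum>x\<in>tuples n (D - I). \<psi> x * of_bool (?bad x)) \<le>
            (\<Sum>x\<in>tuples n (D - I). defect n I (s x) (slice n I x r) / (\<epsilon>1 * c))" by (rule sum_mono)
        also have "\<dots> = (\<Sum>x\<in>tuples n (D - I). defect n I (s x) (slice n I x r)) / (\<epsilon>1 * c)"
          by (simp add: sum_divide_distrib)
        also have "(\<Sum>x\<in>tuples n (D - I). defect n I (s x) (slice n I x r)) = defect n D \<phi> r"
          unfolding defect_def sum_tuples_split[OF D(2,1)] s_def by (simp add: slice_eq)
        also have "defect n D \<phi> r / (\<epsilon>1 * c) \<le> \<epsilon> * (2 * (mass n (D - I) \<psi> * c)) / (\<epsilon>1 * c)"
        proof (intro divide_right_mono)
          have "\<epsilon> * mass n D \<phi> \<le> \<epsilon> * (2 * (mass n (D - I) \<psi> * c))"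
            using half \<epsilon> by (intro mult_left_mono) auto
          then show "defect n D \<phi> r \<le> \<epsilon> * (2 * (mass n (D - I) \<psi> * c))" using r(2) by linarith
        qed (use \<epsilon>1 c in auto)
        also have "\<dots> = \<epsilon>' / 2 * mass n (D - I) \<psi>" using \<epsilon>1 c by (simp add: \<epsilon>_def field_simps)
        finally show ?thesis .
      qed
      have "slice_data n D I {r. multilinear n D r \<and> defect n D \<phi> r \<le> \<epsilon> * mass n D \<phi>} \<psi> V H \<epsilon>' (2 ^ k) k"
        unfolding slice_data_def
      proof (intro conjI ballI allI impI)
        show "0 \<le> \<psi> x" for x using weightD[OF \<psi>w] by simp
        show "b \<in> ideal n (D - I) H"
          if "multilinear n (D - I) b" "defect n (D - I) \<psi> b \<le> \<epsilon>' * mass n (D - I) \<psi>" for b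
          using H(3) that by blast
        show "(\<Sum>x\<in>tuples n (D - I). \<psi> x *
          of_bool (\<nexists>v. v \<in> V x \<and> rank_le n (proper_subsets I) I k (\<lambda>u. slice n I x r u + v u)))
          \<le> \<epsilon>' / 2 * mass n (D - I) \<psi>"
          if "r \<in> {r. multilinear n D r \<and> defect n D \<phi> r \<le> \<epsilon> * mass n D \<phi>}" for r
          using that few by blast
      qed (use V pos H(1) in auto)
      then show ?thesis using H(2) by blast
    qed
    then show ?thesis by blast
  qed
  with \<epsilon> \<epsilon>' show ?thesis by blast
qed

definition removes_block where
  "removes_block n D F I K \<epsilon> k K' \<phi> \<longleftrightarrow> (\<exists>G. generators n D G \<and> card G \<le> k \<and>
     (\<forall>r. rank_le n F D K r \<longrightarrow> defect n D \<phi> r \<le> \<epsilon> * mass n D \<phi> \<longrightarrow>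
       (\<exists>v\<in>ideal n D G. rank_le n (F - {I}) D K' (\<lambda>u. r u + v u))))"

text \<open>For \<open>I = D\<close> there is no complement to slice along. Instead the boundedly
  many representatives from \<open>reduce_to_low_rank\<close> serve as generators on all of
  \<open>D\<close>, and what remains has only proper blocks.\<close>

lemma remove_whole_block:
  assumes D: "finite D" "D \<noteq> {}" "D \<in> F" "proper_subsets D \<subseteq> F"
    and sub: "\<And>E. E \<subset> D \<Longrightarrow> forcing E" and \<delta>: "\<delta> > 0"
  shows "\<exists>k K'. \<forall>n \<phi>. dense_weight n D \<delta> \<phi> \<longrightarrow> removes_block n D F D K (1 / 4) k K' \<phi>"
proof -
  obtain i where i: "i \<in> D" using D by auto
  then have "forcing (D - {i})" using sub by auto
  from reduce_to_low_rank[OF D(1) i this \<delta>] obtain k where k: "\<And>n \<phi>. dense_weight n D \<delta> \<phi> \<Longrightarrow>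
    (\<exists>Y. finite Y \<and> card Y \<le> k \<and> (\<forall>r\<in>Y. multilinear n D r) \<and>
      (\<forall>r. multilinear n D r \<longrightarrow> defect n D \<phi> r \<le> 1 / 4 * mass n D \<phi> \<longrightarrow>
        (\<exists>y\<in>Y. rank_le n (proper_subsets D) D k (\<lambda>u. r u + y u))))" by blast
  have "removes_block n D F D K (1 / 4) k k \<phi>" if \<phi>: "dense_weight n D \<delta> \<phi>" for n \<phi>
  proof -
    from k[OF \<phi>] obtain Y where Y: "finite Y" "card Y \<le> k" "\<forall>r\<in>Y. multilinear n D r"
      and low: "\<forall>r. multilinear n D r \<longrightarrow> defect n D \<phi> r \<le> 1 / 4 * mass n D \<phi> \<longrightarrow>
        (\<exists>y\<in>Y. rank_le n (proper_subsets D) D k (\<lambda>u. r u + y u))" by (elim exE conjE)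
    have gen: "generators n D ({D} \<times> Y)" using Y D by (auto simp: generators_def)
    have "\<exists>v\<in>ideal n D ({D} \<times> Y). rank_le n (F - {D}) D k (\<lambda>u. r u + v u)"
      if r: "rank_le n F D K r" "defect n D \<phi> r \<le> 1 / 4 * mass n D \<phi>" for r
    proof -
      from low[rule_format, OF multilinear_rank_le[OF r(1)] r(2)] obtain y where
        y: "y \<in> Y" "rank_le n (proper_subsets D) D k (\<lambda>u. r u + y u)" by (elim bexE)
      have "(\<lambda>u. y u * 1) \<in> ideal n D ({D} \<times> Y)"
        using Y y by (intro ideal_gen[where J = D]) auto
      then have "y \<in> ideal n D ({D} \<times> Y)" by simp
      moreover have "rank_le n (F - {D}) D k (\<lambda>u. r u + y u)"
        using y(2) by (rule rank_le_family_mono) (use D in auto)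
      ultimately show ?thesis by (intro bexI)
    qed
    then show ?thesis unfolding removes_block_def
      using gen Y(2) by (intro exI[of _ "{D} \<times> Y"]) (auto simp: card_cartesian_product)
  qed
  then show ?thesis by blast
qed

text \<open>The blocks of a product on \<open>D - I\<close> lie inside \<open>D - I\<close>, which
  excludes a non-empty \<open>I\<close>.\<close>

lemma products_avoid:
  assumes "products n F (D - I) b" "I \<noteq> {}" shows "products n (F - {I}) (D - I) b"
  using products_blocks[OF assms(1)] by (rule products_mono) (use assms(2) in auto)

text \<open>The starting point of the elimination: each product is split at its factor on
  \<open>I\<close>, if it has one, and goes into \<open>z\<close> otherwise.\<close>

lemma decompose_block:
  assumes r: "rank_le n F D K r" and "I \<noteq> {}"
  shows "\<exists>a b. decomposed n D I (F - {I}) {..<K} a b K 1 B r"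
proof -
  let ?F = "F - {I}"
  obtain gs where gs: "length gs \<le> K" "\<forall>g\<in>set gs. products n F D g" "r = (\<lambda>u. \<Sum>g\<leftarrow>gs. g u)"
    using r by (auto simp: rank_le_def)
  \<comment> \<open>Padding with zeros gives exactly \<open>K\<close> terms for every
    \<open>r\<close>, as \<open>block_elimination\<close> fixes the number of terms in
    advance.\<close>
  define g where "g j = (if j < length gs then gs ! j else (\<lambda>u. 0))" for j
  have "\<forall>j. \<exists>t. multilinear n I (fst t) \<and> rank_le n ?F (D - I) 1 (fst (snd t)) \<and>
    rank_le n ?F D 1 (snd (snd t)) \<and> g j = (\<lambda>u. fst t u * fst (snd t) u + snd (snd t) u)"
  proof
    fix j
    consider "j \<ge> length gs" | "products n ?F D (g j)" | a b where "multilinear n I a"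
      "products n F (D - I) b" "g j = (\<lambda>u. a u * b u)"
    proof (cases "j < length gs")
      case True
      then have "products n F D (g j)" using gs(2) by (simp add: g_def)
      from products_extract[OF this, of I] show ?thesis using that by blast
    qed (use that in auto)
    then show "\<exists>t. multilinear n I (fst t) \<and> rank_le n ?F (D - I) 1 (fst (snd t)) \<and>
      rank_le n ?F D 1 (snd (snd t)) \<and> g j = (\<lambda>u. fst t u * fst (snd t) u + snd (snd t) u)"
    proof cases
      case 1
      then show ?thesis by (intro exI[of _ "(\<lambda>u. 0, \<lambda>u. 0, \<lambda>u. 0)"]) (simp add: g_def)
    next
      case 2
      then show ?thesis by (intro exI[of _ "(\<lambda>u. 0, \<lambda>u. 0, g j)"]) (simp add: rank_le_product[simplified])
    next
      case 3
      then show ?thesis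
        by (intro exI[of _ "(a, b, \<lambda>u. 0)"])
          (simp add: rank_le_product[simplified] products_avoid[OF _ assms(2)])
    qed
  qed
  from choice[OF this] obtain t where t: "\<And>j. multilinear n I (fst (t j))"
    "\<And>j. rank_le n ?F (D - I) 1 (fst (snd (t j)))" "\<And>j. rank_le n ?F D 1 (snd (snd (t j)))"
    "\<And>j. g j = (\<lambda>u. fst (t j) u * fst (snd (t j)) u + snd (snd (t j)) u)" by blast
  have "(\<Sum>g\<leftarrow>gs. g u) = (\<Sum>j<K. g j u)" for u
  proof -
    have "(\<Sum>g\<leftarrow>gs. g u) = (\<Sum>j<length gs. (gs ! j) u)"
      by (simp add: sum_list_sum_nth atLeast0LessThan)
    also have "\<dots> = (\<Sum>j<K. g j u)"
      using gs(1) by (intro sum.mono_neutral_cong_left) (auto simp: g_def)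
    finally show ?thesis .
  qed
  then have req: "r = (\<lambda>u. (\<Sum>j<K. fst (t j) u * fst (snd (t j)) u) + (\<Sum>j<K. snd (snd (t j)) u) + 0)"
    unfolding gs(3) t(4) by (simp add: sum.distrib)
  have "rank_le n ?F D (card {..<K}) (\<lambda>u. \<Sum>j<K. snd (snd (t j)) u)"
    by (intro rank_le_sum t) auto
  then have z: "rank_le n ?F D K (\<lambda>u. \<Sum>j<K. snd (snd (t j)) u)" by simp
  have "decomposed n D I ?F {..<K} (\<lambda>j. fst (t j)) (\<lambda>j. fst (snd (t j))) K 1 B r"
    unfolding decomposed_def
    by (intro conjI ballI exI[of _ "\<lambda>u. \<Sum>j<K. snd (snd (t j)) u"] exI[of _ "\<lambda>u. 0"] t z ideal_0 req) simp
  then show ?thesis by blast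
qed

text \<open>As \<open>I\<close> is maximal in \<open>F\<close>, all other blocks slice to proper
  subsets of \<open>I\<close>; as \<open>F\<close> contains all these subsets, the low-rank
  remainders of the elimination stay within the family. The constant \<open>\<epsilon>\<close> is
  obtained before \<open>K\<close> and \<open>\<delta>\<close>, which the induction over blocks
  relies on.\<close>

lemma remove_block:
  assumes D: "finite D" "D \<noteq> {}" and F: "\<And>P. P \<in> F \<Longrightarrow> P \<noteq> {} \<and> P \<subseteq> D" "I \<in> F"
    "\<And>P. P \<in> F \<Longrightarrow> I \<subseteq> P \<Longrightarrow> P = I" "proper_subsets I \<subseteq> F"
    and sub: "\<And>E. E \<subset> D \<Longrightarrow> forcing E"
  shows "\<exists>\<epsilon>>0. \<forall>K. \<forall>\<delta>>0. \<exists>k K'. \<forall>n \<phi>. dense_weight n D \<delta> \<phi> \<longrightarrow> removes_block n D F I K \<epsilon> k K' \<phi>"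
proof (cases "I = D")
  case True
  then have "\<forall>K. \<forall>\<delta>>0. \<exists>k K'. \<forall>n \<phi>. dense_weight n D \<delta> \<phi> \<longrightarrow> removes_block n D F I K (1 / 4) k K' \<phi>"
    using remove_whole_block[OF D] F sub by blast
  moreover have "(1 / 4 :: real) > 0" by simp
  ultimately show ?thesis by blast
next
  case False
  then have I: "I \<subset> D" "I \<noteq> {}" "D - I \<subset> D" using F(1)[OF F(2)] by auto
  from ex_slice_data[OF D(1) psubset_imp_subset[OF I(1)] sub[OF I(1)] sub[OF I(3)]]
  obtain \<epsilon>' \<epsilon> where \<epsilon>: "\<epsilon>' > 0" "\<epsilon> > 0" and sd: "\<forall>\<delta>>0. \<exists>N k kG. \<forall>n \<phi>. dense_weight n D \<delta> \<phi> \<longrightarrow>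
    (\<exists>\<psi> V G. card G \<le> kG \<and>
      slice_data n D I {r. multilinear n D r \<and> defect n D \<phi> r \<le> \<epsilon> * mass n D \<phi>} \<psi> V G \<epsilon>' N k)"
    by blast
  have "\<exists>k K'. \<forall>n \<phi>. dense_weight n D \<delta> \<phi> \<longrightarrow> removes_block n D F I K \<epsilon> k K' \<phi>"
    if \<delta>: "\<delta> > 0" for K and \<delta> :: real
  proof -
    from sd \<delta> obtain N k kG where sd': "\<forall>n \<phi>. dense_weight n D \<delta> \<phi> \<longrightarrow>
      (\<exists>\<psi> V G. card G \<le> kG \<and>
      slice_data n D I {r. multilinear n D r \<and> defect n D \<phi> r \<le> \<epsilon> * mass n D \<phi>} \<psi> V G \<epsilon>' N k)"
      by blast
    have F': "\<not> I \<subseteq> P" if "P \<in> F - {I}" for P using F(3) that by blast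
    have F'': "proper_subsets I \<subseteq> F - {I}" using F(4) by auto
    \<comment> \<open>The elimination starts with \<open>K\<close> terms, a remainder of rank
      \<open>K\<close>, cofactors of rank 1 and an empty set of forms on \<open>I\<close>.\<close>
    have "\<exists>k' K'. \<forall>n R \<psi> V G B\<^sub>0. slice_data n D I R \<psi> V G \<epsilon>' N k \<longrightarrow> finite B\<^sub>0 \<longrightarrow>
      card B\<^sub>0 \<le> 0 \<longrightarrow> (\<forall>g\<in>B\<^sub>0. multilinear n I g) \<longrightarrow>
      (\<exists>B. card B \<le> k' \<and> eliminates n D I (F - {I}) R G K K 1 B\<^sub>0 K' B)"
      by (rule block_elimination[OF D(1) _ I(2) _ F'' \<epsilon>(1)]) (use I F' in auto)
    then obtain k' K' where el: "\<forall>n R \<psi> V G B\<^sub>0. slice_data n D I R \<psi> V G \<epsilon>' N k \<longrightarrow> finite B\<^sub>0 \<longrightarrow>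
      card B\<^sub>0 \<le> 0 \<longrightarrow> (\<forall>g\<in>B\<^sub>0. multilinear n I g) \<longrightarrow>
      (\<exists>B. card B \<le> k' \<and> eliminates n D I (F - {I}) R G K K 1 B\<^sub>0 K' B)" by (elim exE)
    have "removes_block n D F I K \<epsilon> (k' + kG) K' \<phi>" if \<phi>: "dense_weight n D \<delta> \<phi>" for n \<phi>
    proof -
      define R where "R = {r. multilinear n D r \<and> defect n D \<phi> r \<le> \<epsilon> * mass n D \<phi>}"
      from sd'[rule_format, OF \<phi>, folded R_def] obtain \<psi> V G where cG: "card G \<le> kG"
        and data: "slice_data n D I R \<psi> V G \<epsilon>' N k" by (elim exE conjE)
      from el[rule_format, OF data, of "{}"] obtain B where cB: "card B \<le> k'"
        and B: "eliminates n D I (F - {I}) R G K K 1 {} K' B" by auto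
      have "generators n (D - I) G" using data by (simp add: slice_data_def)
      then have "generators n D G" by (auto simp: generators_def)
      moreover have "generators n D ({I} \<times> B)" using B I by (auto simp: generators_def eliminates_def)
      ultimately have gen: "generators n D ({I} \<times> B \<union> G)" by (intro generators_Un)
      have "card ({I} \<times> B \<union> G) \<le> card ({I} \<times> B) + card G" by (rule card_Un_le)
      also have "\<dots> \<le> k' + kG" using cB cG by (simp add: card_cartesian_product)
      finally have card: "card ({I} \<times> B \<union> G) \<le> k' + kG" .
      have "\<exists>v\<in>ideal n D ({I} \<times> B \<union> G). rank_le n (F - {I}) D K' (\<lambda>u. r u + v u)"
        if r: "rank_le n F D K r" "defect n D \<phi> r \<le> \<epsilon> * mass n D \<phi>" for r
      proof -
        have "r \<in> R" using r multilinear_rank_le by (auto simp: R_def)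
        moreover from decompose_block[OF r(1) I(2), of "{}"] obtain a b where
          "decomposed n D I (F - {I}) {..<K} a b K 1 {} r" by (elim exE)
        moreover have "card {..<K} = K" by simp
        ultimately show ?thesis using B unfolding eliminates_def by blast
      qed
      then show ?thesis unfolding removes_block_def using gen card by blast
    qed
    then show ?thesis by blast
  qed
  then show ?thesis using \<epsilon>(2) by blast
qed

section \<open>Induction over the blocks and over the coordinates\<close>

definition forcing_rank :: "nat set \<Rightarrow> nat set set \<Rightarrow> bool" where
  "forcing_rank D F \<longleftrightarrow> (\<exists>\<epsilon>>0. \<forall>K. \<forall>\<delta>>0. \<exists>k. \<forall>n \<phi>. dense_weight n D \<delta> \<phi> \<longrightarrow>
     forced n D {r. rank_le n F D K r} \<epsilon> k \<phi>)"

text \<open>The correction \<open>v\<close> depends on \<open>r\<close>, but it lies in the ideal of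
  \<open>G1\<close> and so vanishes on a weight supported on the zeros of \<open>G1\<close>; there
  \<open>r + v\<close> has the same defect as \<open>r\<close>. The refined weight has the smaller
  density \<open>\<delta>'\<close>, to which the induction hypothesis still applies because
  \<open>\<epsilon>2\<close> was fixed before the density.\<close>

lemma forcing_rank_step:
  assumes D: "finite D" and st: "\<exists>\<epsilon>>0. \<forall>K. \<forall>\<delta>>0. \<exists>k K'. \<forall>n \<phi>. dense_weight n D \<delta> \<phi> \<longrightarrow>
      removes_block n D F I K \<epsilon> k K' \<phi>"
    and IH: "forcing_rank D (F - {I})"
  shows "forcing_rank D F"
proof -
  from st obtain \<epsilon>1 where \<epsilon>1: "\<epsilon>1 > 0" and st': "\<forall>K. \<forall>\<delta>>0. \<exists>k K'. \<forall>n \<phi>. dense_weight n D \<delta> \<phi> \<longrightarrow>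
      removes_block n D F I K \<epsilon>1 k K' \<phi>" by blast
  from IH obtain \<epsilon>2 where \<epsilon>2: "\<epsilon>2 > 0" and IH': "\<forall>K. \<forall>\<delta>>0. \<exists>k. \<forall>n \<phi>. dense_weight n D \<delta> \<phi> \<longrightarrow>
     forced n D {r. rank_le n (F - {I}) D K r} \<epsilon>2 k \<phi>" unfolding forcing_rank_def by blast
  \<comment> \<open>Refining in all coordinates of \<open>D\<close> multiplies the relative error by
    up to \<open>4 ^ card D\<close>.\<close>
  define \<epsilon> where "\<epsilon> = min \<epsilon>1 (\<epsilon>2 / 4 ^ card D)"
  have \<epsilon>: "\<epsilon> > 0" "\<epsilon> \<le> \<epsilon>1" "4 ^ card D * \<epsilon> \<le> \<epsilon>2"
    using \<epsilon>1 \<epsilon>2 by (auto simp: \<epsilon>_def min_def field_simps)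
  have "\<exists>k. \<forall>n \<phi>. dense_weight n D \<delta> \<phi> \<longrightarrow> forced n D {r. rank_le n F D K r} \<epsilon> k \<phi>"
    if \<delta>: "\<delta> > 0" for K and \<delta> :: real
  proof -
    from st' \<delta> obtain k1 K' where rb: "\<And>n \<phi>. dense_weight n D \<delta> \<phi> \<Longrightarrow> removes_block n D F I K \<epsilon>1 k1 K' \<phi>"
      by blast
    from ex_zero_refinable[OF D \<delta>, of k1] obtain \<delta>' where \<delta>': "\<delta>' > 0"
      and rz: "zero_refinable \<delta> k1 D \<delta>'" by blast
    from IH' \<delta>' obtain k2 where k2: "\<And>n \<phi>. dense_weight n D \<delta>' \<phi> \<Longrightarrow>
      forced n D {r. rank_le n (F - {I}) D K' r} \<epsilon>2 k2 \<phi>" by blast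
    have "forced n D {r. rank_le n F D K r} \<epsilon> (k1 + k2) \<phi>" if \<phi>: "dense_weight n D \<delta> \<phi>" for n \<phi>
    proof -
      note w = dense_weightD[OF \<phi>]
      from rb[OF \<phi>] obtain G1 where G1: "generators n D G1" "card G1 \<le> k1" and
        red: "\<forall>r. rank_le n F D K r \<longrightarrow> defect n D \<phi> r \<le> \<epsilon>1 * mass n D \<phi> \<longrightarrow>
       (\<exists>v\<in>ideal n D G1. rank_le n (F - {I}) D K' (\<lambda>u. r u + v u))"
        unfolding removes_block_def by (elim exE conjE)
      from rz[unfolded zero_refinable_def, rule_format, OF D subset_refl w G1] obtain \<phi>' where
        ref: "refines n D (4 ^ card D) \<phi> \<phi>'" and m': "mass n D \<phi>' \<ge> \<delta>' * card (tuples n D)"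
        and zero: "\<forall>J g s. (J, g) \<in> G1 \<longrightarrow> J \<inter> D \<noteq> {} \<longrightarrow> s \<in> tuples n D \<longrightarrow> \<phi>' s \<noteq> 0 \<longrightarrow> g s = 0"
        by (elim exE conjE)
      have w': "weight \<phi>'" using ref by (simp add: refines_def)
      then have "dense_weight n D \<delta>' \<phi>'" using m' by (simp add: dense_weight_def)
      from k2[OF this] obtain G2 where G2: "generators n D G2" "card G2 \<le> k2" and
        I2: "\<forall>r\<in>{r. rank_le n (F - {I}) D K' r}. multilinear n D r \<longrightarrow>
          defect n D \<phi>' r \<le> \<epsilon>2 * mass n D \<phi>' \<longrightarrow> r \<in> ideal n D G2"
        unfolding forced_def by (elim exE conjE)
      have fin: "finite (G1 \<union> G2)" using G1(1) G2(1) by (simp add: generators_def)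
      have "r \<in> ideal n D (G1 \<union> G2)"
        if r: "rank_le n F D K r" "multilinear n D r" "defect n D \<phi> r \<le> \<epsilon> * mass n D \<phi>" for r
      proof -
        have "\<epsilon> * mass n D \<phi> \<le> \<epsilon>1 * mass n D \<phi>"
          using \<epsilon>(2) mass_nonneg[OF w(1)] by (rule mult_right_mono)
        then have "defect n D \<phi> r \<le> \<epsilon>1 * mass n D \<phi>" using r(3) by linarith
        from red[rule_format, OF r(1) this] obtain v where v: "v \<in> ideal n D G1"
          and low: "rank_le n (F - {I}) D K' (\<lambda>u. r u + v u)" by (elim bexE)
        have v0: "v s = 0" if "s \<in> tuples n D" "\<phi>' s \<noteq> 0" for s
        proof (rule ideal_vanish[OF v])
          fix J g assume g: "(J, g) \<in> G1"
          then have "J \<subseteq> D" "J \<noteq> {}" using G1(1) by (auto simp: generators_def)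
          then have "J \<inter> D \<noteq> {}" by blast
          then show "g s = 0" using zero g that by blast
        qed
        have "defect n D \<phi>' (\<lambda>u. r u + v u) = defect n D \<phi>' r"
          unfolding defect_def
        proof (rule sum.cong[OF refl])
          fix s assume "s \<in> tuples n D"
          then show "\<phi>' s * of_bool (r s + v s = 1) = \<phi>' s * of_bool (r s = 1)"
            using v0[of s] by (cases "\<phi>' s = 0") auto
        qed
        also have "\<dots> \<le> 4 ^ card D * \<epsilon> * mass n D \<phi>'"
          using ref r \<epsilon>(1) unfolding refines_def by (simp add: less_imp_le)
        also have "\<dots> \<le> \<epsilon>2 * mass n D \<phi>'" using \<epsilon>(3) mass_nonneg[OF w'] by (rule mult_right_mono)
        finally have "(\<lambda>u. r u + v u) \<in> ideal n D G2"
          using I2 low multilinear_rank_le[OF low] by simp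
        then have "(\<lambda>u. r u + v u) \<in> ideal n D (G1 \<union> G2)" using ideal_mono[OF _ _ fin] by blast
        moreover have "v \<in> ideal n D (G1 \<union> G2)" using ideal_mono[OF v _ fin] by blast
        ultimately have "(\<lambda>u. (r u + v u) + v u) \<in> ideal n D (G1 \<union> G2)" by (rule ideal_add)
        then show ?thesis by (simp add: add.assoc)
      qed
      moreover have "generators n D (G1 \<union> G2)" using G1 G2 by (intro generators_Un)
      moreover have "card (G1 \<union> G2) \<le> k1 + k2" using card_Un_le[of G1 G2] G1(2) G2(2) by linarith
      ultimately show ?thesis unfolding forced_def by (intro exI[of _ "G1 \<union> G2"]) simp
    qed
    then show ?thesis by blast
  qed
  then show ?thesis unfolding forcing_rank_def using \<epsilon>(1) by blast
qed

text \<open>Removing a maximal block keeps the family closed under non-empty proper subsets. The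
  empty family leaves only the zero form, because a product on a non-empty \<open>D\<close> needs at
  least one block.\<close>

lemma forcing_rank:
  assumes D: "finite D" "D \<noteq> {}" and sub: "\<And>E. E \<subset> D \<Longrightarrow> forcing E"
    and "finite F" "\<And>P. P \<in> F \<Longrightarrow> P \<noteq> {} \<and> P \<subseteq> D" "\<And>P. P \<in> F \<Longrightarrow> proper_subsets P \<subseteq> F"
  shows "forcing_rank D F"
  using assms(4-6)
proof (induction F rule: finite_psubset_induct)
  case (psubset F)
  show ?case
  proof (cases "F = {}")
    case True
    have no: "\<not> products n {} D g" for n g
    proof
      assume "products n {} D g"
      then show False using D(2) by cases auto
    qed
    have "forced n D {r. rank_le n F D K r} 1 0 \<phi>" for n \<phi> K
    proof -
      have "r \<in> ideal n D {}" if "rank_le n F D K r" for r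
      proof -
        from that obtain gs where gs: "\<forall>g\<in>set gs. products n F D g" "r = (\<lambda>u. \<Sum>g\<leftarrow>gs. g u)"
          by (auto simp: rank_le_def)
        then have "gs = []" using no True by (cases gs) auto
        then show ?thesis using gs(2) ideal_0 by simp
      qed
      then show ?thesis unfolding forced_def by (intro exI[of _ "{}"]) (simp add: generators_def)
    qed
    then show ?thesis unfolding forcing_rank_def using zero_less_one by blast
  next
    case False
    from finite_has_maximal[OF psubset.hyps False] obtain I where I: "I \<in> F"
      "\<forall>P\<in>F. I \<subseteq> P \<longrightarrow> P = I" by metis
    have rb: "\<exists>\<epsilon>>0. \<forall>K. \<forall>\<delta>>0. \<exists>k K'. \<forall>n \<phi>. dense_weight n D \<delta> \<phi> \<longrightarrow>
      removes_block n D F I K \<epsilon> k K' \<phi>"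
    proof (rule remove_block[OF D])
      show "P \<noteq> {} \<and> P \<subseteq> D" if "P \<in> F" for P using psubset.prems(1)[OF that] .
      show "I \<in> F" by (rule I(1))
      show "P = I" if "P \<in> F" "I \<subseteq> P" for P using I(2) that by simp
      show "proper_subsets I \<subseteq> F" by (rule psubset.prems(2)[OF I(1)])
      show "forcing E" if "E \<subset> D" for E by (rule sub[OF that])
    qed
    have "forcing_rank D (F - {I})"
    proof (rule psubset.IH)
      show "F - {I} \<subset> F" using I by auto
      show "P \<noteq> {} \<and> P \<subseteq> D" if "P \<in> F - {I}" for P using psubset.prems(1) that by auto
      show "proper_subsets P \<subseteq> F - {I}" if "P \<in> F - {I}" for P
        using psubset.prems(2)[of P] that I(2) by auto
    qed
    then show ?thesis by (rule forcing_rank_step[OF D(1) rb])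
  qed
qed

lemma forcing_all: "finite D \<Longrightarrow> forcing D"
proof (induction D rule: finite_psubset_induct)
  case (psubset D)
  show ?case
  proof (cases "D = {}")
    case True
    \<comment> \<open>Without coordinates a form is a constant, and the constant 1 has the full mass
      as its defect.\<close>
    have "forced n D UNIV (1 / 2) 0 \<phi>" if "dense_weight n D \<delta> \<phi>" "\<delta> > 0" for n \<phi> \<delta>
    proof -
      have pos: "mass n D \<phi> > 0" using that True by (intro mass_pos) auto
      have "r \<in> ideal n D {}" if r: "multilinear n D r" "defect n D \<phi> r \<le> 1 / 2 * mass n D \<phi>" for r
      proof -
        have const: "r u = r 0" for u using r(1) True multilinear_emptyD by blast
        have "r 0 = 0"
        proof (rule ccontr)
          assume "r 0 \<noteq> 0"
          then have "r s = 1" for s using const by (metis bit_neq_0_iff)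
          then have "defect n D \<phi> r = mass n D \<phi>" by (simp add: defect_def mass_def)
          with r(2) pos show False by simp
        qed
        then have "r = (\<lambda>u. 0)" using const by auto
        then show ?thesis using ideal_0 by simp
      qed
      then show ?thesis unfolding forced_def by (intro exI[of _ "{}"]) (simp add: generators_def)
    qed
    moreover have "(1 / 2 :: real) > 0" by simp
    ultimately show ?thesis unfolding forcing_def by blast
  next
    case False
    define F where "F = {P. P \<noteq> {} \<and> P \<subseteq> D}"
    have "forcing_rank D F"
    proof (rule forcing_rank[OF psubset.hyps False])
      show "forcing E" if "E \<subset> D" for E using psubset.IH that by blast
      show "finite F" using psubset.hyps by (simp add: F_def)
    qed (auto simp: F_def)
    then obtain \<epsilon> where \<epsilon>: "\<epsilon> > 0" and *: "\<forall>K. \<forall>\<delta>>0. \<exists>k. \<forall>n \<phi>. dense_weight n D \<delta> \<phi> \<longrightarrow>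
     forced n D {r. rank_le n F D K r} \<epsilon> k \<phi>" unfolding forcing_rank_def by blast
    have rank: "rank_le n F D 1 r" if "multilinear n D r" for n r
      using that False by (intro rank_le_product products_single) (auto simp: F_def)
    have "forced n D UNIV \<epsilon> k \<phi>" if "forced n D {r. rank_le n F D 1 r} \<epsilon> k \<phi>" for n k \<phi>
      using that rank unfolding forced_def by blast
    then have "\<forall>\<delta>>0. \<exists>k. \<forall>n \<phi>. dense_weight n D \<delta> \<phi> \<longrightarrow> forced n D UNIV \<epsilon> k \<phi>"
      using * by blast
    with \<epsilon> show ?thesis unfolding forcing_def by blast
  qed
qed

section \<open>Fourier analysis and simple subspaces\<close>

lemma tensor_add_self [simp]: "(x::tensor) + x = 0"
  by (auto simp: fun_eq_iff)

lemma finite_multi_indices [simp]: "finite I \<Longrightarrow> finite (multi_indices n I)"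
  by (auto simp: multi_indices_def intro: finite_PiE)

lemma tensor_spaceD: "x \<in> tensor_space n I \<Longrightarrow> j \<notin> multi_indices n I \<Longrightarrow> x j = 0"
  by (auto simp: tensor_space_def)

lemma tensor_space_add: "x \<in> tensor_space n I \<Longrightarrow> y \<in> tensor_space n I \<Longrightarrow> x + y \<in> tensor_space n I"
  by (auto simp: tensor_space_def)

lemma tensor_space_0 [simp]: "0 \<in> tensor_space n I"
  by (auto simp: tensor_space_def)

lemma subspace_tensor_space: "F2.subspace (tensor_space n I)"
  by (rule F2.subspaceI) (auto simp: tensor_space_def tensor_scale_def)

lemma finite_tensor_space [simp]:
  assumes "finite I" shows "finite (tensor_space n I)"
proof -
  have "tensor_space n I \<subseteq> (\<lambda>S j. if j \<in> S then 1 else 0) ` Pow (multi_indices n I)"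
  proof
    fix x assume x: "x \<in> tensor_space n I"
    have "x = (\<lambda>j. if j \<in> {j. x j = 1} then 1 else 0)"
      by (rule ext, rename_tac j, case_tac "x j") simp_all
    moreover have "{j. x j = 1} \<in> Pow (multi_indices n I)"
      using x by (force simp: tensor_space_def)
    ultimately show "x \<in> (\<lambda>S j. if j \<in> S then 1 else 0) ` Pow (multi_indices n I)"
      by (rule image_eqI)
  qed
  moreover have "finite (Pow (multi_indices n I))" using assms by simp
  ultimately show ?thesis by (meson finite_imageI finite_subset)
qed

section \<open>Characters of the tensor space\<close>

definition pairing :: "(nat \<Rightarrow> nat) \<Rightarrow> nat set \<Rightarrow> tensor \<Rightarrow> tensor \<Rightarrow> bit" where
  "pairing n I r x = (\<Sum>j\<in>multi_indices n I. r j * x j)"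

lemma pairing_add_left: "pairing n I (r + r') x = pairing n I r x + pairing n I r' x"
  by (simp add: pairing_def distrib_right sum.distrib)

lemma pairing_add_right: "pairing n I r (x + y) = pairing n I r x + pairing n I r y"
  by (simp add: pairing_def distrib_left sum.distrib)

lemma pairing_scale: "pairing n I r (tensor_scale c x) = c * pairing n I r x"
  by (simp add: pairing_def tensor_scale_def sum_distrib_left mult.left_commute)

lemma pairing_0 [simp]: "pairing n I r 0 = 0"
  by (simp add: pairing_def)

text \<open>Each condition lowers the dimension by at most one: over two elements, vectors violating
  it differ by vectors satisfying it, so a single one of them completes a basis of the kernel to a
  spanning set.\<close>

lemma dim_le_kernel:
  assumes W: "finite W" and S: "finite S" "F2.subspace W"
  shows "F2.dim W \<le> F2.dim {x\<in>W. \<forall>r\<in>S. pairing n I r x = 0} + card S"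
  using S(1)
proof (induction S rule: finite_induct)
  case empty
  then show ?case by simp
next
  case (insert r S)
  define K where "K = {x\<in>W. \<forall>r\<in>S. pairing n I r x = 0}"
  define L where "L = {x\<in>W. \<forall>r\<in>insert r S. pairing n I r x = 0}"
  have L: "L = {x\<in>K. pairing n I r x = 0}" by (auto simp: K_def L_def)
  have "F2.dim K \<le> F2.dim L + 1"
  proof (cases "K = L")
    case False
    then obtain w where "w \<in> K" "w \<notin> L" using L by blast
    then have w: "w \<in> K" "pairing n I r w = 1" by (auto simp: L bit_neq_0_iff)
    obtain b where b: "b \<subseteq> L" "F2.independent b" "L \<subseteq> F2.span b" "card b = F2.dim L"
      by (rule F2.basis_exists)
    have fb: "finite b" using b(1) W by (auto simp: L_def intro: finite_subset)
    have "K \<subseteq> F2.span (insert w b)"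
    proof
      fix x assume x: "x \<in> K"
      show "x \<in> F2.span (insert w b)"
      proof (cases "x \<in> L")
        case True
        then show ?thesis using b(3) F2.span_mono[of b "insert w b"] by blast
      next
        case False
        then have "pairing n I r x = 1" using x by (auto simp: L bit_neq_0_iff)
        then have "x + w \<in> L"
          using x w S(2) by (auto simp: L K_def pairing_add_right F2.subspace_def)
        then have "x + w \<in> F2.span (insert w b)" using b(3) F2.span_mono[of b "insert w b"] by blast
        moreover have "w \<in> F2.span (insert w b)" by (simp add: F2.span_base)
        ultimately have "(x + w) + w \<in> F2.span (insert w b)" by (rule F2.span_add)
        then show ?thesis by (simp add: add.assoc)
      qed
    qed
    from F2.dim_le_card[OF this] fb have "F2.dim K \<le> card (insert w b)" by simp
    also have "\<dots> \<le> card b + 1" using fb by (simp add: card_insert_if)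
    finally show ?thesis using b(4) by simp
  qed simp
  then show ?case using insert by (simp add: K_def L_def)
qed

lemma sum_chi_pairing:
  assumes D: "finite D" and x: "x \<in> tensor_space n D"
  shows "(\<Sum>r\<in>tensor_space n D. chi (pairing n D r x)) = of_bool (x = 0) * real (card (tensor_space n D))"
proof -
  have "(\<Sum>r\<in>tensor_space n D. chi (pairing n D r x)) =
      of_bool (\<forall>r\<in>tensor_space n D. pairing n D r x = 0) * real (card (tensor_space n D))"
    by (rule sum_chi_additive) (auto simp: pairing_add_left tensor_space_add)
  moreover have "(\<forall>r\<in>tensor_space n D. pairing n D r x = 0) \<longleftrightarrow> x = 0"
  proof
    assume *: "\<forall>r\<in>tensor_space n D. pairing n D r x = 0"
    show "x = 0"
    proof
      fix j
      show "x j = 0 j"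
      proof (cases "j \<in> multi_indices n D")
        case True
        define r :: tensor where "r = (\<lambda>i. if i = j then 1 else 0)"
        have "r \<in> tensor_space n D" using True by (auto simp: r_def tensor_space_def)
        then have "pairing n D r x = 0" using * by simp
        moreover have "pairing n D r x = x j"
          using True D by (simp add: pairing_def r_def if_distrib[of "\<lambda>c. c * _"] sum.delta cong: if_cong)
        ultimately show ?thesis by simp
      next
        case False
        then show ?thesis using tensor_spaceD[OF x] by simp
      qed
    qed
  qed simp
  ultimately show ?thesis by simp
qed

definition fourier :: "(nat \<Rightarrow> nat) \<Rightarrow> nat set \<Rightarrow> tensor set \<Rightarrow> tensor \<Rightarrow> real" where
  "fourier n D A r = (\<Sum>a\<in>A. chi (pairing n D r a))"

text \<open>Expand the squares and use orthogonality of characters. In characteristic 2,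
  \<open>a + a' + b = 0\<close> means \<open>a' = a + b\<close>.\<close>

lemma card_shift_fourier:
  assumes D: "finite D" and A: "A \<subseteq> tensor_space n D" and b: "b \<in> tensor_space n D"
  shows "real (card {a\<in>A. a + b \<in> A}) * real (card (tensor_space n D)) =
    (\<Sum>r\<in>tensor_space n D. (fourier n D A r)\<^sup>2 * chi (pairing n D r b))"
proof -
  let ?V = "tensor_space n D"
  have fA: "finite A" using A finite_tensor_space[OF D] finite_subset by blast
  have "(\<Sum>r\<in>?V. (fourier n D A r)\<^sup>2 * chi (pairing n D r b)) =
      (\<Sum>r\<in>?V. \<Sum>a\<in>A. \<Sum>a'\<in>A. chi (pairing n D r (a + a' + b)))"
    unfolding fourier_def power2_eq_square sum_product unfolding sum_distrib_right
    by (simp add: pairing_add_right chi_add)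
  also have "\<dots> = (\<Sum>a\<in>A. \<Sum>a'\<in>A. \<Sum>r\<in>?V. chi (pairing n D r (a + a' + b)))"
    by (subst sum.swap, rule sum.cong[OF refl], rule sum.swap)
  also have "\<dots> = (\<Sum>a\<in>A. \<Sum>a'\<in>A. of_bool (a' = a + b) * real (card ?V))"
  proof (intro sum.cong refl)
    fix a a' assume a: "a \<in> A" "a' \<in> A"
    have "a + a' + b \<in> ?V" using a A b tensor_space_add by blast
    moreover have "a + a' + b = 0 \<longleftrightarrow> a' = a + b"
      by (auto simp: fun_eq_iff bit_add_eq_iff add.assoc add.commute[of "a' _"])
    ultimately show "(\<Sum>r\<in>?V. chi (pairing n D r (a + a' + b))) = of_bool (a' = a + b) * real (card ?V)"
      using sum_chi_pairing[OF D] by simp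
  qed
  also have "\<dots> = (\<Sum>a\<in>A. of_bool (a + b \<in> A) * real (card ?V))"
  proof (rule sum.cong[OF refl])
    fix a
    have "(\<Sum>a'\<in>A. of_bool (a' = a + b) * real (card ?V)) =
        (\<Sum>a'\<in>A. if a' = a + b then real (card ?V) else 0)"
      by (intro sum.cong) auto
    also have "\<dots> = of_bool (a + b \<in> A) * real (card ?V)" using fA by (simp add: sum.delta')
    finally show "(\<Sum>a'\<in>A. of_bool (a' = a + b) * real (card ?V)) = of_bool (a + b \<in> A) * real (card ?V)" .
  qed
  also have "\<dots> = real (card {a\<in>A. a + b \<in> A}) * real (card ?V)"
    using fA by (simp flip: sum_distrib_right) (simp add: Int_def Collect_conj_eq[symmetric])
  finally show ?thesis by simp
qed

lemma sum_fourier_square: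
  assumes "finite D" "A \<subseteq> tensor_space n D"
  shows "(\<Sum>r\<in>tensor_space n D. (fourier n D A r)\<^sup>2) = real (card A) * real (card (tensor_space n D))"
  using card_shift_fourier[OF assms, of 0] by simp

text \<open>Average \<open>card {a\<in>A. a + h \<in> A}\<close> over \<open>h\<close> in
  \<open>H\<close>. In the Fourier expansion the characters from \<open>R\<close> are 1 on
  \<open>H\<close>, and all others contribute a nonnegative amount because \<open>H\<close> is a
  subspace. So the average is at least half of \<open>card A\<close>, and some element of
  \<open>A\<close> gives a translate of density one half.\<close>

lemma ex_dense_translate:
  assumes D: "finite D" and A: "A \<subseteq> tensor_space n D" "A \<noteq> {}"
    and H: "F2.subspace H" "H \<subseteq> tensor_space n D"
    and R: "R \<subseteq> tensor_space n D" "\<And>r x. r \<in> R \<Longrightarrow> x \<in> H \<Longrightarrow> pairing n D r x = 0"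
    and big: "(\<Sum>r\<in>R. (fourier n D A r)\<^sup>2) \<ge> 1 / 2 * (\<Sum>r\<in>tensor_space n D. (fourier n D A r)\<^sup>2)"
  shows "\<exists>a\<in>A. real (card (((+) a ` H) \<inter> A)) \<ge> 1 / 2 * real (card ((+) a ` H))"
proof (rule ccontr)
  assume no: "\<not> ?thesis"
  let ?V = "tensor_space n D" and ?f = "\<lambda>r. (fourier n D A r)\<^sup>2"
  have fV: "finite ?V" using D by simp
  have fA: "finite A" and fH: "finite H" and fR: "finite R" using A H R fV finite_subset by blast+
  have add: "x + y \<in> H" if "x \<in> H" "y \<in> H" for x y using H(1) that by (simp add: F2.subspace_def)
  have eq: "(\<Sum>h\<in>H. real (card {a\<in>A. a + h \<in> A})) * real (card ?V) =
      (\<Sum>r\<in>?V. ?f r * (\<Sum>h\<in>H. chi (pairing n D r h)))"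
  proof -
    have "(\<Sum>h\<in>H. real (card {a\<in>A. a + h \<in> A})) * real (card ?V) =
      (\<Sum>h\<in>H. \<Sum>r\<in>?V. ?f r * chi (pairing n D r h))"
    unfolding sum_distrib_right using H A D by (intro sum.cong refl card_shift_fourier) auto
    also have "\<dots> = (\<Sum>r\<in>?V. ?f r * (\<Sum>h\<in>H. chi (pairing n D r h)))"
      unfolding sum_distrib_left by (rule sum.swap)
    finally show ?thesis .
  qed
  have "1 / 2 * (real (card A) * real (card ?V)) * card H \<le> (\<Sum>r\<in>R. ?f r) * card H"
    using big by (intro mult_right_mono) (simp_all add: sum_fourier_square[OF D A(1)])
  also have "\<dots> = (\<Sum>r\<in>R. ?f r * (\<Sum>h\<in>H. chi (pairing n D r h)))"
    using R(2) by (simp add: sum_distrib_right)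
  also have "\<dots> \<le> (\<Sum>r\<in>?V. ?f r * (\<Sum>h\<in>H. chi (pairing n D r h)))"
  proof (rule sum_mono2[OF fV R(1)])
    fix r
    have "(\<Sum>h\<in>H. chi (pairing n D r h)) = of_bool (\<forall>h\<in>H. pairing n D r h = 0) * real (card H)"
      by (rule sum_chi_additive) (auto simp: pairing_add_right add)
    then show "0 \<le> ?f r * (\<Sum>h\<in>H. chi (pairing n D r h))" by simp
  qed
  finally have "1 / 2 * (real (card A) * real (card ?V)) * card H \<le>
      (\<Sum>h\<in>H. real (card {a\<in>A. a + h \<in> A})) * real (card ?V)" unfolding eq .
  then have "(1 / 2 * (real (card A) * card H)) * real (card ?V) \<le>
      (\<Sum>h\<in>H. real (card {a\<in>A. a + h \<in> A})) * real (card ?V)" by (simp add: mult_ac)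
  moreover have "card ?V > 0" using fV tensor_space_0 by (metis card_gt_0_iff empty_iff)
  ultimately have 1: "1 / 2 * (real (card A) * card H) \<le> (\<Sum>h\<in>H. real (card {a\<in>A. a + h \<in> A}))"
    by simp
  have "(\<Sum>h\<in>H. real (card {a\<in>A. a + h \<in> A})) = (\<Sum>h\<in>H. \<Sum>a\<in>A. of_bool (a + h \<in> A))"
    using fA by (intro sum.cong refl) (simp add: Int_def Collect_conj_eq[symmetric])
  also have "\<dots> = (\<Sum>a\<in>A. \<Sum>h\<in>H. of_bool (a + h \<in> A))" by (rule sum.swap)
  also have "\<dots> < (\<Sum>a\<in>A. 1 / 2 * real (card H))"
  proof (rule sum_strict_mono[OF fA A(2)])
    fix a assume a: "a \<in> A"
    have inj: "inj_on ((+) a) H" by (simp add: inj_on_def)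
    have "(\<Sum>h\<in>H. of_bool (a + h \<in> A)) = real (card {h\<in>H. a + h \<in> A})"
      using fH by (simp add: Int_def Collect_conj_eq[symmetric])
    also have "card {h\<in>H. a + h \<in> A} = card ((+) a ` {h\<in>H. a + h \<in> A})"
      by (rule card_image[symmetric]) (simp add: inj_on_def)
    also have "(+) a ` {h\<in>H. a + h \<in> A} = ((+) a ` H) \<inter> A" by auto
    also have "real (card (((+) a ` H) \<inter> A)) < 1 / 2 * real (card ((+) a ` H))" using no a by force
    also have "card ((+) a ` H) = card H" using inj by (rule card_image)
    finally show "(\<Sum>h\<in>H. of_bool (a + h \<in> A)) < 1 / 2 * real (card H)" .
  qed
  finally show False using 1 by simp
qed

section \<open>Annihilators of generators\<close>

definition unit_tuple :: "nat set \<Rightarrow> multi_index \<Rightarrow> tuple" where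
  "unit_tuple I j = (\<lambda>i l. if i \<in> I \<and> l = j i then 1 else 0)"

text \<open>The values of a form at unit tuples are its coefficients, so this is the space of
  tensors orthogonal to the generators whose coordinate set is exactly \<open>I\<close>. If there
  are none, it is the whole space.\<close>

definition annihilator :: "(nat \<Rightarrow> nat) \<Rightarrow> (nat set \<times> form) set \<Rightarrow> nat set \<Rightarrow> tensor set" where
  "annihilator n G I =
     {x\<in>tensor_space n I. \<forall>g. (I, g) \<in> G \<longrightarrow> pairing n I (\<lambda>j. g (unit_tuple I j)) x = 0}"

lemma subspace_annihilator: "F2.subspace (annihilator n G I)"
  using subspace_tensor_space[of n I] unfolding F2.subspace_def annihilator_def
  by (auto simp: pairing_add_right pairing_scale)

lemma codim_annihilator:
  assumes "finite I" "finite G"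
  shows "F2.dim (tensor_space n I) - F2.dim (annihilator n G I) \<le> card G"
proof -
  define S where "S = (\<lambda>p j. snd p (unit_tuple I j)) ` {p\<in>G. fst p = I}"
  have "annihilator n G I = {x\<in>tensor_space n I. \<forall>r\<in>S. pairing n I r x = 0}"
    by (force simp: annihilator_def S_def)
  moreover have "finite S" using assms by (simp add: S_def)
  then have "F2.dim (tensor_space n I) \<le>
      F2.dim {x\<in>tensor_space n I. \<forall>r\<in>S. pairing n I r x = 0} + card S"
    using assms by (intro dim_le_kernel subspace_tensor_space) auto
  moreover have "card S \<le> card G"
    unfolding S_def by (rule le_trans[OF card_image_le card_mono]) (use assms(2) in auto)
  ultimately show ?thesis by simp
qed

lemma sum_multi_indices_split:
  assumes "I \<subseteq> D"
  shows "(\<Sum>j\<in>multi_indices n D. F (restrict j I) * F' (restrict j (D - I))) =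
    (\<Sum>j\<in>multi_indices n I. F j) * (\<Sum>j\<in>multi_indices n (D - I). F' j :: bit)"
proof -
  have "(\<Sum>j\<in>multi_indices n I. F j) * (\<Sum>j\<in>multi_indices n (D - I). F' j) =
     (\<Sum>(j, j')\<in>multi_indices n I \<times> multi_indices n (D - I). F j * F' j')"
    by (simp add: sum_product sum.cartesian_product)
  also have "\<dots> = (\<Sum>j\<in>multi_indices n D. F (restrict j I) * F' (restrict j (D - I)))"
  proof (rule sum.reindex_bij_witness[of _ "\<lambda>j. (restrict j I, restrict j (D - I))"
        "\<lambda>(j, j') i. if i \<in> I then j i else j' i"])
    fix a assume a: "a \<in> multi_indices n I \<times> multi_indices n (D - I)"
    obtain j j' where jj: "a = (j, j')" "j \<in> multi_indices n I" "j' \<in> multi_indices n (D - I)"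
      using a by auto
    have 1: "restrict (\<lambda>i. if i \<in> I then j i else j' i) I = j"
      using jj by (auto simp: fun_eq_iff multi_indices_def PiE_def extensional_def)
    have 2: "restrict (\<lambda>i. if i \<in> I then j i else j' i) (D - I) = j'"
      using jj by (auto simp: fun_eq_iff multi_indices_def PiE_def extensional_def)
    show "(restrict (case a of (j, j') \<Rightarrow> \<lambda>i. if i \<in> I then j i else j' i) I,
        restrict (case a of (j, j') \<Rightarrow> \<lambda>i. if i \<in> I then j i else j' i) (D - I)) = a"
      using 1 2 jj by simp
    show "(case a of (j, j') \<Rightarrow> \<lambda>i. if i \<in> I then j i else j' i) \<in> multi_indices n D"
      using jj assms by (auto simp: multi_indices_def PiE_iff extensional_def)
    show "F (restrict (case a of (j, j') \<Rightarrow> \<lambda>i. if i \<in> I then j i else j' i) I) *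
        F' (restrict (case a of (j, j') \<Rightarrow> \<lambda>i. if i \<in> I then j i else j' i) (D - I)) =
        (case a of (j, j') \<Rightarrow> F j * F' j')"
      using 1 2 jj by simp
  next
    fix j assume j: "j \<in> multi_indices n D"
    then show "(case (restrict j I, restrict j (D - I)) of (j, j') \<Rightarrow> \<lambda>i. if i \<in> I then j i else j' i) = j"
      using assms by (auto simp: fun_eq_iff multi_indices_def PiE_iff extensional_def)
    show "(restrict j I, restrict j (D - I)) \<in> multi_indices n I \<times> multi_indices n (D - I)"
      using j assms by (auto simp: multi_indices_def PiE_iff extensional_def)
  qed
  finally show ?thesis by simp
qed

text \<open>By linearity it suffices to take the product of some \<open>y\<close> and
  \<open>z\<close>. There the pairing splits into the pairing of \<open>g\<close> with
  \<open>y\<close>, which is 0, and that of \<open>h\<close> with \<open>z\<close>.\<close>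

lemma pairing_annihilates:
  assumes D: "I \<subseteq> D" and g: "multilinear n I g" "(I, g) \<in> G" and h: "multilinear n (D - I) h"
    and x: "x \<in> subspace_tensor n I (D - I) (annihilator n G I) (tensor_space n (D - I))"
  shows "pairing n D (\<lambda>j. g (unit_tuple D j) * h (unit_tuple D j)) x = 0"
proof -
  define T where "T = {x. pairing n D (\<lambda>j. g (unit_tuple D j) * h (unit_tuple D j)) x = 0}"
  have "F2.subspace T" unfolding F2.subspace_def T_def by (auto simp: pairing_add_right pairing_scale)
  moreover have "tensor_mult n I (D - I) y z \<in> T" if y: "y \<in> annihilator n G I" for y z
  proof -
    have ID: "I \<union> (D - I) = D" using D by auto
    have ug: "g (unit_tuple D j) = g (unit_tuple I (restrict j I))" for j
      using D by (intro multilinear_cong[OF g(1)]) (auto simp: unit_tuple_def)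
    have uh: "h (unit_tuple D j) = h (unit_tuple (D - I) (restrict j (D - I)))" for j
      by (intro multilinear_cong[OF h]) (auto simp: unit_tuple_def)
    have "pairing n D (\<lambda>j. g (unit_tuple D j) * h (unit_tuple D j)) (tensor_mult n I (D - I) y z) =
      (\<Sum>j\<in>multi_indices n D. (\<lambda>j. g (unit_tuple I j) * y j) (restrict j I) *
        (\<lambda>j. h (unit_tuple (D - I) j) * z j) (restrict j (D - I)))"
      unfolding pairing_def
      by (intro sum.cong refl) (simp add: tensor_mult_def ID Un_absorb1[OF D] ug uh mult_ac)
    also have "\<dots> = (\<Sum>j\<in>multi_indices n I. g (unit_tuple I j) * y j) *
        (\<Sum>j\<in>multi_indices n (D - I). h (unit_tuple (D - I) j) * z j)"
      by (rule sum_multi_indices_split[OF D])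
    also have "(\<Sum>j\<in>multi_indices n I. g (unit_tuple I j) * y j) = 0"
      using y g(2) by (auto simp: annihilator_def pairing_def)
    finally show ?thesis by (simp add: T_def)
  qed
  ultimately have "F2.span {tensor_mult n I (D - I) y z |y z. y \<in> annihilator n G I \<and>
      z \<in> tensor_space n (D - I)} \<subseteq> T"
    by (intro F2.span_minimal) auto
  then show ?thesis using x by (auto simp: subspace_tensor_def T_def)
qed

lemma subspace_tensor_subset:
  assumes "I \<subseteq> D" shows "subspace_tensor n I (D - I) U W \<subseteq> tensor_space n D"
proof -
  have "I \<union> (D - I) = D" using assms by auto
  then show ?thesis unfolding subspace_tensor_def
    by (intro F2.span_minimal subspace_tensor_space) (auto simp: tensor_mult_def tensor_space_def)
qed

section \<open>Tensors as multilinear forms\<close>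

definition tensor_form :: "nat \<Rightarrow> (nat \<Rightarrow> nat) \<Rightarrow> tensor \<Rightarrow> form" where
  "tensor_form d n r u = pairing n {1..d} r (pure_tensor d n u)"

lemma tensor_form_eq: "tensor_form d n r u = (\<Sum>j\<in>multi_indices n {1..d}. r j * (\<Prod>i=1..d. u i (j i)))"
  unfolding tensor_form_def pairing_def by (intro sum.cong) (auto simp: pure_tensor_def)

lemma multilinear_tensor_form: "multilinear n {1..d} (tensor_form d n r)"
  unfolding tensor_form_eq[abs_def]
proof (intro multilinear_sum multilinear_cmult)
  fix j assume j: "j \<in> multi_indices n {1..d}"
  have "multilinear n E (\<lambda>u. \<Prod>i\<in>E. u i (j i))" if "finite E" "E \<subseteq> {1..d}" for E
    using that
  proof (induction E rule: finite_induct)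
    case empty
    then show ?case by simp
  next
    case (insert i E)
    have "j i < n i" using j insert.prems by (auto simp: multi_indices_def)
    then have "multilinear n ({i} \<union> E) (\<lambda>u. u i (j i) * (\<Prod>i\<in>E. u i (j i)))"
      using insert by (intro multilinear_mult multilinear_coord) auto
    then show ?case using insert.hyps by simp
  qed
  then show "multilinear n {1..d} (\<lambda>u. \<Prod>i=1..d. u i (j i))" by simp
qed

text \<open>Unit tuples recover the coefficients of \<open>r\<close>, so a representation of its
  form in an ideal translates into one of the pairing with \<open>r\<close>.\<close>

lemma tensor_form_unit:
  assumes "j \<in> multi_indices n {1..d}"
  shows "tensor_form d n r (unit_tuple {1..d} j) = r j"
proof -
  have "(\<Prod>i=1..d. unit_tuple {1..d} j i (j' i)) = (if j' = j then 1 else 0)"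
    if "j' \<in> multi_indices n {1..d}" for j'
  proof (cases "j' = j")
    case False
    have "\<exists>i\<in>{1..d}. j' i \<noteq> j i"
    proof (rule ccontr)
      assume "\<not> ?thesis"
      then have "j' = j" using that assms unfolding multi_indices_def by (intro PiE_ext) auto
      with False show False by simp
    qed
    then obtain i where "i \<in> {1..d}" "j' i \<noteq> j i" by blast
    then have "\<exists>i\<in>{1..d}. unit_tuple {1..d} j i (j' i) = 0"
      by (intro bexI[of _ i]) (auto simp: unit_tuple_def)
    then show ?thesis using False by simp
  qed (simp add: unit_tuple_def)
  then have "tensor_form d n r (unit_tuple {1..d} j) =
      (\<Sum>j'\<in>multi_indices n {1..d}. r j' * (if j' = j then 1 else 0))"
    unfolding tensor_form_eq by (intro sum.cong) auto
  also have "\<dots> = r j" using assms by (simp add: if_distrib[of "\<lambda>c. _ * c"] sum.delta cong: if_cong)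
  finally show ?thesis .
qed

text \<open>Multiplicities become distinct preimages. This turns a sub-multiset of the pure tensors
  into a set of tuples, to which weights apply.\<close>

lemma subset_image_mset_mset_set:
  assumes "finite X" "M \<subseteq># image_mset f (mset_set X)"
  shows "\<exists>S\<subseteq>X. M = image_mset f (mset_set S)"
  using assms
proof (induction X arbitrary: M rule: finite_induct)
  case empty
  then show ?case by simp
next
  case (insert x X)
  have M: "M \<subseteq># add_mset (f x) (image_mset f (mset_set X))" using insert by simp
  show ?case
  proof (cases "f x \<in># M")
    case True
    then have "M - {#f x#} \<subseteq># image_mset f (mset_set X)" using M
      by (metis add_mset_remove_trivial diff_subset_eq_self insert_DiffM mset_subset_eq_add_mset_cancel)
    from insert.IH[OF this] obtain S where S: "S \<subseteq> X" "M - {#f x#} = image_mset f (mset_set S)" by auto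
    have "x \<notin> S" "finite S" using S(1) insert.hyps finite_subset by auto
    moreover have "M = add_mset (f x) (M - {#f x#})" using True by simp
    ultimately have "M = image_mset f (mset_set (insert x S))" using S(2) by simp
    then show ?thesis using S(1) by (intro exI[of _ "insert x S"]) auto
  next
    case False
    have "M \<subseteq># image_mset f (mset_set X)"
    proof (rule mset_subset_eqI)
      fix a show "count M a \<le> count (image_mset f (mset_set X)) a"
        using mset_subset_eq_count[OF M, of a] False
        by (cases "a = f x") (simp_all add: not_in_iff)
    qed
    from insert.IH[OF this] show ?thesis by blast
  qed
qed

lemma bij_tuples_PiE:
  "bij_betw (\<lambda>u. restrict u I) (tuples n I) (\<Pi>\<^sub>E i\<in>I. vec_space (n i))"
proof (rule bij_betw_byWitness[where f' = "\<lambda>u i. if i \<in> I then u i else 0"])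
  show "\<forall>u\<in>tuples n I. (\<lambda>i. if i \<in> I then restrict u I i else 0) = u"
    by (auto simp: tuples_def fun_eq_iff)
  show "\<forall>u\<in>\<Pi>\<^sub>E i\<in>I. vec_space (n i). restrict (\<lambda>i. if i \<in> I then u i else 0) I = u"
    by (auto simp: fun_eq_iff PiE_iff extensional_def)
  show "(\<lambda>u. restrict u I) ` tuples n I \<subseteq> (\<Pi>\<^sub>E i\<in>I. vec_space (n i))"
    by (auto simp: vec_space_def tuplesD)
  show "(\<lambda>u i. if i \<in> I then u i else 0) ` (\<Pi>\<^sub>E i\<in>I. vec_space (n i)) \<subseteq> tuples n I"
    by (auto simp: tuples_def vec_space_def PiE_iff split: if_splits) (meson not_less)+
qed

lemma pure_tensor_restrict: "pure_tensor d n (restrict u {1..d}) = pure_tensor d n u"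
proof
  fix j
  have "(\<Prod>i=1..d. restrict u {1..d} i (j i)) = (\<Prod>i=1..d. u i (j i))" by (intro prod.cong) auto
  then show "pure_tensor d n (restrict u {1..d}) j = pure_tensor d n u j"
    by (simp only: pure_tensor_def)
qed

lemma pure_tensor_full_space: "pure_tensor d n u \<in> full_space d n"
  by (auto simp: pure_tensor_def tensor_space_def)

lemma simple_annihilator_intersection:
  assumes G: "generators n {1..d} G" "card G \<le> k" and t: "t \<in> full_space d n"
  shows "simple k d n ((+) t ` (\<Inter>I\<in>{I. I \<subseteq> {1..d} \<and> I \<noteq> {}}.
    subspace_tensor n I ({1..d} - I) (annihilator n G I) (tensor_space n ({1..d} - I))))"
  unfolding simple_def
proof (intro exI[of _ "annihilator n G"] conjI allI impI)
  fix I assume I: "I \<subseteq> {1..d} \<and> I \<noteq> {}"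
  show "F2.subspace (annihilator n G I)" by (rule subspace_annihilator)
  show "annihilator n G I \<subseteq> tensor_space n I" by (auto simp: annihilator_def)
  have "finite I" using I finite_subset by blast
  moreover have "finite G" using G(1) by (simp add: generators_def)
  ultimately show "F2.dim (tensor_space n I) - F2.dim (annihilator n G I) \<le> k"
    using codim_annihilator[of I G n] G(2) by linarith
qed (use t in blast)

text \<open>By \<open>card_shift_fourier\<close>, closedness bounds the average of
  \<open>c r\<close>, weighted by the squared Fourier coefficients, by
  \<open>\<epsilon> / 2 * card S\<close>. By Markov's inequality the \<open>r\<close> with
  \<open>c r > \<epsilon> * card S\<close> carry at most half of the squared coefficients.\<close>

lemma large_spectrum:
  fixes S :: "tuple set" and \<epsilon> :: real
  assumes D: "D = {1..d}" and A: "A \<subseteq> tensor_space n D" and S: "finite S" "S \<noteq> {}" and \<epsilon>: "\<epsilon> > 0"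
    and closed: "(\<Sum>s\<in>S. real (card {a\<in>A. a + pure_tensor d n s \<in> A})) \<ge> (1 - \<epsilon>) * card A * card S"
  shows "(\<Sum>r\<in>{r\<in>tensor_space n D. real (card {s\<in>S. tensor_form d n r s = 1}) \<le> \<epsilon> * card S}.
      (fourier n D A r)\<^sup>2) \<ge> 1 / 2 * (\<Sum>r\<in>tensor_space n D. (fourier n D A r)\<^sup>2)"
proof -
  let ?V = "tensor_space n D" and ?f = "\<lambda>r. (fourier n D A r)\<^sup>2"
  define c where "c r = real (card {s\<in>S. tensor_form d n r s = 1})" for r
  define R where "R = {r\<in>?V. c r \<le> \<epsilon> * card S}"
  have fD: "finite D" and fV: "finite ?V" using D by simp_all
  have cS: "real (card S) > 0" using S by (simp add: card_gt_0_iff)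
  define F where "F = (\<Sum>r\<in>?V. ?f r)"
  have Feq: "F = real (card A) * real (card ?V)" unfolding F_def by (rule sum_fourier_square[OF fD A])
  have "(1 - \<epsilon>) * card A * card S * real (card ?V) \<le>
      (\<Sum>s\<in>S. real (card {a\<in>A. a + pure_tensor d n s \<in> A})) * real (card ?V)"
    using closed by (intro mult_right_mono) auto
  also have "\<dots> = (\<Sum>s\<in>S. \<Sum>r\<in>?V. ?f r * chi (tensor_form d n r s))"
    unfolding sum_distrib_right
  proof (rule sum.cong[OF refl])
    fix s
    have "pure_tensor d n s \<in> ?V" using pure_tensor_full_space[of d n s] D by simp
    from card_shift_fourier[OF fD A this]
    show "real (card {a\<in>A. a + pure_tensor d n s \<in> A}) * real (card ?V) =
        (\<Sum>r\<in>?V. ?f r * chi (tensor_form d n r s))" by (simp add: tensor_form_def D)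
  qed
  also have "\<dots> = (\<Sum>r\<in>?V. ?f r * (\<Sum>s\<in>S. chi (tensor_form d n r s)))"
    unfolding sum_distrib_left by (rule sum.swap)
  also have "\<dots> = (\<Sum>r\<in>?V. ?f r * (card S - 2 * c r))"
  proof (intro sum.cong refl arg_cong2[where f = "(*)"])
    fix r
    have "(\<Sum>s\<in>S. chi (tensor_form d n r s)) = (\<Sum>s\<in>S. 1 - 2 * of_bool (tensor_form d n r s = 1))"
      by (simp add: chi_eq)
    also have "\<dots> = card S - 2 * c r"
      using S(1) by (simp add: sum_subtractf c_def Int_def Collect_conj_eq[symmetric] flip: sum_distrib_left)
    finally show "(\<Sum>s\<in>S. chi (tensor_form d n r s)) = card S - 2 * c r" .
  qed
  also have "\<dots> = F * card S - 2 * (\<Sum>r\<in>?V. ?f r * c r)"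
    unfolding F_def by (simp add: right_diff_distrib sum_subtractf sum_distrib_right sum_distrib_left mult_ac)
  finally have 1: "2 * (\<Sum>r\<in>?V. ?f r * c r) \<le> \<epsilon> * card S * F"
    unfolding Feq by (simp add: algebra_simps)
  have "\<epsilon> * card S * (\<Sum>r\<in>?V - R. ?f r) \<le> (\<Sum>r\<in>?V - R. ?f r * c r)"
    unfolding sum_distrib_left
  proof (rule sum_mono)
    fix r assume "r \<in> ?V - R"
    then have "\<epsilon> * card S \<le> c r" by (auto simp: R_def)
    then have "\<epsilon> * card S * ?f r \<le> c r * ?f r" by (rule mult_right_mono) simp
    then show "\<epsilon> * card S * ?f r \<le> ?f r * c r" by (simp only: mult.commute[of "c r"])
  qed
  also have "\<dots> \<le> (\<Sum>r\<in>?V. ?f r * c r)" using fV by (intro sum_mono2) (auto simp: c_def)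
  finally have "\<epsilon> * card S * (2 * (\<Sum>r\<in>?V - R. ?f r)) \<le> \<epsilon> * card S * F" using 1 by simp
  then have "2 * (\<Sum>r\<in>?V - R. ?f r) \<le> F" using cS \<epsilon> by simp
  moreover have "F = (\<Sum>r\<in>?V - R. ?f r) + (\<Sum>r\<in>R. ?f r)"
    unfolding F_def using fV by (intro sum.subset_diff) (auto simp: R_def)
  ultimately show ?thesis unfolding F_def R_def c_def by linarith
qed

theorem corollary1p11:
  fixes d :: nat
  assumes "d \<ge> 1"
  shows "\<exists>\<epsilon>::real. \<epsilon> > 0 \<and>
    (\<forall>\<delta>::real. \<delta> > 0 \<longrightarrow>
      (\<exists>k::nat. k \<ge> 1 \<and>
        (\<forall>(n :: nat \<Rightarrow> nat) (B' :: tensor multiset) (A :: tensor set).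
           (\<forall>i\<in>{1..d}. n i \<ge> 1) \<longrightarrow>
           B' \<subseteq># pure_tensors d n \<longrightarrow>
           real (size B') \<ge> \<delta> * real (size (pure_tensors d n)) \<longrightarrow>
           A \<subseteq> full_space d n \<longrightarrow>
           closed_wrt B' (1 - \<epsilon>) A \<longrightarrow>
           (\<exists>D. D \<subseteq> full_space d n \<and> simple k d n D \<and>
                real (card (D \<inter> A)) \<ge> 1 / 2 * real (card D)))))"
proof -
  define E where "E = {1..d}"
  have E: "finite E" "E \<noteq> {}" using assms by (auto simp: E_def)
  from forcing_all[OF E(1)] obtain \<epsilon> :: real where \<epsilon>: "\<epsilon> > 0" and force:
    "\<forall>\<delta>>0. \<exists>k. \<forall>n \<phi>. dense_weight n E \<delta> \<phi> \<longrightarrow> forced n E UNIV \<epsilon> k \<phi>"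
    unfolding forcing_def by blast
  show ?thesis
  proof (intro exI[of _ \<epsilon>] conjI \<epsilon> allI impI)
    fix \<delta> :: real assume \<delta>: "\<delta> > 0"
    with force obtain k where k: "\<And>n \<phi>. dense_weight n E \<delta> \<phi> \<Longrightarrow> forced n E UNIV \<epsilon> k \<phi>" by blast
    show "\<exists>k::nat. k \<ge> 1 \<and>
        (\<forall>(n :: nat \<Rightarrow> nat) (B' :: tensor multiset) (A :: tensor set).
           (\<forall>i\<in>{1..d}. n i \<ge> 1) \<longrightarrow>
           B' \<subseteq># pure_tensors d n \<longrightarrow>
           real (size B') \<ge> \<delta> * real (size (pure_tensors d n)) \<longrightarrow>
           A \<subseteq> full_space d n \<longrightarrow>
           closed_wrt B' (1 - \<epsilon>) A \<longrightarrow>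
           (\<exists>D. D \<subseteq> full_space d n \<and> simple k d n D \<and>
                real (card (D \<inter> A)) \<ge> 1 / 2 * real (card D)))"
    \<comment> \<open>The successor makes the bound positive when \<open>k\<close> is 0.\<close>
    proof (intro exI[of _ "Suc k"] conjI allI impI)
      fix n :: "nat \<Rightarrow> nat" and B' :: "tensor multiset" and A :: "tensor set"
      assume B': "B' \<subseteq># pure_tensors d n" "real (size B') \<ge> \<delta> * real (size (pure_tensors d n))"
        and A: "A \<subseteq> full_space d n" and closed: "closed_wrt B' (1 - \<epsilon>) A"
      let ?V = "tensor_space n E"
      have AV: "A \<subseteq> ?V" using A by (simp add: E_def)
      let ?P = "\<Pi>\<^sub>E i\<in>E. vec_space (n i)"
      have finP: "finite ?P" using E finite_vec_space by (simp add: finite_PiE)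
      have bij: "bij_betw (\<lambda>u. restrict u E) (tuples n E) ?P" by (rule bij_tuples_PiE)
      from subset_image_mset_mset_set[OF finP] B'(1) obtain S' where S': "S' \<subseteq> ?P"
        "B' = image_mset (pure_tensor d n) (mset_set S')"
        unfolding pure_tensors_def E_def[symmetric] by blast
      \<comment> \<open>The test points: zero-padded tuples whose pure tensors, one for each tuple,
        make up \<open>B'\<close>.\<close>
      define S where "S = {u\<in>tuples n E. restrict u E \<in> S'}"
      have fS: "finite S" using E(1) by (simp add: S_def)
      have bijS: "bij_betw (\<lambda>u. restrict u E) S S'"
        unfolding bij_betw_def
      proof
        show "inj_on (\<lambda>u. restrict u E) S"
          using bij by (auto simp: S_def bij_betw_def intro: inj_on_subset)
        show "(\<lambda>u. restrict u E) ` S = S'"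
        proof
          show "S' \<subseteq> (\<lambda>u. restrict u E) ` S"
          proof
            fix v assume v: "v \<in> S'"
            then have "v \<in> (\<lambda>u. restrict u E) ` tuples n E"
              using bij S'(1) unfolding bij_betw_def by blast
            then show "v \<in> (\<lambda>u. restrict u E) ` S" using v by (auto simp: S_def)
          qed
        qed (auto simp: S_def)
      qed
      have "B' = image_mset (pure_tensor d n) (image_mset (\<lambda>u. restrict u E) (mset_set S))"
        using S'(2) bijS by (simp add: bij_betw_def image_mset_mset_set)
      then have B'S: "B' = image_mset (pure_tensor d n) (mset_set S)"
        by (simp only: multiset.map_comp comp_def pure_tensor_restrict E_def)
      have sizeB': "size B' = card S" by (simp add: B'S)
      have sizeB: "size (pure_tensors d n) = card (tuples n E)"
        using bij_betw_same_card[OF bij] by (simp add: pure_tensors_def E_def)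
      have A0: "A \<noteq> {}" "finite A" and S0: "S \<noteq> {}"
        using closed by (auto simp: closed_wrt_def B'S)
      define \<phi> :: "tuple \<Rightarrow> real" where "\<phi> s = of_bool (s \<in> S)" for s
      have SS: "S \<subseteq> tuples n E" by (auto simp: S_def)
      have mass: "mass n E \<phi> = card S"
        unfolding mass_def \<phi>_def using E(1) SS by (simp add: Int_absorb1)
      have defect: "defect n E \<phi> r = card {s\<in>S. r s = 1}" for r
      proof -
        have "defect n E \<phi> r = (\<Sum>s\<in>tuples n E. of_bool (s \<in> S \<and> r s = 1))"
          unfolding defect_def \<phi>_def by (intro sum.cong) auto
        also have "\<dots> = card (tuples n E \<inter> {s. s \<in> S \<and> r s = 1})" using E(1) by simp
        also have "tuples n E \<inter> {s. s \<in> S \<and> r s = 1} = {s\<in>S. r s = 1}" using SS by auto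
        finally show ?thesis .
      qed
      have "dense_weight n E \<delta> \<phi>"
        using B'(2) by (simp add: dense_weight_def weight_def mass sizeB' sizeB) (simp add: \<phi>_def)
      from k[OF this] obtain G where G: "generators n E G" "card G \<le> k"
        and GI: "\<And>r. multilinear n E r \<Longrightarrow> defect n E \<phi> r \<le> \<epsilon> * mass n E \<phi> \<Longrightarrow> r \<in> ideal n E G"
        unfolding forced_def by blast
      \<comment> \<open>The large spectrum. Its forms have defect at most
        \<open>\<epsilon> * mass\<close> for the indicator weight of \<open>S\<close>, so they all
        lie in the ideal of \<open>G\<close>.\<close>
      define R where "R = {r\<in>?V. real (card {s\<in>S. tensor_form d n r s = 1}) \<le> \<epsilon> * card S}"
      \<comment> \<open>The simple subspace on which every element of the ideal of \<open>G\<close>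
        pairs to 0; a translate of it is the set sought.\<close>
      define H where "H = (\<Inter>I\<in>{I. I \<subseteq> E \<and> I \<noteq> {}}.
        subspace_tensor n I (E - I) (annihilator n G I) (tensor_space n (E - I)))"
      have HV: "H \<subseteq> ?V"
        unfolding H_def using subspace_tensor_subset[OF subset_refl, of n E] E(2) by blast
      have Hsub: "F2.subspace H"
        unfolding H_def subspace_tensor_def by (intro F2.subspace_Int F2.subspace_span)
      have RH: "pairing n E r x = 0" if r: "r \<in> R" and x: "x \<in> H" for r x
      proof -
        have "multilinear n E (tensor_form d n r)" unfolding E_def by (rule multilinear_tensor_form)
        then have "tensor_form d n r \<in> ideal n E G"
          using r by (intro GI) (simp_all add: R_def defect mass)
        then obtain h where h: "\<forall>p\<in>G. multilinear n (E - fst p) (h p)"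
          "tensor_form d n r = (\<lambda>u. \<Sum>p\<in>G. snd p u * h p u)" by (auto simp: ideal_def)
        have "pairing n E r x =
            (\<Sum>j\<in>multi_indices n E. \<Sum>p\<in>G. snd p (unit_tuple E j) * h p (unit_tuple E j) * x j)"
          unfolding pairing_def
        proof (rule sum.cong[OF refl])
          fix j assume "j \<in> multi_indices n E"
          then have "r j = tensor_form d n r (unit_tuple E j)"
            using tensor_form_unit[of j n d r] by (simp add: E_def)
          then show "r j * x j = (\<Sum>p\<in>G. snd p (unit_tuple E j) * h p (unit_tuple E j) * x j)"
            by (simp add: h(2) sum_distrib_right)
        qed
        also have "\<dots> = (\<Sum>p\<in>G. pairing n E (\<lambda>j. snd p (unit_tuple E j) * h p (unit_tuple E j)) x)"
          unfolding pairing_def by (rule sum.swap)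
        also have "\<dots> = 0"
        proof (intro sum.neutral ballI)
          fix p assume p: "p \<in> G"
          obtain I g where Ig: "p = (I, g)" by (cases p)
          have I: "I \<subseteq> E" "I \<noteq> {}" "multilinear n I g" using G(1) p by (auto simp: generators_def Ig)
          have "x \<in> subspace_tensor n I (E - I) (annihilator n G I) (tensor_space n (E - I))"
            using x I by (auto simp: H_def)
          moreover have "multilinear n (E - I) (h p)" using h(1) p Ig by auto
          ultimately show "pairing n E (\<lambda>j. snd p (unit_tuple E j) * h p (unit_tuple E j)) x = 0"
            using pairing_annihilates[OF I(1,3), of G "h p" x] p by (simp add: Ig)
        qed
        finally show ?thesis .
      qed
      have "(\<Sum>s\<in>S. real (card {a\<in>A. a + pure_tensor d n s \<in> A})) \<ge> (1 - \<epsilon>) * card A * card S"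
      proof -
        have "(\<Sum>a\<in>A. size {#b \<in># B'. a + b \<in> A#}) = (\<Sum>a\<in>A. card {s\<in>S. a + pure_tensor d n s \<in> A})"
          using fS by (simp add: B'S filter_mset_image_mset)
        also have "\<dots> = (\<Sum>s\<in>S. card {a\<in>A. a + pure_tensor d n s \<in> A})"
          using sum.swap_restrict[OF A0(2) fS, of "\<lambda>a s. 1 :: nat" "\<lambda>a s. a + pure_tensor d n s \<in> A"]
          by simp
        finally show ?thesis using closed by (simp add: closed_wrt_def sizeB')
      qed
      from large_spectrum[OF E_def AV fS S0 \<epsilon> this]
      have "(\<Sum>r\<in>R. (fourier n E A r)\<^sup>2) \<ge> 1 / 2 * (\<Sum>r\<in>?V. (fourier n E A r)\<^sup>2)"
        by (simp only: R_def)
      from ex_dense_translate[OF E(1) AV A0(1) Hsub HV _ RH this] obtain a where a: "a \<in> A"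
        "real (card (((+) a ` H) \<inter> A)) \<ge> 1 / 2 * real (card ((+) a ` H))" by (auto simp: R_def)
      have "(+) a ` H \<subseteq> full_space d n" using a(1) AV HV tensor_space_add unfolding E_def by blast
      moreover have "simple (Suc k) d n ((+) a ` H)"
        unfolding H_def E_def using G a(1) A by (intro simple_annihilator_intersection) (auto simp: E_def)
      ultimately show "\<exists>D. D \<subseteq> full_space d n \<and> simple (Suc k) d n D \<and>
          real (card (D \<inter> A)) \<ge> 1 / 2 * real (card D)" using a(2) by blast
    qed simp
  qed
qed

end
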